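(* Let $\mathfrak{g}$ be a finite-dimensional complex simple Lie algebra. Then: (a) $\operatorname{H}^i(\mathfrak{g}[t]^+,\mathbb{C})^{\mathfrak{g}} = 0$ for all $i\ge 1$. (b) The restriction map induces an isomorphism $\operatorname{H}^\bullet(\mathfrak{g}[t],\mathbb{C}) \cong \operatorname{H}^\bullet(\mathfrak{g},\mathbb{C})$.
   Context: $\mathfrak{g}[t]=\mathfrak{g}\otimes\mathbb{C}[t]$ is the current algebra with bracket $[x\otimes p,y\otimes q]=[x,y]\otimes pq$, and $\mathfrak{g}[t]^+=\mathfrak{g}\otimes t\mathbb{C}[t]$ is an ideal of it. $\mathfrak{g}$ is identified with $\mathfrak{g}\otimes 1\subset\mathfrak{g}[t]$ and acts on $\operatorname{H}^\bullet(\mathfrak{g}[t]^+,\mathbb{C})$ via the adjoint action on $\mathfrak{g}[t]^+$; the superscript $\mathfrak{g}$ denotes invariants. $\operatorname{H}^\bullet(\mathfrak{a},\mathbb{C})$ is Lie algebra cohomology with trivial coefficients. The restriction map $\operatorname{H}^\bullet(\mathfrak{g}[t],\mathbb{C})\to\operatorname{H}^\bullet(\mathfrak{g},\mathbb{C})$ is the one given by the inclusion $\mathfrak{g}\hookrightarrow\mathfrak{g}[t]$ (which is split by evaluation at $t=0$). *)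

theory Defs
  imports
    "HOL-Computational_Algebra.Polynomial"
    "HOL-Library.Function_Algebras"
    "HOL-Library.Set_Algebras"
begin

section \<open>Lie algebras\<close>

locale lie_algebra = vector_space scale
  for scale :: "'k::field \<Rightarrow> 'a::ab_group_add \<Rightarrow> 'a" +
  fixes bracket :: "'a \<Rightarrow> 'a \<Rightarrow> 'a"
  assumes bracket_add_left: "bracket (x + y) z = bracket x z + bracket y z"
    and bracket_add_right: "bracket x (y + z) = bracket x y + bracket x z"
    and bracket_scale_left: "bracket (scale c x) y = scale c (bracket x y)"
    and bracket_scale_right: "bracket x (scale c y) = scale c (bracket x y)"
    and bracket_self: "bracket x x = 0"
    and jacobi: "bracket x (bracket y z) + bracket y (bracket z x) + bracket z (bracket x y) = 0"

definition lie_ideal ::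
  "('k::field \<Rightarrow> 'a::ab_group_add \<Rightarrow> 'a) \<Rightarrow> ('a \<Rightarrow> 'a \<Rightarrow> 'a) \<Rightarrow> 'a set \<Rightarrow> bool"
  where "lie_ideal scale bracket I \<longleftrightarrow>
    module.subspace scale I \<and> (\<forall>x. \<forall>y\<in>I. bracket x y \<in> I)"

locale simple_lie_algebra = lie_algebra scale bracket
  for scale :: "'k::field \<Rightarrow> 'a::ab_group_add \<Rightarrow> 'a" and bracket :: "'a \<Rightarrow> 'a \<Rightarrow> 'a" +
  assumes not_abelian: "\<exists>x y. bracket x y \<noteq> 0"
    and ideal_trivial: "lie_ideal scale bracket I \<Longrightarrow> I = {0} \<or> I = UNIV"


section \<open>Chevalley--Eilenberg cohomology with trivial coefficients\<close>

text \<open>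
  The Lie algebra is a subalgebra \<open>L\<close> of an ambient Lie algebra with underlying type \<open>'a\<close>.
  An alternating \<open>n\<close>-linear form on \<open>L\<close> is a function on lists, extended by zero to all lists
  that are not of length \<open>n\<close> or have an entry outside \<open>L\<close>. Hence the forms of
  degree \<open>n\<close> are a subspace of a function space, with the pointwise vector space structure.
\<close>

definition cochains ::
  "('k::field \<Rightarrow> 'a::ab_group_add \<Rightarrow> 'a) \<Rightarrow> 'a set \<Rightarrow> nat \<Rightarrow> ('a list \<Rightarrow> 'k) set"
  where "cochains scale L n = {\<omega>.
    (\<forall>xs. \<not> (length xs = n \<and> set xs \<subseteq> L) \<longrightarrow> \<omega> xs = 0) \<and>
    (\<forall>xs. length xs = n \<and> set xs \<subseteq> L \<longrightarrow>
      (\<forall>i<n. \<forall>x\<in>L. \<forall>y\<in>L. \<omega> (xs[i := x + y]) = \<omega> (xs[i := x]) + \<omega> (xs[i := y])) \<and>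
      (\<forall>i<n. \<forall>c. \<forall>x\<in>L. \<omega> (xs[i := scale c x]) = c * \<omega> (xs[i := x])) \<and>
      (\<forall>j<n. \<forall>i<j. xs ! i = xs ! j \<longrightarrow> \<omega> xs = 0))}"

text \<open>
  In the summand for \<open>i < j\<close>, the term \<open>nths xs (- {i, j})\<close> is \<open>xs\<close> with its entries at
  positions \<open>i\<close> and \<open>j\<close> deleted. The degree need not be given: if \<open>\<omega>\<close> has degree \<open>n\<close>, then
  the value is zero on lists whose length is not \<open>n + 1\<close>.
\<close>

definition ce_differential ::
  "('a \<Rightarrow> 'a \<Rightarrow> 'a) \<Rightarrow> 'a set \<Rightarrow> ('a list \<Rightarrow> 'k::field) \<Rightarrow> 'a list \<Rightarrow> 'k"
  where "ce_differential bracket L \<omega> xs =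
    (if set xs \<subseteq> L
     then \<Sum>j<length xs. \<Sum>i<j.
       (-1) ^ (i + j) * \<omega> (bracket (xs ! i) (xs ! j) # nths xs (- {i, j}))
     else 0)"

definition cocycles ::
  "('k::field \<Rightarrow> 'a::ab_group_add \<Rightarrow> 'a) \<Rightarrow> ('a \<Rightarrow> 'a \<Rightarrow> 'a) \<Rightarrow> 'a set \<Rightarrow> nat \<Rightarrow> ('a list \<Rightarrow> 'k) set"
  where "cocycles scale bracket L n =
    {\<omega> \<in> cochains scale L n. ce_differential bracket L \<omega> = 0}"

fun coboundaries ::
  "('k::field \<Rightarrow> 'a::ab_group_add \<Rightarrow> 'a) \<Rightarrow> ('a \<Rightarrow> 'a \<Rightarrow> 'a) \<Rightarrow> 'a set \<Rightarrow> nat \<Rightarrow> ('a list \<Rightarrow> 'k) set"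
  where
    "coboundaries scale bracket L 0 = {0}"
  | "coboundaries scale bracket L (Suc n) = ce_differential bracket L ` cochains scale L n"

text \<open>
  Cohomology classes are the cosets \<open>\<omega> +o B\<close> of cocycles modulo the coboundaries \<open>B\<close>; the zero
  class is \<open>B\<close> itself. Classes are added as sets.
\<close>

definition cohomology ::
  "('k::field \<Rightarrow> 'a::ab_group_add \<Rightarrow> 'a) \<Rightarrow> ('a \<Rightarrow> 'a \<Rightarrow> 'a) \<Rightarrow> 'a set \<Rightarrow> nat \<Rightarrow> ('a list \<Rightarrow> 'k) set set"
  where "cohomology scale bracket L n =
    (\<lambda>\<omega>. \<omega> +o coboundaries scale bracket L n) ` cocycles scale bracket L n"

text \<open>
  The map of quotients induced by a linear map \<open>f\<close>, where \<open>B\<close> is the subspace that is divided out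
  in the codomain: if \<open>f\<close> maps \<open>B'\<close> into \<open>B\<close>, then the class \<open>\<omega> +o B'\<close> is sent to \<open>f \<omega> +o B\<close>.
\<close>

definition on_classes :: "'w::plus set \<Rightarrow> ('v \<Rightarrow> 'w) \<Rightarrow> 'v set \<Rightarrow> 'w set"
  where "on_classes B f X = f ` X + B"

definition class_scale :: "('a list \<Rightarrow> 'k::field) set \<Rightarrow> 'k \<Rightarrow> ('a list \<Rightarrow> 'k) set \<Rightarrow> ('a list \<Rightarrow> 'k) set"
  where "class_scale B c = on_classes B (\<lambda>\<omega> xs. c * \<omega> xs)"

definition linear_iso ::
  "('k \<Rightarrow> 'u::plus \<Rightarrow> 'u) \<Rightarrow> 'u set \<Rightarrow> ('k \<Rightarrow> 'v::plus \<Rightarrow> 'v) \<Rightarrow> 'v set \<Rightarrow> ('u \<Rightarrow> 'v) \<Rightarrow> bool"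
  where "linear_iso s1 U s2 V f \<longleftrightarrow> bij_betw f U V \<and>
    (\<forall>x\<in>U. \<forall>y\<in>U. f (x + y) = f x + f y) \<and>
    (\<forall>c. \<forall>x\<in>U. f (s1 c x) = s2 c (f x))"

definition pullback :: "'a set \<Rightarrow> ('a \<Rightarrow> 'b) \<Rightarrow> ('b list \<Rightarrow> 'k::zero) \<Rightarrow> 'a list \<Rightarrow> 'k"
  where "pullback L \<phi> \<omega> xs = (if set xs \<subseteq> L then \<omega> (map \<phi> xs) else 0)"

text \<open>
  For an ideal \<open>L\<close>, the action on cochains of \<open>L\<close> that is dual to the adjoint action of an
  element \<open>x\<close> of the ambient Lie algebra on \<open>L\<close>.
\<close>

definition cochain_action ::
  "('a \<Rightarrow> 'a \<Rightarrow> 'a) \<Rightarrow> 'a set \<Rightarrow> 'a \<Rightarrow> ('a list \<Rightarrow> 'k::field) \<Rightarrow> 'a list \<Rightarrow> 'k"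
  where "cochain_action bracket L x \<omega> ys =
    (if set ys \<subseteq> L then - (\<Sum>i<length ys. \<omega> (ys[i := bracket x (ys ! i)])) else 0)"

definition cohomology_invariants ::
  "('k::field \<Rightarrow> 'a::ab_group_add \<Rightarrow> 'a) \<Rightarrow> ('a \<Rightarrow> 'a \<Rightarrow> 'a) \<Rightarrow> 'a set \<Rightarrow> 'a set \<Rightarrow> nat
    \<Rightarrow> ('a list \<Rightarrow> 'k) set set"
  where "cohomology_invariants scale bracket S L n =
    {X \<in> cohomology scale bracket L n. \<forall>x\<in>S.
      on_classes (coboundaries scale bracket L n) (cochain_action bracket L x) X
        = coboundaries scale bracket L n}"


section \<open>Current algebras\<close>

text \<open>
  The tensor product of a Lie algebra \<open>\<gg>\<close> with the ring of polynomials in \<open>t\<close> is realised as the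
  type of polynomials with coefficients in \<open>\<gg>\<close>: \<open>monom x n\<close> is the tensor of \<open>x\<close> and \<open>t ^ n\<close>, and
  \<open>[:x:]\<close> is the tensor of \<open>x\<close> and \<open>1\<close>.
\<close>

definition current_scale ::
  "('k::field \<Rightarrow> 'a::ab_group_add \<Rightarrow> 'a) \<Rightarrow> 'k \<Rightarrow> 'a poly \<Rightarrow> 'a poly"
  where "current_scale scale c = map_poly (scale c)"

definition current_bracket ::
  "('a::ab_group_add \<Rightarrow> 'a \<Rightarrow> 'a) \<Rightarrow> 'a poly \<Rightarrow> 'a poly \<Rightarrow> 'a poly"
  where "current_bracket bracket p q =
    (\<Sum>i\<le>degree p. \<Sum>j\<le>degree q. monom (bracket (coeff p i) (coeff q j)) (i + j))"

definition constant_currents :: "'a::ab_group_add poly set"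
  where "constant_currents = range (\<lambda>x. [:x:])"

definition positive_currents :: "'a::ab_group_add poly set"
  where "positive_currents = {p. coeff p 0 = 0}"

definition pure_tensor :: "('k::field \<Rightarrow> 'a::ab_group_add \<Rightarrow> 'a) \<Rightarrow> 'a \<Rightarrow> 'k poly \<Rightarrow> 'a poly"
  where "pure_tensor scale x = map_poly (\<lambda>c. scale c x)"

context lie_algebra
begin

lemma bracket_zero_left [simp]: "bracket 0 y = 0"
  using bracket_add_left[of 0 0 y] by simp

lemma bracket_zero_right [simp]: "bracket x 0 = 0"
  using bracket_add_right[of x 0 0] by simp

lemma bracket_antisym: "bracket x y = - bracket y x"
proof -
  have "bracket (x + y) (x + y) = bracket x y + bracket y x"
    unfolding bracket_add_left bracket_add_right by (simp add: bracket_self)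
  then show ?thesis by (simp add: bracket_self eq_neg_iff_add_eq_0)
qed

lemma coeff_current_scale [simp]: "coeff (current_scale scale c p) n = scale c (coeff p n)"
  by (simp add: current_scale_def coeff_map_poly)

lemma coeff_pure_tensor [simp]: "coeff (pure_tensor scale x p) n = scale (coeff p n) x"
  by (simp add: pure_tensor_def coeff_map_poly)

lemma current_bracket_bounded:
  assumes "degree p \<le> m" "degree q \<le> n"
  shows "current_bracket bracket p q =
    (\<Sum>i\<le>m. \<Sum>j\<le>n. monom (bracket (coeff p i) (coeff q j)) (i + j))"
proof -
  have "(\<Sum>i\<le>m. \<Sum>j\<le>n. monom (bracket (coeff p i) (coeff q j)) (i + j)) =
    (\<Sum>i\<le>degree p. \<Sum>j\<le>n. monom (bracket (coeff p i) (coeff q j)) (i + j))"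
    using assms by (intro sum.mono_neutral_right) (auto simp: coeff_eq_0)
  also have "\<dots> = (\<Sum>i\<le>degree p. \<Sum>j\<le>degree q. monom (bracket (coeff p i) (coeff q j)) (i + j))"
    using assms by (intro sum.cong refl sum.mono_neutral_right) (auto simp: coeff_eq_0)
  finally show ?thesis by (simp add: current_bracket_def)
qed

lemma current_bracket_add_left:
  "current_bracket bracket (p + q) r = current_bracket bracket p r + current_bracket bracket q r"
proof -
  define m where "m = max (degree p) (degree q)"
  have "degree p \<le> m" "degree q \<le> m" "degree (p + q) \<le> m"
    by (auto simp: m_def intro: degree_add_le)
  then show ?thesis
    by (simp add: current_bracket_bounded[where m = m and n = "degree r"] bracket_add_left
        add_monom[symmetric] sum.distrib)
qed

lemma current_bracket_add_right:
  "current_bracket bracket p (q + r) = current_bracket bracket p q + current_bracket bracket p r"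
proof -
  define m where "m = max (degree q) (degree r)"
  have "degree q \<le> m" "degree r \<le> m" "degree (q + r) \<le> m"
    by (auto simp: m_def intro: degree_add_le)
  then show ?thesis
    by (simp add: current_bracket_bounded[where n = m and m = "degree p"] bracket_add_right
        add_monom[symmetric] sum.distrib)
qed

lemma current_bracket_monom:
  "current_bracket bracket (monom x m) (monom y n) = monom (bracket x y) (m + n)"
proof -
  have "current_bracket bracket (monom x m) (monom y n) =
    (\<Sum>i\<le>m. \<Sum>j\<le>n. if j = n then if i = m then monom (bracket x y) (m + n) else 0 else 0)"
    unfolding current_bracket_bounded[OF degree_monom_le degree_monom_le]
    by (intro sum.cong refl) auto
  then show ?thesis by simp
qed

lemma current_poly_induct [case_names monom add]:
  fixes p :: "'a poly"
  assumes m: "\<And>x n. P (monom x n)" and a: "\<And>p q. P p \<Longrightarrow> P q \<Longrightarrow> P (p + q)"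
  shows "P p"
proof -
  have "P (\<Sum>i\<in>A. monom (coeff p i) i)" if "finite A" for A
    using that m[of 0 0] by induction (auto intro: m a)
  from this[of "{..degree p}"] show ?thesis by (simp add: poly_as_sum_of_monoms)
qed

lemma current_scale_add:
  "current_scale scale c (p + q) = current_scale scale c p + current_scale scale c q"
  by (rule poly_eqI) (simp add: scale_right_distrib)

lemma current_scale_monom: "current_scale scale c (monom x n) = monom (scale c x) n"
  by (rule poly_eqI) simp

lemma current_bracket_scale_left:
  "current_bracket bracket (current_scale scale c p) q = current_scale scale c (current_bracket bracket p q)"
proof (induction p rule: current_poly_induct)
  case (monom x m)
  show ?case
    by (induction q rule: current_poly_induct)
      (simp_all add: current_bracket_monom current_scale_monom current_bracket_add_right
        current_scale_add bracket_scale_left)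
qed (simp add: current_bracket_add_left current_scale_add)

lemma current_bracket_antisym:
  "current_bracket bracket p q = - current_bracket bracket q p"
proof (induction p rule: current_poly_induct)
  case (monom x m)
  show ?case
  proof (induction q rule: current_poly_induct)
    case (monom y n)
    show ?case
      unfolding current_bracket_monom minus_monom
      using bracket_antisym[of x y] by (simp add: add.commute)
  qed (simp add: current_bracket_add_left current_bracket_add_right)
qed (simp add: current_bracket_add_left current_bracket_add_right)

lemma current_scale_minus: "current_scale scale c (- p) = - current_scale scale c p"
  by (rule poly_eqI) simp

lemma current_bracket_self: "current_bracket bracket p p = 0"
proof (induction p rule: current_poly_induct)
  case (monom x n)
  show ?case by (simp add: current_bracket_monom bracket_self)
next
  case (add p q)
  then show ?case
    using current_bracket_antisym[of p q]
    by (simp add: current_bracket_add_left current_bracket_add_right)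
qed

lemma current_jacobi:
  "current_bracket bracket p (current_bracket bracket q r) +
   current_bracket bracket q (current_bracket bracket r p) +
   current_bracket bracket r (current_bracket bracket p q) = 0"
proof (induction p rule: current_poly_induct)
  case (monom x l)
  show ?case
  proof (induction q rule: current_poly_induct)
    case (monom y m)
    show ?case
    proof (induction r rule: current_poly_induct)
      case (monom z n)
      show ?case
        using jacobi[of x y z] by (simp add: current_bracket_monom add_monom ac_simps)
    next
      case (add p q)
      from arg_cong2[where f = "(+)", OF add] show ?case
        by (simp add: current_bracket_add_left current_bracket_add_right ac_simps)
    qed
  next
    case (add p q)
    from arg_cong2[where f = "(+)", OF add] show ?case
      by (simp add: current_bracket_add_left current_bracket_add_right ac_simps)
  qed
next
  case (add p q)
  from arg_cong2[where f = "(+)", OF add] show ?case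
    by (simp add: current_bracket_add_left current_bracket_add_right ac_simps)
qed

theorem lie_algebra_current: "lie_algebra (current_scale scale) (current_bracket bracket)"
proof
  fix c d :: 'k and p q r :: "'a poly"
  show "current_scale scale c (p + q) = current_scale scale c p + current_scale scale c q"
    by (rule current_scale_add)
  show "current_scale scale (c + d) p = current_scale scale c p + current_scale scale d p"
    by (rule poly_eqI) (simp add: scale_left_distrib)
  show "current_scale scale c (current_scale scale d p) = current_scale scale (c * d) p"
    by (rule poly_eqI) simp
  show "current_scale scale 1 p = p"
    by (rule poly_eqI) simp
  show "current_bracket bracket p (current_scale scale c q) = current_scale scale c (current_bracket bracket p q)"
    using current_bracket_antisym[of p q] current_bracket_antisym[of p "current_scale scale c q"]
    by (simp add: current_bracket_scale_left current_scale_minus)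
qed (rule current_bracket_add_left current_bracket_add_right current_bracket_scale_left
      current_bracket_self current_jacobi)+

theorem current_bracket_pure_tensor:
  "current_bracket bracket (pure_tensor scale x p) (pure_tensor scale y q) =
   pure_tensor scale (bracket x y) (p * q)"
proof (rule poly_eqI)
  fix n
  have "current_bracket bracket (pure_tensor scale x p) (pure_tensor scale y q) =
    (\<Sum>i\<le>degree p. \<Sum>j\<le>degree q. monom (scale (coeff p i * coeff q j) (bracket x y)) (i + j))"
    by (subst current_bracket_bounded[of _ "degree p" _ "degree q"])
      (auto simp: pure_tensor_def map_poly_degree_leq bracket_scale_left bracket_scale_right
        coeff_map_poly mult.commute)
  also have "coeff \<dots> n =
    scale (\<Sum>i\<le>degree p. \<Sum>j\<le>degree q. coeff (monom (coeff p i * coeff q j) (i + j)) n) (bracket x y)"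
    by (simp add: coeff_sum scale_sum_left if_distrib[of "\<lambda>c. scale c _"] cong: if_cong)
  also have "(\<Sum>i\<le>degree p. \<Sum>j\<le>degree q. coeff (monom (coeff p i * coeff q j) (i + j)) n) =
      coeff ((\<Sum>i\<le>degree p. monom (coeff p i) i) * (\<Sum>j\<le>degree q. monom (coeff q j) j)) n"
    unfolding sum_product mult_monom coeff_sum ..
  finally show "coeff (current_bracket bracket (pure_tensor scale x p) (pure_tensor scale y q)) n =
      coeff (pure_tensor scale (bracket x y) (p * q)) n"
    by (simp add: poly_as_sum_of_monoms)
qed

theorem lie_ideal_positive_currents:
  "lie_ideal (current_scale scale) (current_bracket bracket) positive_currents"
proof -
  interpret current: lie_algebra "current_scale scale" "current_bracket bracket"
    by (rule lie_algebra_current)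
  have "coeff (current_bracket bracket p q) 0 = 0" if "coeff q 0 = 0" for p q
    using that by (auto simp: current_bracket_def coeff_sum intro!: sum.neutral)
  then show ?thesis
    by (auto simp: lie_ideal_def positive_currents_def current.subspace_def)
qed

end

end

theory Submission
  imports Defs "HOL-Computational_Algebra.Fundamental_Theorem_Algebra"
begin

text \<open>
  Let \<open>\<Omega> = \<Sum>b. b \<otimes> b\<^sup>*\<close> be the Casimir element of the Killing form. The cobracket
  \<open>\<delta>(x t\<^sup>n) = \<Sum>k=1..n. \<Sum>b. b t\<^sup>k \<and> [b\<^sup>*, x] t\<^bsup>n-k\<^esup>\<close> of the current algebra is a 1-cocycle, and
  its composite with the bracket is the Euler derivation \<open>t d/dt\<close>, because \<open>\<Omega>\<close> acts on the
  adjoint representation as the identity. Hence the transpose \<open>h\<close> of \<open>\<delta>\<close> satisfies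
  \<open>d h + h d = - L\<close>, where \<open>L\<close> is the action of \<open>t d/dt\<close>. Integrating along the dilations
  \<open>t \<mapsto> s t\<close>, \<open>0 \<le> s \<le> 1\<close>, turns \<open>h\<close> into a homotopy between the identity and the pullback along
  evaluation at \<open>t = 0\<close>, which gives (b).

  For (a), extend a cocycle \<open>\<omega>\<close> on the positive currents by zero on constants. Then \<open>h d \<omega>\<close> restricts
  to \<open>- \<Sum>b. L\<^sub>b L\<^sub>b\<^sub>* \<omega>\<close>, which is a coboundary as soon as every \<open>L\<^sub>x \<omega>\<close> is one; no complete
  reducibility is needed.

  The Killing form is nondegenerate by Cartan's criterion: if it vanishes, replacing the eigenvalues
  of \<open>ad x\<close> by their conjugates gives a derivation \<open>s\<close> with \<open>tr (s \<circ> ad x) = 0\<close>, so the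
  eigenvalues vanish and Engel's theorem yields a nonzero centre.
\<close>

section \<open>Calculus of alternating forms\<close>

text \<open>Two obstacles shape the argument. The cobracket has infinitely many modes b t^k,
  although only finitely many of them contribute on a given polynomial; its identities are therefore
  proved for truncated sums under a degree bound and then glued. Moreover, a form on the current
  algebra may have nonzero components in infinitely many t-degrees, so L is not inverted by dividing
  each component by its weight: for a fixed list of arguments the dependence on the dilation
  parameter s is polynomial, and the division takes place in that polynomial. The range k = 1..n of
  the modes, asymmetric in the two legs, does two jobs. It has exactly n terms, which gives t d/dt.
  It also keeps the first leg in the positive currents, so when the differential of the extended
  cocycle in (a) is contracted with the cobracket, an entry x t^n contributes only through k = n,
  where the second leg becomes constant. These surviving terms form the Casimir operator.\<close>

lemma cochains_0 [simp]: "0 \<in> cochains scale L n"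
  by (simp add: cochains_def)

lemma cochains_add:
  assumes "\<omega> \<in> cochains scale L n" "\<eta> \<in> cochains scale L n"
  shows "\<omega> + \<eta> \<in> cochains scale L n"
  using assms unfolding cochains_def by (auto simp: algebra_simps)

lemma cochains_mult:
  assumes "\<omega> \<in> cochains scale L n"
  shows "(\<lambda>xs. c * \<omega> xs) \<in> cochains scale L n"
  using assms unfolding cochains_def by (auto simp: algebra_simps)

lemma cochains_uminus:
  assumes "\<omega> \<in> cochains scale L n"
  shows "- \<omega> \<in> cochains scale L n"
proof -
  have "- \<omega> = (\<lambda>xs. (-1) * \<omega> xs)" by (simp add: fun_eq_iff)
  then show ?thesis using cochains_mult[OF assms, of "-1"] by simp
qed

lemma cochains_sum:
  assumes "\<And>a. a \<in> I \<Longrightarrow> \<omega> a \<in> cochains scale L n"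
  shows "(\<lambda>xs. \<Sum>a\<in>I. \<omega> a xs) \<in> cochains scale L n"
proof (cases "finite I")
  case True
  then show ?thesis using assms
  proof (induction I)
    case empty
    then show ?case using cochains_0[of scale L n] by (simp add: zero_fun_def)
  next
    case (insert a I)
    then show ?case
      using cochains_add[of "\<omega> a" scale L n "\<lambda>xs. \<Sum>a\<in>I. \<omega> a xs"] by (simp add: plus_fun_def)
  qed
next
  case False
  then show ?thesis using cochains_0[of scale L n] by (simp add: zero_fun_def)
qed

section \<open>Interior products and the slotwise action of operators on forms\<close>

definition ins :: "'a \<Rightarrow> ('a list \<Rightarrow> 'k) \<Rightarrow> 'a list \<Rightarrow> 'k"
  where "ins p \<omega> xs = \<omega> (p # xs)"

text \<open>The derivation extension of \<open>T\<close>, without the minus sign of a dual action: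
  for \<open>T = bracket p\<close> it is the negative of the Lie derivative along
  \<open>p\<close>.\<close>

definition slot_sum :: "('a \<Rightarrow> 'a) \<Rightarrow> ('a list \<Rightarrow> 'k::comm_monoid_add) \<Rightarrow> 'a list \<Rightarrow> 'k"
  where "slot_sum T \<omega> xs = (\<Sum>i<length xs. \<omega> (xs[i := T (xs ! i)]))"

lemma slot_sum_Nil [simp]: "slot_sum T \<omega> [] = 0"
  by (simp add: slot_sum_def)

lemma slot_sum_Cons: "slot_sum T \<omega> (p # xs) = slot_sum T (ins p \<omega>) xs + \<omega> (T p # xs)"
  by (simp add: slot_sum_def sum.lessThan_Suc_shift ins_def add.commute del: sum.lessThan_Suc)

lemma ins_slot_sum: "ins p (slot_sum T \<omega>) = slot_sum T (ins p \<omega>) + ins (T p) \<omega>"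
  by (simp add: fun_eq_iff slot_sum_Cons ins_def)

lemma slot_sum_zero [simp]: "slot_sum T 0 = 0"
  by (simp add: slot_sum_def fun_eq_iff)

lemma slot_sum_add: "slot_sum T (\<omega> + \<eta>) = slot_sum T \<omega> + slot_sum T \<eta>"
  by (simp add: slot_sum_def fun_eq_iff sum.distrib)

lemma slot_sum_sum: "slot_sum T (\<lambda>xs. \<Sum>a\<in>I. \<omega> a xs) xs = (\<Sum>a\<in>I. slot_sum T (\<omega> a) xs)"
  unfolding slot_sum_def by (rule sum.swap)

lemma slot_sum_uminus: "slot_sum T (- \<omega>) = - slot_sum T (\<omega> :: 'a list \<Rightarrow> 'k::ab_group_add)"
  by (simp add: slot_sum_def fun_eq_iff sum_negf)

lemma ins_zero [simp]: "ins p 0 = 0"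
  by (simp add: ins_def fun_eq_iff)

lemma ins_uminus: "ins p (- \<omega>) = - ins p \<omega>"
  by (simp add: ins_def fun_eq_iff)

lemma slot_sum_diff: "slot_sum T (\<omega> - \<eta>) = slot_sum T \<omega> - slot_sum T (\<eta> :: 'a list \<Rightarrow> 'k::ab_group_add)"
  by (simp add: slot_sum_def fun_eq_iff sum_subtractf)

lemma ins_diff: "ins p (\<omega> - \<eta>) = ins p \<omega> - ins p \<eta>"
  by (simp add: ins_def fun_eq_iff)

lemma ce_differential_add:
  "ce_differential b L (\<omega> + \<eta>) = ce_differential b L \<omega> + ce_differential b L \<eta>"
  by (simp add: ce_differential_def fun_eq_iff sum.distrib algebra_simps)

lemma ce_differential_mult:
  "ce_differential b L (\<lambda>xs. c * \<omega> xs) = (\<lambda>xs. c * ce_differential b L \<omega> xs)"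
  by (simp add: ce_differential_def fun_eq_iff sum_distrib_left mult.left_commute)

lemma ce_differential_uminus: "ce_differential b L (- \<omega>) = - ce_differential b L \<omega>"
  by (simp add: ce_differential_def fun_eq_iff sum_negf)

lemma ce_differential_diff:
  "ce_differential b L (\<omega> - \<eta>) = ce_differential b L \<omega> - ce_differential b L \<eta>"
  using ce_differential_add[of b L \<omega> "- \<eta>"] by (simp add: ce_differential_uminus)

lemma ce_differential_zero [simp]: "ce_differential b L 0 = 0"
  by (simp add: ce_differential_def fun_eq_iff)

lemma ce_differential_sum:
  "ce_differential b L (\<lambda>xs. \<Sum>a\<in>I. \<omega> a xs) xs = (\<Sum>a\<in>I. ce_differential b L (\<omega> a) xs)"
proof (cases "set xs \<subseteq> L")
  case True
  have "ce_differential b L (\<lambda>xs. \<Sum>a\<in>I. \<omega> a xs) xs =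
    (\<Sum>j<length xs. \<Sum>a\<in>I. \<Sum>i<j. (-1) ^ (i + j) * \<omega> a (b (xs ! i) (xs ! j) # nths xs (- {i, j})))"
    using True unfolding ce_differential_def sum_distrib_left by (simp add: sum.swap[of _ _ I])
  also have "\<dots> = (\<Sum>a\<in>I. ce_differential b L (\<omega> a) xs)"
    using True by (simp add: ce_differential_def sum.swap[of _ _ I])
  finally show ?thesis .
qed (simp add: ce_differential_def)

lemma ce_differential_Nil [simp]: "ce_differential b L \<omega> [] = 0"
  by (simp add: ce_differential_def)

lemma nths_remove: "nths xs (- {i}) = take i xs @ drop (Suc i) xs"
proof (induction xs arbitrary: i)
  case (Cons x xs)
  show ?case
  proof (cases i)
    case 0
    then have "{j. Suc j \<in> - {i}} = UNIV" by auto
    then show ?thesis using 0 by (simp add: nths_Cons nths_all)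
  next
    case (Suc k)
    then have "{j. Suc j \<in> - {i}} = - {k}" by auto
    then show ?thesis using Suc Cons[of k] by (simp add: nths_Cons)
  qed
qed simp

lemma nths_Cons_remove_first:
  "nths (p # xs) (- {0, Suc j}) = take j xs @ drop (Suc j) xs"
proof -
  have "{i. Suc i \<in> - {0, Suc j}} = - {j}" by auto
  then show ?thesis by (simp add: nths_Cons nths_remove)
qed

lemma nths_Cons_remove_rest: "nths (p # xs) (- {Suc i, Suc j}) = p # nths xs (- {i, j})"
proof -
  have "{l. Suc l \<in> - {Suc i, Suc j}} = - {i, j}" by auto
  then show ?thesis by (simp add: nths_Cons)
qed

lemma cochains_length: "\<omega> \<in> cochains scale L n \<Longrightarrow> length xs \<noteq> n \<Longrightarrow> \<omega> xs = 0"
  by (auto simp: cochains_def)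

context
  fixes scale :: "'k::field \<Rightarrow> 'a::ab_group_add \<Rightarrow> 'a"
begin

abbreviation "\<A> \<equiv> cochains scale UNIV"

lemma cochains_update_add:
  assumes "\<omega> \<in> \<A> n" "i < length xs"
  shows "\<omega> (xs[i := x + y]) = \<omega> (xs[i := x]) + \<omega> (xs[i := y])"
  using assms by (cases "length xs = n") (auto simp: cochains_def)

lemma cochains_update_scale:
  assumes "\<omega> \<in> \<A> n" "i < length xs"
  shows "\<omega> (xs[i := scale c x]) = c * \<omega> (xs[i := x])"
  using assms by (cases "length xs = n") (auto simp: cochains_def)

lemma cochains_eq_zero:
  assumes "\<omega> \<in> \<A> n" "i < j" "j < length xs" "xs ! i = xs ! j"
  shows "\<omega> xs = 0"
  using assms by (cases "length xs = n") (auto simp: cochains_def)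

lemma cochains_Cons_add:
  assumes "\<omega> \<in> \<A> n"
  shows "\<omega> ((x + y) # xs) = \<omega> (x # xs) + \<omega> (y # xs)"
  using cochains_update_add[OF assms, of 0 "x # xs" x y] by simp

lemma cochains_Cons_scale:
  assumes "\<omega> \<in> \<A> n"
  shows "\<omega> (scale c x # xs) = c * \<omega> (x # xs)"
  using cochains_update_scale[OF assms, of 0 "x # xs" c x] by simp

lemma cochains_Cons_zero:
  assumes "\<omega> \<in> \<A> n"
  shows "\<omega> (0 # xs) = 0"
  using cochains_Cons_add[OF assms, of 0 0 xs] by (metis add.right_neutral add_cancel_right_right)

lemma cochains_Cons_sum:
  assumes "\<omega> \<in> \<A> n"
  shows "\<omega> (sum f I # xs) = (\<Sum>i\<in>I. \<omega> (f i # xs))"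
  by (induction I rule: infinite_finite_induct)
    (simp_all add: cochains_Cons_zero[OF assms] cochains_Cons_add[OF assms])

lemma cochains_swap:
  assumes "\<omega> \<in> \<A> n" "i < length xs"
  shows "\<omega> (u # xs[i := v]) = - \<omega> (v # xs[i := u])"
proof -
  have z: "\<omega> (w # xs[i := w]) = 0" for w
    using assms by (intro cochains_eq_zero[OF assms(1), of 0 "Suc i"]) auto
  have a: "\<omega> (w # xs[i := x + y]) = \<omega> (w # xs[i := x]) + \<omega> (w # xs[i := y])" for w x y
    using cochains_update_add[OF assms(1), of "Suc i" "w # xs" x y] assms(2) by simp
  have "0 = \<omega> ((u + v) # xs[i := u + v])" by (simp only: z)
  also have "\<dots> = \<omega> (u # xs[i := v]) + \<omega> (v # xs[i := u])"
    by (simp add: cochains_Cons_add[OF assms(1)] a) (simp add: z)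
  finally have "0 = \<omega> (u # xs[i := v]) + \<omega> (v # xs[i := u])" .
  from this[symmetric] show ?thesis by (rule eq_neg_iff_add_eq_0[THEN iffD2])
qed

lemma cochains_swap_Cons:
  assumes "\<omega> \<in> \<A> n"
  shows "\<omega> (u # v # xs) = - \<omega> (v # u # xs)"
  using cochains_swap[OF assms, of 0 "v # xs" u v] by simp

lemma cochains_0_iff: "\<omega> \<in> \<A> 0 \<longleftrightarrow> (\<forall>xs. xs \<noteq> [] \<longrightarrow> \<omega> xs = 0)"
  by (auto simp: cochains_def)

lemma ins_cochains:
  assumes "\<omega> \<in> \<A> n"
  shows "ins p \<omega> \<in> \<A> (n - 1)"
proof (cases n)
  case 0
  then have "ins p \<omega> = 0" using assms by (auto simp: cochains_0_iff ins_def fun_eq_iff)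
  then show ?thesis by simp
next
  case (Suc m)
  have u: "\<omega> (p # xs[i := x + y]) = \<omega> (p # xs[i := x]) + \<omega> (p # xs[i := y])"
    "\<omega> (p # xs[i := scale c x]) = c * \<omega> (p # xs[i := x])" if "i < length xs" for xs i x y c
    using cochains_update_add[OF assms, of "Suc i" "p # xs"] cochains_update_scale[OF assms, of "Suc i" "p # xs"] that
    by auto
  have "ins p \<omega> xs = 0" if "length xs \<noteq> m" for xs
    using that assms Suc by (auto simp: ins_def cochains_length)
  moreover have "ins p \<omega> xs = 0" if "length xs = m" "i < j" "j < m" "xs ! i = xs ! j" for xs i j
    unfolding ins_def using that
    by (intro cochains_eq_zero[OF assms, of "Suc i" "Suc j"]) auto
  ultimately show ?thesis
    unfolding cochains_def Suc ins_def by (auto simp: u)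
qed

text \<open>Supports induction on the degree. Only the first slot, and alternation in the first two
  slots, have to be checked by hand: equal entries at position 0 and at a later position beyond 1
  are handled by swapping the first two entries, which moves the pair into the scope of
  \<open>ins\<close>.\<close>

lemma cochains_SucI:
  assumes nil: "\<omega> [] = 0"
    and ins: "\<And>p. ins p \<omega> \<in> \<A> n"
    and add: "\<And>x y xs. \<omega> ((x + y) # xs) = \<omega> (x # xs) + \<omega> (y # xs)"
    and scl: "\<And>c x xs. \<omega> (scale c x # xs) = c * \<omega> (x # xs)"
    and alt: "\<And>x xs. \<omega> (x # x # xs) = 0"
  shows "\<omega> \<in> \<A> (Suc n)"
proof -
  have eq: "\<omega> (x # xs) = ins x \<omega> xs" for x xs by (simp add: ins_def)
  have swap: "\<omega> (x # y # xs) = - \<omega> (y # x # xs)" for x y xs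
  proof -
    have l: "\<omega> (x # (a + b) # xs) = \<omega> (x # a # xs) + \<omega> (x # b # xs)" for x a b xs
      using cochains_Cons_add[OF ins[of x], of a b xs] by (simp add: ins_def)
    have "0 = \<omega> ((x + y) # (x + y) # xs)" by (simp only: alt)
    also have "\<dots> = \<omega> (x # y # xs) + \<omega> (y # x # xs)" by (simp add: add l) (simp add: alt)
    finally have "0 = \<omega> (x # y # xs) + \<omega> (y # x # xs)" .
    from this[symmetric] show ?thesis by (rule eq_neg_iff_add_eq_0[THEN iffD2])
  qed
  have "\<omega> xs = 0" if "length xs \<noteq> Suc n" for xs
    using that nil cochains_length[OF ins] by (cases xs) (auto simp: eq)
  moreover have "\<omega> (xs[i := x + y]) = \<omega> (xs[i := x]) + \<omega> (xs[i := y])"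
    if "length xs = Suc n" "i < Suc n" for xs i x y
  proof (cases xs)
    case (Cons z zs)
    then show ?thesis using that cochains_update_add[OF ins[of z], of "i - 1" zs x y]
      by (cases i) (auto simp: eq add[unfolded eq])
  qed (use that in auto)
  moreover have "\<omega> (xs[i := scale c x]) = c * \<omega> (xs[i := x])"
    if "length xs = Suc n" "i < Suc n" for xs i x c
  proof (cases xs)
    case (Cons z zs)
    then show ?thesis using that cochains_update_scale[OF ins[of z], of "i - 1" zs c x]
      by (cases i) (auto simp: eq scl[unfolded eq])
  qed (use that in auto)
  moreover have "\<omega> xs = 0"
    if xs: "length xs = Suc n" "i < j" "j < Suc n" "xs ! i = xs ! j" for xs i j
  proof -
    obtain z zs where z: "xs = z # zs" using xs by (cases xs) auto
    obtain k where j: "j = Suc k" using xs by (cases j) auto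
    show ?thesis
    proof (cases i)
      case (Suc l)
      then show ?thesis using xs z j cochains_eq_zero[OF ins[of z], of l k zs] by (simp add: eq)
    next
      case 0
      show ?thesis
      proof (cases k)
        case 0
        then show ?thesis using xs z j \<open>i = 0\<close> alt by (cases zs) auto
      next
        case (Suc l)
        then obtain y ys where y: "zs = y # ys" using xs z j by (cases zs) auto
        have "ins y \<omega> (z # ys) = 0"
          using xs z y j Suc \<open>i = 0\<close> by (intro cochains_eq_zero[OF ins, of 0 "Suc l"]) auto
        then show ?thesis using swap[of z y ys] z y by (simp add: ins_def)
      qed
    qed
  qed
  ultimately show ?thesis unfolding cochains_def by auto
qed

text \<open>Bringing slot \<open>i\<close> to the front takes \<open>i\<close> adjacent
  transpositions. This matches the Chevalley-Eilenberg signs, where the bracket stands first, with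
  slotwise replacement.\<close>

lemma cochains_update_move:
  assumes "\<omega> \<in> \<A> n" "i < length xs"
  shows "\<omega> (xs[i := v]) = (- 1) ^ i * \<omega> (v # take i xs @ drop (Suc i) xs)"
  using assms
proof (induction i arbitrary: xs \<omega> n)
  case 0
  then show ?case by (cases xs) auto
next
  case (Suc i)
  then obtain y ys where xs: "xs = y # ys" by (cases xs) auto
  have "\<omega> (xs[Suc i := v]) = ins y \<omega> (ys[i := v])" by (simp add: xs ins_def)
  also have "\<dots> = (- 1) ^ i * ins y \<omega> (v # take i ys @ drop (Suc i) ys)"
    using Suc.prems(2) xs by (intro Suc.IH[OF ins_cochains[OF Suc.prems(1)]]) simp
  also have "\<dots> = (- 1) ^ Suc i * \<omega> (v # y # take i ys @ drop (Suc i) ys)"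
    using cochains_swap_Cons[OF Suc.prems(1), of y v] by (simp add: ins_def)
  finally show ?case by (simp add: xs)
qed

lemma slot_sum_cochains:
  assumes "\<omega> \<in> \<A> n" and T: "Vector_Spaces.linear scale scale T"
  shows "slot_sum T \<omega> \<in> \<A> n"
  using assms(1)
proof (induction n arbitrary: \<omega>)
  case 0
  have "slot_sum T \<omega> xs = 0" if "xs \<noteq> []" for xs
    unfolding slot_sum_def using 0 that by (intro sum.neutral) (auto simp: cochains_0_iff)
  then show ?case by (simp add: cochains_0_iff)
next
  case (Suc n)
  interpret T: Vector_Spaces.linear scale scale T by (fact T)
  have i: "ins p \<omega> \<in> \<A> n" for p using ins_cochains[OF Suc.prems, of p] by simp
  have e: "\<omega> (a # xs[j := y]) = ins a \<omega> (xs[j := y])" for a xs j y by (simp add: ins_def)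
  show ?case
  proof (rule cochains_SucI)
    show "ins p (slot_sum T \<omega>) \<in> \<A> n" for p
      unfolding ins_slot_sum by (intro cochains_add Suc.IH i)
    show "slot_sum T \<omega> ((x + y) # xs) = slot_sum T \<omega> (x # xs) + slot_sum T \<omega> (y # xs)" for x y xs
      by (simp add: slot_sum_Cons T.add cochains_Cons_add[OF Suc.prems])
        (simp add: slot_sum_def ins_def cochains_Cons_add[OF Suc.prems] sum.distrib algebra_simps)
    show "slot_sum T \<omega> (scale c x # xs) = c * slot_sum T \<omega> (x # xs)" for c x xs
      by (simp add: slot_sum_Cons T.scale cochains_Cons_scale[OF Suc.prems])
        (simp add: slot_sum_def ins_def cochains_Cons_scale[OF Suc.prems] sum_distrib_left algebra_simps)
    show "slot_sum T \<omega> (x # x # xs) = 0" for x xs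
    proof -
      have "\<omega> (x # x # ys) = 0" for ys
        using cochains_eq_zero[OF Suc.prems, of 0 1 "x # x # ys"] by simp
      then have "slot_sum T (ins x (ins x \<omega>)) xs = 0"
        by (simp add: slot_sum_def ins_def)
      then show ?thesis
        using cochains_swap_Cons[OF Suc.prems, of x "T x" xs] by (simp add: slot_sum_Cons) (simp add: ins_def)
    qed
  qed simp
qed

end

section \<open>The differential through Cartan's formula\<close>

context lie_algebra
begin

abbreviation "dd \<equiv> ce_differential bracket UNIV"

lemma linear_bracket: "Vector_Spaces.linear scale scale (bracket x)"
  by unfold_locales (simp_all add: bracket_add_right bracket_scale_right)

lemma bracket_diff_right: "bracket x (y - z) = bracket x y - bracket x z"
  using bracket_add_right[of x "y - z" z] by simp

lemma bracket_minus_right: "bracket x (- y) = - bracket x y"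
  using bracket_diff_right[of x 0 y] by simp

lemma bracket_minus_left: "bracket (- x) y = - bracket x y"
  using bracket_antisym[of "-x" y] bracket_antisym[of x y] by (simp add: bracket_minus_right)

text \<open>Cartan's formula. As a recursion on the list it determines the differential, and replaces its
  definition from here on.\<close>

lemma ce_differential_Cons:
  assumes "\<omega> \<in> cochains scale UNIV n"
  shows "dd \<omega> (p # xs) = - slot_sum (bracket p) \<omega> xs - dd (ins p \<omega>) xs"
proof -
  have "dd \<omega> (p # xs) = (\<Sum>j<length xs. \<Sum>i<Suc j.
      (- 1) ^ (i + Suc j) * \<omega> (bracket ((p # xs) ! i) (xs ! j) # nths (p # xs) (- {i, Suc j})))"
    unfolding ce_differential_def by (simp add: sum.lessThan_Suc_shift del: sum.lessThan_Suc)
  also have "\<dots> = (\<Sum>j<length xs.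
      - ((- 1) ^ j * \<omega> (bracket p (xs ! j) # take j xs @ drop (Suc j) xs)) -
      (\<Sum>i<j. (- 1) ^ (i + j) * ins p \<omega> (bracket (xs ! i) (xs ! j) # nths xs (- {i, j}))))"
  \<comment> \<open>The summand \<open>i = 0\<close> brackets \<open>p\<close> with an entry of
    \<open>xs\<close> and becomes the slot sum. In the others \<open>p\<close> is a spectator behind
    the bracket; swapping it to the front costs a sign.\<close>
  proof (rule sum.cong[OF refl])
    fix j
    show "(\<Sum>i<Suc j. (- 1) ^ (i + Suc j) *
        \<omega> (bracket ((p # xs) ! i) (xs ! j) # nths (p # xs) (- {i, Suc j}))) =
      - ((- 1) ^ j * \<omega> (bracket p (xs ! j) # take j xs @ drop (Suc j) xs)) -
      (\<Sum>i<j. (- 1) ^ (i + j) * ins p \<omega> (bracket (xs ! i) (xs ! j) # nths xs (- {i, j})))"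
      unfolding sum.lessThan_Suc_shift nths_Cons_remove_rest nths_Cons_remove_first
      by (simp add: ins_def cochains_swap_Cons[OF assms, of _ p] sum_negf)
  qed
  also have "\<dots> = - slot_sum (bracket p) \<omega> xs - dd (ins p \<omega>) xs"
    by (simp add: slot_sum_def ce_differential_def sum_subtractf sum_negf
        cochains_update_move[OF assms])
  finally show ?thesis .
qed

lemma ins_ce_differential:
  assumes "\<omega> \<in> cochains scale UNIV n"
  shows "ins p (dd \<omega>) = - slot_sum (bracket p) \<omega> - dd (ins p \<omega>)"
  unfolding fun_eq_iff by (simp add: ins_def[of p "dd \<omega>"] ce_differential_Cons[OF assms])

lemma slot_sum_add_op:
  assumes "\<omega> \<in> cochains scale UNIV n"
  shows "slot_sum (\<lambda>z. T z + U z) \<omega> xs = slot_sum T \<omega> xs + slot_sum U \<omega> xs"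
  by (simp add: slot_sum_def cochains_update_add[OF assms] sum.distrib)

lemma slot_sum_scale_op:
  assumes "\<omega> \<in> cochains scale UNIV n"
  shows "slot_sum (\<lambda>z. scale c (T z)) \<omega> xs = c * slot_sum T \<omega> xs"
  by (simp add: slot_sum_def cochains_update_scale[OF assms] sum_distrib_left)

text \<open>Induction on the degree through Cartan's formula. For alternation the formula is applied
  twice to a list starting with \<open>x, x\<close>: the two slot sums of
  \<open>ins x \<omega>\<close> cancel, and what remains contains \<open>bracket x x\<close> or a
  double insertion of \<open>x\<close>.\<close>

lemma ce_differential_cochains:
  assumes "\<omega> \<in> cochains scale UNIV n"
  shows "dd \<omega> \<in> cochains scale UNIV (Suc n)"
  using assms
proof (induction n arbitrary: \<omega>)
  case 0
  have "dd \<omega> xs = 0" for xs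
    unfolding ce_differential_def using 0 by (auto simp: cochains_0_iff intro!: sum.neutral)
  then have "dd \<omega> = 0" by (simp add: fun_eq_iff)
  then show ?case by (simp only: cochains_0)
next
  case (Suc n)
  note c = Suc.prems
  have i: "ins p \<omega> \<in> cochains scale UNIV n" for p using ins_cochains[OF c, of p] by simp
  show ?case
  proof (rule cochains_SucI)
    show "ins p (dd \<omega>) \<in> cochains scale UNIV (Suc n)" for p
      unfolding ins_ce_differential[OF c] diff_conv_add_uminus
      by (intro cochains_add cochains_uminus slot_sum_cochains Suc.IH i c linear_bracket)
    have "ins (x + y) \<omega> = ins x \<omega> + ins y \<omega>" for x y
      by (simp add: fun_eq_iff ins_def cochains_Cons_add[OF c])
    moreover have "bracket (x + y) = (\<lambda>z. bracket x z + bracket y z)" for x y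
      by (simp add: fun_eq_iff bracket_add_left)
    ultimately show "dd \<omega> ((x + y) # xs) = dd \<omega> (x # xs) + dd \<omega> (y # xs)" for x y xs
      by (simp add: ce_differential_Cons[OF c] ce_differential_add
          slot_sum_add_op[OF c])
    have "ins (scale r x) \<omega> = (\<lambda>xs. r * ins x \<omega> xs)" for r x
      by (simp add: fun_eq_iff ins_def cochains_Cons_scale[OF c])
    moreover have "bracket (scale r x) = (\<lambda>z. scale r (bracket x z))" for r x
      by (simp add: fun_eq_iff bracket_scale_left)
    ultimately show "dd \<omega> (scale r x # xs) = r * dd \<omega> (x # xs)" for r x xs
      by (simp add: ce_differential_Cons[OF c] ce_differential_mult
          slot_sum_scale_op[OF c] algebra_simps)
    have "\<omega> (x # x # ys) = 0" for x ys
      using cochains_eq_zero[OF c, of 0 1 "x # x # ys"] by simp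
    then have "ins x (ins x \<omega>) = 0" for x by (simp add: fun_eq_iff ins_def)
    then show "dd \<omega> (x # x # xs) = 0" for x xs
      by (simp add: ce_differential_Cons[OF c] ce_differential_Cons[OF i] slot_sum_Cons
          bracket_self cochains_Cons_zero[OF c])
  qed simp
qed

end

definition skew_bilinear :: "('k::field \<Rightarrow> 'a::ab_group_add \<Rightarrow> 'a) \<Rightarrow> ('a \<Rightarrow> 'a \<Rightarrow> 'k) \<Rightarrow> bool"
  where "skew_bilinear scale \<beta> \<longleftrightarrow>
    (\<forall>x y z. \<beta> (x + y) z = \<beta> x z + \<beta> y z) \<and> (\<forall>c x y. \<beta> (scale c x) y = c * \<beta> x y) \<and>
    (\<forall>x y. \<beta> x y = - \<beta> y x)"

context lie_algebra
begin

text \<open>Terms in which the two operators hit different slots cancel. Precomposition reverses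
  products, hence the order on the right.\<close>

lemma slot_sum_commutator:
  assumes "\<omega> \<in> cochains scale UNIV n"
  shows "slot_sum S (slot_sum T \<omega>) xs - slot_sum T (slot_sum S \<omega>) xs =
    slot_sum (\<lambda>z. T (S z) - S (T z)) \<omega> xs"
  using assms
proof (induction xs arbitrary: \<omega> n)
  case (Cons p xs)
  have "\<omega> ((T (S p) - S (T p)) # xs) = \<omega> (T (S p) # xs) - \<omega> (S (T p) # xs)"
    using cochains_Cons_add[OF Cons.prems, of "T (S p) - S (T p)" "S (T p)" xs] by simp
  then show ?case
    using Cons.IH[OF ins_cochains[OF Cons.prems, of p]]
    by (simp add: slot_sum_Cons ins_slot_sum slot_sum_add)
qed simp

definition insertion_homotopy ::
  "'i set \<Rightarrow> ('i \<Rightarrow> 'a) \<Rightarrow> ('i \<Rightarrow> 'a \<Rightarrow> 'a) \<Rightarrow> ('a list \<Rightarrow> 'k) \<Rightarrow> 'a list \<Rightarrow> 'k"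
  where "insertion_homotopy I q T \<omega> xs = (\<Sum>a\<in>I. slot_sum (T a) (ins (q a) \<omega>) xs)"

lemma insertion_homotopy_cochains:
  assumes "\<omega> \<in> cochains scale UNIV n" "\<And>a. a \<in> I \<Longrightarrow> Vector_Spaces.linear scale scale (T a)"
  shows "insertion_homotopy I q T \<omega> \<in> cochains scale UNIV (n - 1)"
  unfolding insertion_homotopy_def[abs_def]
  by (intro cochains_sum slot_sum_cochains ins_cochains assms)

lemma skew_bilinear_cochain:
  assumes "\<omega> \<in> cochains scale UNIV n" "i < length xs"
  shows "skew_bilinear scale (\<lambda>u v. \<omega> (u # xs[i := v]))"
  unfolding skew_bilinear_def
  by (intro conjI allI cochains_swap[OF assms] cochains_Cons_add[OF assms(1)] cochains_Cons_scale[OF assms(1)])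

text \<open>The first hypothesis is the cocycle condition for the cobracket
  \<open>p \<mapsto> \<Sum>a\<in>I. q a \<and> T a p\<close>, of which \<open>insertion_homotopy\<close> is the transpose; the second one
  identifies the composite of the cobracket with the bracket.\<close>

lemma insertion_homotopy:
  fixes q :: "'i \<Rightarrow> 'a"
  assumes T: "\<And>a. a \<in> I \<Longrightarrow> Vector_Spaces.linear scale scale (T a)"
    and cocycle: "\<And>\<beta> p z. p \<in> X \<Longrightarrow> z \<in> X \<Longrightarrow> skew_bilinear scale \<beta> \<Longrightarrow>
      (\<Sum>a\<in>I. \<beta> (q a) (bracket p (T a z) - T a (bracket p z) + bracket (T a p) z)
        + \<beta> (bracket p (q a)) (T a z) - \<beta> (T a p) (bracket (q a) z)) = 0"
    and D: "\<And>p. p \<in> X \<Longrightarrow> (\<Sum>a\<in>I. bracket (q a) (T a p)) = D p"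
    and \<omega>: "\<omega> \<in> cochains scale UNIV n" and xs: "set xs \<subseteq> X"
  shows "dd (insertion_homotopy I q T \<omega>) xs + insertion_homotopy I q T (dd \<omega>) xs = - slot_sum D \<omega> xs"
  using \<omega> xs
proof (induction xs arbitrary: \<omega> n)
  case (Cons p xs)
  note \<omega> = Cons.prems(1)
  have d\<omega>: "dd \<omega> \<in> cochains scale UNIV (Suc n)" by (rule ce_differential_cochains[OF \<omega>])
  have i: "ins u \<omega> \<in> cochains scale UNIV (n - 1)" for u by (rule ins_cochains[OF \<omega>])
  have sw: "ins u (ins v \<eta>) = - ins v (ins u \<eta>)" if "\<eta> \<in> cochains scale UNIV m" for u v \<eta> m
    using cochains_swap_Cons[OF that, of v u] by (simp add: ins_def fun_eq_iff)
  have A: "dd (slot_sum (T a) (ins (q a) \<omega>)) (p # xs) =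
      - slot_sum (bracket p) (slot_sum (T a) (ins (q a) \<omega>)) xs
      + dd (slot_sum (T a) (ins (q a) (ins p \<omega>))) xs - dd (ins (T a p) (ins (q a) \<omega>)) xs"
    if "a \<in> I" for a
    by (simp add: ce_differential_Cons[OF slot_sum_cochains[OF i T[OF that]]] ins_slot_sum
        sw[OF \<omega>, of p "q a"] slot_sum_uminus ce_differential_diff ce_differential_uminus)
  have B: "slot_sum (T a) (ins (q a) (dd \<omega>)) (p # xs) =
      slot_sum (T a) (slot_sum (bracket p) (ins (q a) \<omega>)) xs
      + slot_sum (T a) (ins (bracket p (q a)) \<omega>) xs + slot_sum (T a) (ins (q a) (dd (ins p \<omega>))) xs
      - slot_sum (bracket (q a)) (ins (T a p) \<omega>) xs - \<omega> (bracket (q a) (T a p) # xs)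
      + slot_sum (bracket (T a p)) (ins (q a) \<omega>) xs + dd (ins (T a p) (ins (q a) \<omega>)) xs" for a
  proof -
    have "slot_sum (T a) (ins (q a) (dd \<omega>)) (p # xs) =
        - slot_sum (T a) (ins (q a) (ins p (dd \<omega>))) xs + ins (q a) (dd \<omega>) (T a p # xs)"
      by (simp add: slot_sum_Cons sw[OF d\<omega>, of p "q a"] slot_sum_uminus)
    also have "- slot_sum (T a) (ins (q a) (ins p (dd \<omega>))) xs =
        slot_sum (T a) (slot_sum (bracket p) (ins (q a) \<omega>)) xs
        + slot_sum (T a) (ins (bracket p (q a)) \<omega>) xs + slot_sum (T a) (ins (q a) (dd (ins p \<omega>))) xs"
      by (simp add: ins_ce_differential[OF \<omega>] ins_diff ins_uminus slot_sum_add slot_sum_diff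
          slot_sum_uminus ins_slot_sum)
    also have "ins (q a) (dd \<omega>) (T a p # xs) =
      - slot_sum (bracket (q a)) (ins (T a p) \<omega>) xs - \<omega> (bracket (q a) (T a p) # xs)
      + slot_sum (bracket (T a p)) (ins (q a) \<omega>) xs + dd (ins (T a p) (ins (q a) \<omega>)) xs"
      by (simp add: ins_ce_differential[OF \<omega>] slot_sum_Cons ce_differential_Cons[OF i])
    finally show ?thesis by (simp add: algebra_simps)
  qed
  \<comment> \<open>What the induction hypothesis for \<open>ins p \<omega>\<close> and the
    \<open>D p\<close> term leave over. It vanishes after summation over \<open>a\<close>, one slot
    at a time: with the other slots frozen, \<open>\<omega>\<close> is a skew form in the first
    entry and that slot, to which the cocycle condition applies.\<close>
  define E where "E a = slot_sum (T a) (slot_sum (bracket p) (ins (q a) \<omega>)) xs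
      - slot_sum (bracket p) (slot_sum (T a) (ins (q a) \<omega>)) xs
      + slot_sum (T a) (ins (bracket p (q a)) \<omega>) xs
      - slot_sum (bracket (q a)) (ins (T a p) \<omega>) xs
      + slot_sum (bracket (T a p)) (ins (q a) \<omega>) xs" for a
  have E: "E a = (\<Sum>i<length xs.
      \<omega> (q a # xs[i := bracket p (T a (xs ! i)) - T a (bracket p (xs ! i)) + bracket (T a p) (xs ! i)])
      + \<omega> (bracket p (q a) # xs[i := T a (xs ! i)]) - \<omega> (T a p # xs[i := bracket (q a) (xs ! i)]))" for a
  proof -
    have l: "\<omega> (q a # xs[j := u + v]) = \<omega> (q a # xs[j := u]) + \<omega> (q a # xs[j := v])" if "j < length xs" for j u v
      using cochains_update_add[OF \<omega>, of "Suc j" "q a # xs" u v] that by simp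
    show ?thesis
      unfolding E_def slot_sum_commutator[OF i]
      by (simp add: slot_sum_def ins_def sum.distrib sum_subtractf l)
  qed
  have "(\<Sum>a\<in>I. E a) = (\<Sum>i<length xs. \<Sum>a\<in>I.
      \<omega> (q a # xs[i := bracket p (T a (xs ! i)) - T a (bracket p (xs ! i)) + bracket (T a p) (xs ! i)])
      + \<omega> (bracket p (q a) # xs[i := T a (xs ! i)]) - \<omega> (T a p # xs[i := bracket (q a) (xs ! i)]))"
    unfolding E by (rule sum.swap)
  also have "\<dots> = 0"
    using Cons.prems(2) by (intro sum.neutral ballI cocycle[OF _ _ skew_bilinear_cochain[OF \<omega>]]) auto
  finally have E0: "(\<Sum>a\<in>I. E a) = 0" .
  have "dd (insertion_homotopy I q T \<omega>) (p # xs) + insertion_homotopy I q T (dd \<omega>) (p # xs) =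
    (\<Sum>a\<in>I. dd (slot_sum (T a) (ins (q a) \<omega>)) (p # xs) + slot_sum (T a) (ins (q a) (dd \<omega>)) (p # xs))"
    by (simp add: insertion_homotopy_def[abs_def] ce_differential_sum sum.distrib)
  also have "\<dots> = (\<Sum>a\<in>I. (dd (slot_sum (T a) (ins (q a) (ins p \<omega>))) xs
      + slot_sum (T a) (ins (q a) (dd (ins p \<omega>))) xs) + E a - \<omega> (bracket (q a) (T a p) # xs))"
    by (rule sum.cong[OF refl]) (simp add: A B E_def)
  also have "\<dots> = (dd (insertion_homotopy I q T (ins p \<omega>)) xs + insertion_homotopy I q T (dd (ins p \<omega>)) xs)
      - \<omega> (D p # xs)"
    using Cons.prems(2) E0
    by (simp add: insertion_homotopy_def[abs_def] ce_differential_sum sum.distrib sum_subtractf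
        cochains_Cons_sum[OF \<omega>] flip: D)
  also have "\<dots> = - slot_sum D \<omega> (p # xs)"
    using Cons.prems(2) Cons.IH[OF i[of p]] by (simp add: slot_sum_Cons)
  finally show ?case .
qed (simp add: insertion_homotopy_def)

end

section \<open>The homotopy on cochains of a current algebra\<close>

lemma additive_sum:
  fixes f :: "'a::comm_monoid_add \<Rightarrow> 'b::ab_group_add"
  assumes "\<And>x y. f (x + y) = f x + f y"
  shows "f (sum g A) = (\<Sum>a\<in>A. f (g a))"
proof -
  have "f 0 = 0" using assms[of 0 0] by simp
  then show ?thesis by (induction A rule: infinite_finite_induct) (simp_all add: assms)
qed

text \<open>Each axiom of a cochain involves finitely many vectors, so agreement with some cochain
  on every finite set suffices. This serves functions whose definition has a cutoff depending on the
  arguments.\<close>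

lemma cochains_local:
  assumes "\<And>S. finite S \<Longrightarrow> \<exists>\<eta>\<in>cochains scale UNIV n. \<forall>xs. set xs \<subseteq> S \<longrightarrow> \<omega> xs = \<eta> xs"
  shows "\<omega> \<in> cochains scale UNIV n"
  unfolding cochains_def mem_Collect_eq
proof (intro conjI allI ballI impI)
  fix xs :: "'a list"
  obtain \<eta> where \<eta>: "\<eta> \<in> cochains scale UNIV n" "\<And>ys. set ys \<subseteq> set xs \<Longrightarrow> \<omega> ys = \<eta> ys"
    using assms[of "set xs"] by auto
  show "\<omega> xs = 0" if "\<not> (length xs = n \<and> set xs \<subseteq> UNIV)"
    using \<eta> that cochains_length[OF \<eta>(1), of xs] by auto
  show "\<omega> xs = 0" if "length xs = n \<and> set xs \<subseteq> UNIV" "j < n" "i < j" "xs ! i = xs ! j" for i j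
    using \<eta> that cochains_eq_zero[OF \<eta>(1), of i j xs] by auto
next
  fix xs :: "'a list" and i x y
  assume a: "length xs = n \<and> set xs \<subseteq> UNIV" "i < n"
  obtain \<eta> where \<eta>: "\<eta> \<in> cochains scale UNIV n"
    "\<And>ys. set ys \<subseteq> insert (x + y) (insert x (insert y (set xs))) \<Longrightarrow> \<omega> ys = \<eta> ys"
    using assms[of "insert (x + y) (insert x (insert y (set xs)))"] by auto
  have "set (xs[i := z]) \<subseteq> insert (x + y) (insert x (insert y (set xs)))" if "z \<in> {x + y, x, y}" for z
    using set_update_subset_insert[of xs i z] that by auto
  then show "\<omega> (xs[i := x + y]) = \<omega> (xs[i := x]) + \<omega> (xs[i := y])"
    using \<eta>(2) cochains_update_add[OF \<eta>(1), of i xs x y] a by auto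
next
  fix xs :: "'a list" and i c x
  assume a: "length xs = n \<and> set xs \<subseteq> UNIV" "i < n"
  obtain \<eta> where \<eta>: "\<eta> \<in> cochains scale UNIV n"
    "\<And>ys. set ys \<subseteq> insert (scale c x) (insert x (set xs)) \<Longrightarrow> \<omega> ys = \<eta> ys"
    using assms[of "insert (scale c x) (insert x (set xs))"] by auto
  have "set (xs[i := z]) \<subseteq> insert (scale c x) (insert x (set xs))" if "z \<in> {scale c x, x}" for z
    using set_update_subset_insert[of xs i z] that by auto
  then show "\<omega> (xs[i := scale c x]) = c * \<omega> (xs[i := x])"
    using \<eta>(2) cochains_update_scale[OF \<eta>(1), of i xs c x] a by auto
qed

definition bilinear_form :: "('k::field \<Rightarrow> 'a::ab_group_add \<Rightarrow> 'a) \<Rightarrow> ('a \<Rightarrow> 'a \<Rightarrow> 'k) \<Rightarrow> bool"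
  where "bilinear_form scale \<gamma> \<longleftrightarrow>
    (\<forall>x y z. \<gamma> (x + y) z = \<gamma> x z + \<gamma> y z) \<and> (\<forall>c x y. \<gamma> (scale c x) y = c * \<gamma> x y) \<and>
    (\<forall>x y z. \<gamma> x (y + z) = \<gamma> x y + \<gamma> x z) \<and> (\<forall>c x y. \<gamma> x (scale c y) = c * \<gamma> x y)"

lemma skew_bilinearD:
  assumes "skew_bilinear scale \<beta>"
  shows "\<beta> (x + y) z = \<beta> x z + \<beta> y z" "\<beta> (scale c x) y = c * \<beta> x y"
    "\<beta> x (y + z) = \<beta> x y + \<beta> x z" "\<beta> x (scale c y) = c * \<beta> x y" "\<beta> x y = - \<beta> y x"
proof -
  show s: "\<beta> x y = - \<beta> y x" for x y using assms unfolding skew_bilinear_def by blast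
  show a: "\<beta> (x + y) z = \<beta> x z + \<beta> y z" for x y z using assms unfolding skew_bilinear_def by blast
  show c: "\<beta> (scale c x) y = c * \<beta> x y" for c x y using assms unfolding skew_bilinear_def by blast
  show "\<beta> x (y + z) = \<beta> x y + \<beta> x z" using s[of x "y + z"] s[of x y] s[of x z] a[of y z x] by simp
  show "\<beta> x (scale c y) = c * \<beta> x y" using s[of x "scale c y"] s[of x y] c[of c y x] by simp
qed

text \<open>The Casimir element is \<open>\<Sum>b\<in>B. b \<otimes> star b\<close>; its normalisation is part of the definition.\<close>

locale casimir_lie_algebra = lie_algebra scale bracket
  for scale :: "'k::field_char_0 \<Rightarrow> 'a::ab_group_add \<Rightarrow> 'a" and bracket +
  fixes B :: "'a set" and star :: "'a \<Rightarrow> 'a"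
  assumes casimir_invariant: "bilinear_form scale \<gamma> \<Longrightarrow>
      (\<Sum>b\<in>B. \<gamma> (bracket x b) (star b)) = - (\<Sum>b\<in>B. \<gamma> b (bracket x (star b)))"
    and casimir_adjoint: "(\<Sum>b\<in>B. bracket b (bracket (star b) x)) = x"

sublocale casimir_lie_algebra \<subseteq> cur: lie_algebra "current_scale scale" "current_bracket bracket"
  by (rule lie_algebra_current)

context casimir_lie_algebra
begin

abbreviation "cscale \<equiv> current_scale scale"
abbreviation "cbracket \<equiv> current_bracket bracket"

definition reweight :: "(nat \<Rightarrow> 'k) \<Rightarrow> 'a poly \<Rightarrow> 'a poly"
  where "reweight f p = (\<Sum>i\<le>degree p. monom (scale (f i) (coeff p i)) i)"

lemma coeff_reweight [simp]: "coeff (reweight f p) n = scale (f n) (coeff p n)"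
  by (auto simp: reweight_def coeff_sum coeff_eq_0)

abbreviation "euler \<equiv> reweight of_nat"
abbreviation "dilate s \<equiv> reweight (\<lambda>i. s ^ i)"

lemma reweight_add: "reweight f (p + q) = reweight f p + reweight f q"
  by (rule poly_eqI) (simp add: scale_right_distrib)

lemma reweight_scale: "reweight f (cscale c p) = cscale c (reweight f p)"
  by (rule poly_eqI) (simp add: mult.commute)

lemma reweight_monom: "reweight f (monom x n) = cscale (f n) (monom x n)"
  by (rule poly_eqI) simp

lemma dilate_cbracket: "dilate s (cbracket p q) = cbracket (dilate s p) (dilate s q)"
proof (induction p rule: current_poly_induct)
  case (monom x m)
  show ?case
    by (induction q rule: current_poly_induct)
      (simp_all add: current_bracket_monom reweight_monom current_scale_monom bracket_scale_left
        bracket_scale_right power_add reweight_add cur.bracket_add_right)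
qed (simp add: cur.bracket_add_left reweight_add)

lemma degree_cbracket_le: "degree (cbracket p q) \<le> degree p + degree q"
  unfolding current_bracket_def
  by (intro degree_sum_le) (auto intro!: order.trans[OF degree_monom_le])

text \<open>The second leg of the cobracket for the mode \<open>(k, b)\<close>.
  \<open>poly_shift\<close> discards the terms below t^k, so these powers contribute
  nothing.\<close>

definition contraction :: "nat \<times> 'a \<Rightarrow> 'a poly \<Rightarrow> 'a poly"
  where "contraction a p = map_poly (bracket (star (snd a))) (poly_shift (fst a) p)"

lemma coeff_contraction [simp]:
  "coeff (contraction a p) n = bracket (star (snd a)) (coeff p (n + fst a))"
  by (simp add: contraction_def coeff_map_poly coeff_poly_shift)

lemma linear_contraction: "Vector_Spaces.linear cscale cscale (contraction a)"
  by unfold_locales (auto intro!: poly_eqI simp: bracket_add_right bracket_scale_right)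

lemma contraction_add: "contraction a (p + q) = contraction a p + contraction a q"
  by (rule poly_eqI) (simp add: bracket_add_right)

lemma contraction_monom:
  "contraction a (monom x n) = (if fst a \<le> n then monom (bracket (star (snd a)) x) (n - fst a) else 0)"
  by (rule poly_eqI) auto

lemma contraction_eq_0: "degree p < fst a \<Longrightarrow> contraction a p = 0"
  by (rule poly_eqI) (simp add: coeff_eq_0)

text \<open>Starting at 1 matters: a term \<open>k = 0\<close> would turn the composite with the
  bracket into multiplication by n + 1 in t-degree n.\<close>

definition modes :: "nat \<Rightarrow> (nat \<times> 'a) set"
  where "modes N = {1..N} \<times> B"

definition mode :: "nat \<times> 'a \<Rightarrow> 'a poly"
  where "mode a = monom (snd a) (fst a)"

lemma sum_modes: "(\<Sum>a\<in>modes N. f a) = (\<Sum>k=1..N. \<Sum>b\<in>B. f (k, b))"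
  by (simp add: modes_def sum.cartesian_product)

lemma sum_cut:
  fixes n N :: nat
  assumes "n \<le> N"
  shows "(\<Sum>k=Suc 0..N. \<Sum>b\<in>B. if k \<le> n then f k b else 0) = (\<Sum>k=Suc 0..n. \<Sum>b\<in>B. f k b)"
proof -
  have "(\<Sum>k=Suc 0..N. \<Sum>b\<in>B. if k \<le> n then f k b else 0) = (\<Sum>k=Suc 0..N. if k \<le> n then \<Sum>b\<in>B. f k b else 0)"
    by (intro sum.cong) auto
  also have "\<dots> = (\<Sum>k\<in>{k \<in> {Suc 0..N}. k \<le> n}. \<Sum>b\<in>B. f k b)"
    by (rule sum.inter_filter[symmetric]) simp
  also have "{k \<in> {Suc 0..N}. k \<le> n} = {Suc 0..n}" using assms by auto
  finally show ?thesis .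
qed

text \<open>On x t^n each of the n values \<open>k = 1..n\<close> contributes x t^n once, by
  \<open>casimir_adjoint\<close>; larger \<open>k\<close> are killed by the contraction.\<close>

lemma bracket_mode_contraction:
  assumes "degree p \<le> N"
  shows "(\<Sum>a\<in>modes N. cbracket (mode a) (contraction a p)) = euler p"
proof -
  let ?f = "\<lambda>p. \<Sum>a\<in>modes N. cbracket (mode a) (contraction a p)"
  have m: "?f (monom x n) = euler (monom x n)" if "n \<le> N" for x n
  proof -
    have "?f (monom x n) = (\<Sum>k=1..N. \<Sum>b\<in>B. if k \<le> n then monom (bracket b (bracket (star b) x)) n else 0)"
      unfolding sum_modes by (intro sum.cong) (auto simp: mode_def contraction_monom current_bracket_monom)
    also have "\<dots> = (\<Sum>k=1..n. \<Sum>b\<in>B. monom (bracket b (bracket (star b) x)) n)"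
      using that by (simp add: sum_cut)
    also have "\<dots> = (\<Sum>k=1..n. monom x n)"
      using additive_sum[of "\<lambda>u. monom u n" "\<lambda>b. bracket b (bracket (star b) x)" B]
      by (simp add: add_monom casimir_adjoint)
    also have "\<dots> = euler (monom x n)"
      by (rule poly_eqI) (simp add: reweight_monom coeff_sum scale_sum_left[symmetric, of "\<lambda>_. 1", simplified])
    finally show ?thesis .
  qed
  have "?f p = ?f (\<Sum>i\<le>N. monom (coeff p i) i)" using assms by (simp add: poly_as_sum_of_monoms')
  also have "\<dots> = (\<Sum>i\<le>N. ?f (monom (coeff p i) i))"
    by (rule additive_sum) (simp add: contraction_add cur.bracket_add_right sum.distrib)
  also have "\<dots> = (\<Sum>i\<le>N. euler (monom (coeff p i) i))" using m by simp
  also have "\<dots> = euler (\<Sum>i\<le>N. monom (coeff p i) i)"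
    by (rule additive_sum[symmetric]) (rule reweight_add)
  finally show ?thesis using assms by (simp add: poly_as_sum_of_monoms')
qed

text \<open>Invariance of the Casimir element brings all five sums to the three shapes
  \<open>P\<^sub>A\<close>, \<open>P\<^sub>B\<close>, \<open>P\<^sub>C\<close>, related by the
  Jacobi identity. The index ranges then fit together to \<open>1..m + n\<close> for each
  shape.\<close>

lemma contraction_cocycle_monom:
  fixes x y :: 'a and m n :: nat
  assumes \<beta>: "skew_bilinear cscale \<beta>" and N: "m + n \<le> N"
  defines "p \<equiv> monom x m" and "z \<equiv> monom y n"
  shows "(\<Sum>a\<in>modes N. \<beta> (mode a) (cbracket p (contraction a z) - contraction a (cbracket p z)
            + cbracket (contraction a p) z)
      + \<beta> (cbracket p (mode a)) (contraction a z) - \<beta> (contraction a p) (cbracket (mode a) z)) = 0"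
proof -
  note b = skew_bilinearD[OF \<beta>]
  have b0 [simp]: "\<beta> 0 v = 0" "\<beta> v 0 = 0" for v
    using b(1)[of 0 0 v] b(3)[of v 0 0] by (metis add.right_neutral add_cancel_right_right)+
  have bd: "\<beta> u (v - w) = \<beta> u v - \<beta> u w" for u v w using b(3)[of u "v - w" w] by simp
  \<comment> \<open>Every term pairs monomials of total degree \<open>m + n\<close>, so it is enough
    to record the power \<open>j\<close> of the first one.\<close>
  define F where "F j u v = \<beta> (monom u j) (monom v (m + n - j))" for j u v
  have F: "bilinear_form scale (F j)" for j
    by (simp add: bilinear_form_def F_def add_monom[symmetric] current_scale_monom[symmetric] b(1-4))
  have F2: "bilinear_form scale (\<lambda>u v. F j u (bracket v w))" for j w
    using F[of j] by (simp add: bilinear_form_def bracket_add_left bracket_scale_left)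
  have Fm: "F j (- u) v = - F j u v" "F j u (- v) = - F j u v" "F j u (v + w) = F j u v + F j u w" for j u v w
  proof -
    have a: "F j (u + u') v = F j u v + F j u' v" "F j u (v + w) = F j u v + F j u w" for u u' v w
      using F[of j] unfolding bilinear_form_def by blast+
    show "F j u (v + w) = F j u v + F j u w" by (rule a)
    have z: "F j 0 v = 0" "F j v 0 = 0" for v by (simp_all add: F_def)
    show "F j (- u) v = - F j u v" using a(1)[of u "- u" v] z by (simp add: eq_neg_iff_add_eq_0 add.commute)
    show "F j u (- v) = - F j u v" using a(2)[of u v "- v"] z by (simp add: eq_neg_iff_add_eq_0 add.commute)
  qed
  define P\<^sub>A P\<^sub>B P\<^sub>C where "P\<^sub>A j = (\<Sum>b\<in>B. F j b (bracket (bracket x (star b)) y))"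
    and "P\<^sub>B j = (\<Sum>b\<in>B. F j b (bracket x (bracket (star b) y)))"
    and "P\<^sub>C j = (\<Sum>b\<in>B. F j b (bracket (star b) (bracket x y)))" for j
  have jac: "bracket x (bracket u y) = bracket (bracket x u) y + bracket u (bracket x y)" for u
  proof -
    have "bracket y (bracket x u) = - bracket (bracket x u) y" by (rule bracket_antisym)
    moreover have "bracket u (bracket y x) = - bracket u (bracket x y)"
      by (simp add: bracket_antisym[of y x] bracket_minus_right)
    ultimately show ?thesis using jacobi[of x u y] by (simp add: algebra_simps)
  qed
  have PB: "P\<^sub>B j = P\<^sub>A j + P\<^sub>C j" for j
    by (simp add: P\<^sub>A_def P\<^sub>B_def P\<^sub>C_def jac Fm sum.distrib)
  have t1: "(\<Sum>a\<in>modes N. \<beta> (mode a) (cbracket p (contraction a z))) = (\<Sum>k=1..n. P\<^sub>B k)"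
  proof -
    have "(\<Sum>a\<in>modes N. \<beta> (mode a) (cbracket p (contraction a z))) =
      (\<Sum>k=1..N. \<Sum>b\<in>B. if k \<le> n then F k b (bracket x (bracket (star b) y)) else 0)"
      unfolding sum_modes p_def z_def
      by (intro sum.cong) (auto simp: contraction_monom current_bracket_monom mode_def F_def)
    then show ?thesis using N by (simp add: sum_cut P\<^sub>B_def)
  qed
  have t2: "(\<Sum>a\<in>modes N. \<beta> (mode a) (contraction a (cbracket p z))) = (\<Sum>k=1..m + n. P\<^sub>C k)"
  proof -
    have "(\<Sum>a\<in>modes N. \<beta> (mode a) (contraction a (cbracket p z))) =
      (\<Sum>k=1..N. \<Sum>b\<in>B. if k \<le> m + n then F k b (bracket (star b) (bracket x y)) else 0)"
      unfolding sum_modes p_def z_def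
      by (intro sum.cong) (auto simp: contraction_monom current_bracket_monom mode_def F_def)
    then show ?thesis using N by (simp add: sum_cut P\<^sub>C_def)
  qed
  have t3: "(\<Sum>a\<in>modes N. \<beta> (mode a) (cbracket (contraction a p) z)) = - (\<Sum>k=1..m. P\<^sub>A k)"
  proof -
    have "(\<Sum>a\<in>modes N. \<beta> (mode a) (cbracket (contraction a p) z)) =
      (\<Sum>k=1..N. \<Sum>b\<in>B. if k \<le> m then F k b (bracket (bracket (star b) x) y) else 0)"
      unfolding sum_modes p_def z_def
      by (intro sum.cong) (auto simp: contraction_monom current_bracket_monom mode_def F_def)
    also have "\<dots> = (\<Sum>k=1..m. \<Sum>b\<in>B. F k b (bracket (bracket (star b) x) y))"
      using N by (simp add: sum_cut)
    also have "\<dots> = - (\<Sum>k=1..m. P\<^sub>A k)"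
      unfolding P\<^sub>A_def sum_negf[symmetric]
      by (intro sum.cong refl) (simp only: bracket_antisym[of "star _" x] bracket_minus_left Fm)
    finally show ?thesis .
  qed
  \<comment> \<open>Here \<open>bracket x\<close> sits on the first leg;
    \<open>casimir_invariant\<close> moves it to the second and produces the shape
    \<open>P\<^sub>A\<close>.\<close>
  have t4: "(\<Sum>a\<in>modes N. \<beta> (cbracket p (mode a)) (contraction a z)) = - (\<Sum>k=1..n. P\<^sub>A (m + k))"
  proof -
    have "(\<Sum>a\<in>modes N. \<beta> (cbracket p (mode a)) (contraction a z)) =
      (\<Sum>k=1..N. \<Sum>b\<in>B. if k \<le> n then F (m + k) (bracket x b) (bracket (star b) y) else 0)"
      unfolding sum_modes p_def z_def
      by (intro sum.cong) (auto simp: contraction_monom current_bracket_monom mode_def F_def)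
    also have "\<dots> = (\<Sum>k=1..n. \<Sum>b\<in>B. F (m + k) (bracket x b) (bracket (star b) y))"
      using N by (simp add: sum_cut)
    also have "\<dots> = - (\<Sum>k=1..n. P\<^sub>A (m + k))"
      by (simp add: P\<^sub>A_def casimir_invariant[OF F2] sum_negf)
    finally show ?thesis .
  qed
  \<comment> \<open>Skewness first puts the mode into the first argument; then invariance moves
    \<open>bracket y\<close> from the mode to its dual.\<close>
  have t5: "(\<Sum>a\<in>modes N. \<beta> (contraction a p) (cbracket (mode a) z)) = - (\<Sum>k=1..m. P\<^sub>B (n + k))"
  proof -
    have "(\<Sum>a\<in>modes N. \<beta> (contraction a p) (cbracket (mode a) z)) =
      (\<Sum>a\<in>modes N. - \<beta> (cbracket (mode a) z) (contraction a p))"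
      by (intro sum.cong refl b(5))
    also have "\<dots> =
      (\<Sum>k=1..N. \<Sum>b\<in>B. if k \<le> m then - F (n + k) (bracket b y) (bracket (star b) x) else 0)"
      unfolding sum_modes p_def z_def
      by (intro sum.cong) (auto simp: contraction_monom current_bracket_monom mode_def F_def add.commute)
    also have "\<dots> = (\<Sum>k=1..m. \<Sum>b\<in>B. - F (n + k) (bracket b y) (bracket (star b) x))"
      using N by (simp add: sum_cut)
    also have "\<dots> = (\<Sum>k=1..m. \<Sum>b\<in>B. F (n + k) (bracket y b) (bracket (star b) x))"
      by (intro sum.cong refl) (simp add: bracket_antisym[of _ y] Fm)
    also have "\<dots> = - (\<Sum>k=1..m. \<Sum>b\<in>B. F (n + k) b (bracket (bracket y (star b)) x))"
      by (simp add: casimir_invariant[OF F2] sum_negf)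
    also have "\<dots> = - (\<Sum>k=1..m. P\<^sub>B (n + k))"
    proof -
      have "bracket (bracket y u) x = bracket x (bracket u y)" for u
        using bracket_antisym[of "bracket y u" x] bracket_antisym[of y u] by (simp add: bracket_minus_right)
      then show ?thesis by (simp add: P\<^sub>B_def)
    qed
    finally show ?thesis .
  qed
  \<comment> \<open>The shifted ranges of \<open>t4\<close> and \<open>t5\<close> continue those of
    \<open>t3\<close> and \<open>t1\<close>, so that \<open>PB\<close> cancels everything.\<close>
  have split: "(\<Sum>k=1..i + j. f k) = (\<Sum>k=1..i. f k) + (\<Sum>k=1..j. f (i + k))" for i j and f :: "nat \<Rightarrow> 'k"
    by (induction j) (simp_all add: add.assoc)
  have "(\<Sum>k=1..n + m. P\<^sub>B k) = (\<Sum>k=1..m + n. P\<^sub>A k) + (\<Sum>k=1..m + n. P\<^sub>C k)"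
    by (simp add: PB sum.distrib add.commute)
  then show ?thesis
    unfolding sum.distrib sum_subtractf b(3) bd t1 t2 t3 t4 t5 split[of P\<^sub>A m n] split[of P\<^sub>B n m]
    by (simp only: diff_minus_eq_add) (simp add: algebra_simps)
qed

text \<open>Bilinear extension from monomials. The cutoff is \<open>M + M\<close> because the
  bracket of two polynomials of degree at most \<open>M\<close> is contracted as well.\<close>

lemma contraction_cocycle:
  assumes \<beta>: "skew_bilinear cscale \<beta>" and p: "degree p \<le> M" and z: "degree z \<le> M"
  shows "(\<Sum>a\<in>modes (M + M). \<beta> (mode a) (cbracket p (contraction a z) - contraction a (cbracket p z)
            + cbracket (contraction a p) z)
      + \<beta> (cbracket p (mode a)) (contraction a z) - \<beta> (contraction a p) (cbracket (mode a) z)) = 0"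
proof -
  note b = skew_bilinearD[OF \<beta>]
  have bd: "\<beta> u (v - w) = \<beta> u v - \<beta> u w" for u v w using b(3)[of u "v - w" w] by simp
  define G where "G p z = (\<Sum>a\<in>modes (M + M). \<beta> (mode a) (cbracket p (contraction a z) - contraction a (cbracket p z)
            + cbracket (contraction a p) z)
      + \<beta> (cbracket p (mode a)) (contraction a z) - \<beta> (contraction a p) (cbracket (mode a) z))" for p z
  have add: "G (p + p') z = G p z + G p' z" "G p (z + z') = G p z + G p z'" for p p' z z'
    unfolding G_def sum.distrib[symmetric]
    by (intro sum.cong refl,
        simp only: contraction_add cur.bracket_add_left cur.bracket_add_right b(1,3) bd, simp)+
  have "G p z = G (\<Sum>i\<le>M. monom (coeff p i) i) (\<Sum>j\<le>M. monom (coeff z j) j)"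
    using p z by (simp add: poly_as_sum_of_monoms')
  also have "\<dots> = (\<Sum>i\<le>M. G (monom (coeff p i) i) (\<Sum>j\<le>M. monom (coeff z j) j))"
    by (rule additive_sum[of "\<lambda>p. G p _"]) (rule add)
  also have "\<dots> = (\<Sum>i\<le>M. \<Sum>j\<le>M. G (monom (coeff p i) i) (monom (coeff z j) j))"
    by (intro sum.cong refl additive_sum[of "G _"] add)
  also have "\<dots> = 0"
    unfolding G_def by (intro sum.neutral ballI contraction_cocycle_monom[OF \<beta>]) auto
  finally show ?thesis unfolding G_def .
qed

abbreviation "modes_homotopy N \<equiv> cur.insertion_homotopy (modes N) mode contraction"

text \<open>The sum of the degrees is merely a convenient bound for all of them: by
  \<open>current_homotopy_eq\<close> every larger cutoff gives the same value, so this is the sum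
  over all modes.\<close>

definition current_homotopy :: "('a poly list \<Rightarrow> 'k) \<Rightarrow> 'a poly list \<Rightarrow> 'k"
  where "current_homotopy \<omega> xs = modes_homotopy (sum_list (map degree xs)) \<omega> xs"

text \<open>A mode with \<open>k > N\<close> contracts every entry of the list to 0.\<close>

lemma modes_homotopy_mono:
  assumes \<omega>: "\<omega> \<in> cochains cscale UNIV n" and deg: "\<And>x. x \<in> set xs \<Longrightarrow> degree x \<le> N" and le: "N \<le> N'"
  shows "modes_homotopy N' \<omega> xs = modes_homotopy N \<omega> xs"
proof -
  have "slot_sum (contraction (k, b)) (ins (mode (k, b)) \<omega>) xs = 0" if "k > N" for k b
  proof -
    have "contraction (k, b) (xs ! i) = 0" if "i < length xs" for i
      using that \<open>k > N\<close> deg[of "xs ! i"] by (intro contraction_eq_0) auto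
    moreover have "ins (mode (k, b)) \<omega> (xs[i := 0]) = 0" if "i < length xs" for i
      using cochains_update_scale[OF ins_cochains[OF \<omega>] that, of _ 0 0] by simp
    ultimately show ?thesis unfolding slot_sum_def by (intro sum.neutral) auto
  qed
  then show ?thesis
    unfolding cur.insertion_homotopy_def sum_modes using le
    by (intro sum.mono_neutral_right) (auto intro!: sum.neutral)
qed

lemma current_homotopy_eq:
  assumes "\<omega> \<in> cochains cscale UNIV n" "\<And>x. x \<in> set xs \<Longrightarrow> degree x \<le> N"
  shows "current_homotopy \<omega> xs = modes_homotopy N \<omega> xs"
proof -
  have "degree x \<le> sum_list (map degree xs)" if "x \<in> set xs" for x
    using that by (intro member_le_sum_list) auto
  then show ?thesis
    using modes_homotopy_mono[OF assms(1), of xs N "max N (sum_list (map degree xs))"] assms(2)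
      modes_homotopy_mono[OF assms(1), of xs "sum_list (map degree xs)" "max N (sum_list (map degree xs))"]
    by (simp add: current_homotopy_def)
qed

lemma current_homotopy_cochains:
  assumes "\<omega> \<in> cochains cscale UNIV n"
  shows "current_homotopy \<omega> \<in> cochains cscale UNIV (n - 1)"
proof (rule cochains_local)
  fix S :: "'a poly set" assume S: "finite S"
  define N where "N = sum degree S"
  have "degree x \<le> N" if "x \<in> S" for x using that S unfolding N_def by (intro member_le_sum) auto
  then have "\<forall>xs. set xs \<subseteq> S \<longrightarrow> current_homotopy \<omega> xs = modes_homotopy N \<omega> xs"
    by (auto intro!: current_homotopy_eq[OF assms])
  then show "\<exists>\<eta>\<in>cochains cscale UNIV (n - 1). \<forall>xs. set xs \<subseteq> S \<longrightarrow> current_homotopy \<omega> xs = \<eta> xs"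
    by (intro bexI[of _ "modes_homotopy N \<omega>"] cur.insertion_homotopy_cochains[OF assms linear_contraction])
qed

text \<open>The cobracket of the current algebra with \<open>r\<close>-matrix proportional to
  \<open>\<Omega> (t + u) / (t - u)\<close> provides a homotopy between zero and the Euler derivation
  \<open>t d/dt\<close>.\<close>

lemma current_homotopy:
  assumes \<omega>: "\<omega> \<in> cochains cscale UNIV n"
  shows "cur.dd (current_homotopy \<omega>) xs + current_homotopy (cur.dd \<omega>) xs = - slot_sum euler \<omega> xs"
proof -
  define M where "M = sum_list (map degree xs)"
  have deg: "degree x \<le> M" if "x \<in> set xs" for x
    using that unfolding M_def by (intro member_le_sum_list) auto
  \<comment> \<open>The differential evaluates the homotopy on different lists, each with its own
    cutoff. All their entries, including the brackets, have degree at most \<open>M + M\<close>,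
    which is therefore used uniformly.\<close>
  have "cur.dd (current_homotopy \<omega>) xs = cur.dd (modes_homotopy (M + M) \<omega>) xs"
    unfolding ce_differential_def
  proof (intro if_cong refl sum.cong arg_cong2[where f = "(*)"] current_homotopy_eq[OF \<omega>])
    fix i j x
    assume ij: "j \<in> {..<length xs}" "i \<in> {..<j}"
      and x: "x \<in> set (cbracket (xs ! i) (xs ! j) # nths xs (- {i, j}))"
    have "degree (cbracket (xs ! i) (xs ! j)) \<le> M + M"
      using ij deg[of "xs ! i"] deg[of "xs ! j"] degree_cbracket_le[of "xs ! i" "xs ! j"] by auto
    moreover have "set (nths xs (- {i, j})) \<subseteq> set xs" by (rule set_nths_subset)
    ultimately show "degree x \<le> M + M" using x deg[of x] by auto
  qed
  moreover have "current_homotopy (cur.dd \<omega>) xs = modes_homotopy (M + M) (cur.dd \<omega>) xs"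
    using deg by (intro current_homotopy_eq[OF cur.ce_differential_cochains[OF \<omega>]]) force
  moreover have "cur.dd (modes_homotopy (M + M) \<omega>) xs + modes_homotopy (M + M) (cur.dd \<omega>) xs =
      - slot_sum euler \<omega> xs"
    using deg
    by (intro cur.insertion_homotopy[where X = "{p. degree p \<le> M}", OF linear_contraction _ _ \<omega>]
        contraction_cocycle bracket_mode_contraction) auto
  ultimately show ?thesis by simp
qed

end

section \<open>Integration along dilations\<close>

text \<open>\<open>radial_integral P\<close> is the integral of \<open>(P(s) - P(0)) / s\<close> over the unit interval.\<close>

definition radial_integral :: "'k::field_char_0 poly \<Rightarrow> 'k"
  where "radial_integral P = (\<Sum>i=1..degree P. coeff P i / of_nat i)"

lemma radial_integral_bounded:
  assumes "degree P \<le> N"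
  shows "radial_integral P = (\<Sum>i=1..N. coeff P i / of_nat i)"
  unfolding radial_integral_def using assms
  by (intro sum.mono_neutral_left) (auto simp: coeff_eq_0)

lemma radial_integral_add: "radial_integral (P + Q) = radial_integral P + radial_integral Q"
proof -
  define N where "N = max (degree P) (degree Q)"
  have "degree (P + Q) \<le> N" "degree P \<le> N" "degree Q \<le> N"
    by (auto simp: N_def intro: degree_add_le)
  then show ?thesis by (simp add: radial_integral_bounded sum.distrib add_divide_distrib)
qed

lemma radial_integral_smult: "radial_integral (smult c P) = c * radial_integral P"
  by (simp add: radial_integral_bounded[of "smult c P" "degree P"] radial_integral_def sum_distrib_left)

lemma radial_integral_0 [simp]: "radial_integral 0 = 0"
  by (simp add: radial_integral_def)

text \<open>The argument is s P'(s), so the integrand is P' itself: this is the fundamental theorem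
  of calculus for polynomials.\<close>

lemma radial_integral_euler: "radial_integral (pCons 0 (pderiv P)) = poly P 1 - poly P 0"
proof -
  have "radial_integral (pCons 0 (pderiv P)) = (\<Sum>i=1..Suc (degree P). coeff (pCons 0 (pderiv P)) i / of_nat i)"
    by (rule radial_integral_bounded) (auto simp: degree_pCons_eq_if pderiv.simps degree_pderiv)
  also have "\<dots> = (\<Sum>i=1..Suc (degree P). coeff P i)"
  proof (intro sum.cong refl)
    fix i assume "i \<in> {1..Suc (degree P)}"
    then obtain k where "i = Suc k" by (cases i) auto
    then show "coeff (pCons 0 (pderiv P)) i / of_nat i = coeff P i"
      by (simp add: coeff_pderiv del: of_nat_Suc)
  qed
  also have "\<dots> = (\<Sum>i\<le>Suc (degree P). coeff P i) - coeff P 0"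
    by (simp add: atLeast0AtMost[symmetric] sum.atLeast_Suc_atMost[of 0] del: sum.cl_ivl_Suc)
  also have "(\<Sum>i\<le>Suc (degree P). coeff P i) = poly P 1"
    by (simp add: poly_altdef coeff_eq_0)
  finally show ?thesis by (simp add: poly_0_coeff_0)
qed

context casimir_lie_algebra
begin

text \<open>A polynomial over a field of characteristic 0 is determined by its values, so the
  description is unique.\<close>

definition dilation_poly :: "('a poly list \<Rightarrow> 'k) \<Rightarrow> 'a poly list \<Rightarrow> 'k poly"
  where "dilation_poly \<omega> xs = (THE P. \<forall>s. poly P s = \<omega> (map (dilate s) xs))"

text \<open>Expanding the head of the list into monomials reduces to the tail, with factors s^i from
  the head. In the derivative, the product rule separates the Euler derivation acting on the head
  from that on the tail.\<close>

lemma dilation_poly_exists: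
  assumes "\<omega> \<in> cochains cscale UNIV n"
  shows "\<exists>P. \<forall>s. poly P s = \<omega> (map (dilate s) xs) \<and>
    s * poly (pderiv P) s = slot_sum euler \<omega> (map (dilate s) xs)"
  using assms
proof (induction xs arbitrary: \<omega> n)
  case Nil
  show ?case by (intro exI[of _ "[:\<omega> []:]"]) simp
next
  case (Cons p xs)
  note \<omega> = Cons.prems
  let ?m = "\<lambda>i. monom (coeff p i) i"
  obtain P where P: "\<And>i s. poly (P i) s = ins (?m i) \<omega> (map (dilate s) xs)"
    "\<And>i s. s * poly (pderiv (P i)) s = slot_sum euler (ins (?m i) \<omega>) (map (dilate s) xs)"
  proof -
    have "\<forall>i. \<exists>P. \<forall>s. poly P s = ins (?m i) \<omega> (map (dilate s) xs) \<and>
        s * poly (pderiv P) s = slot_sum euler (ins (?m i) \<omega>) (map (dilate s) xs)"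
      by (intro allI Cons.IH[OF ins_cochains[OF \<omega>]])
    from choice[OF this] that show ?thesis by blast
  qed
  have dil: "dilate s p = (\<Sum>i\<le>degree p. cscale (s ^ i) (?m i))" for s
    by (simp add: reweight_def current_scale_monom)
  have eul: "euler (dilate s p) = (\<Sum>i\<le>degree p. cscale (of_nat i * s ^ i) (?m i))" for s
    unfolding dil additive_sum[of euler, OF reweight_add] reweight_scale reweight_monom
    by (simp add: mult.commute)
  have insd: "ins (dilate s p) \<omega> = (\<lambda>ys. \<Sum>i\<le>degree p. s ^ i * ins (?m i) \<omega> ys)" for s
    unfolding ins_def dil cochains_Cons_sum[OF \<omega>] cochains_Cons_scale[OF \<omega>] ..
  define Q where "Q = (\<Sum>i\<le>degree p. monom 1 i * P i)"
  show ?case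
  proof (intro exI[of _ Q] allI conjI)
    fix s
    have "\<omega> (map (dilate s) (p # xs)) = ins (dilate s p) \<omega> (map (dilate s) xs)" by (simp add: ins_def)
    then show "poly Q s = \<omega> (map (dilate s) (p # xs))"
      by (simp add: Q_def poly_sum poly_monom P insd)
    have "s * poly (pderiv (monom 1 i * P i)) s =
        s ^ i * slot_sum euler (ins (?m i) \<omega>) (map (dilate s) xs)
        + of_nat i * s ^ i * ins (?m i) \<omega> (map (dilate s) xs)" for i
    proof -
      \<comment> \<open>The case \<open>i = 0\<close> is separate because of truncated subtraction;
        there both sides vanish.\<close>
      have "s * (of_nat i * s ^ (i - 1)) = of_nat i * s ^ i" by (cases i) simp_all
      then show ?thesis
        by (simp add: pderiv_mult pderiv_monom poly_monom P[symmetric] algebra_simps) (auto)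
    qed
    then have "s * poly (pderiv Q) s = (\<Sum>i\<le>degree p. s ^ i * slot_sum euler (ins (?m i) \<omega>) (map (dilate s) xs))
        + (\<Sum>i\<le>degree p. of_nat i * s ^ i * ins (?m i) \<omega> (map (dilate s) xs))"
      by (simp add: Q_def poly_sum additive_sum[of pderiv, OF pderiv_add] sum_distrib_left sum.distrib)
    also have "(\<Sum>i\<le>degree p. s ^ i * slot_sum euler (ins (?m i) \<omega>) (map (dilate s) xs))
        = slot_sum euler (ins (dilate s p) \<omega>) (map (dilate s) xs)"
      unfolding insd slot_sum_sum by (simp add: slot_sum_def sum_distrib_left)
    also have "(\<Sum>i\<le>degree p. of_nat i * s ^ i * ins (?m i) \<omega> (map (dilate s) xs))
        = \<omega> (euler (dilate s p) # map (dilate s) xs)"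
      unfolding eul cochains_Cons_sum[OF \<omega>] cochains_Cons_scale[OF \<omega>] by (simp add: ins_def)
    finally show "s * poly (pderiv Q) s = slot_sum euler \<omega> (map (dilate s) (p # xs))"
      by (simp add: slot_sum_Cons)
  qed
qed

lemma dilation_poly_eqI:
  assumes "\<And>s. poly P s = \<omega> (map (dilate s) xs)"
  shows "dilation_poly \<omega> xs = P"
  unfolding dilation_poly_def
proof (rule the_equality)
  fix Q assume "\<forall>s. poly Q s = \<omega> (map (dilate s) xs)"
  then have "poly Q = poly P" using assms by (simp add: fun_eq_iff)
  then show "Q = P" by (simp add: poly_eq_poly_eq_iff)
qed (use assms in simp)

lemma poly_dilation_poly:
  assumes "\<omega> \<in> cochains cscale UNIV n"
  shows "poly (dilation_poly \<omega> xs) s = \<omega> (map (dilate s) xs)"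
proof -
  obtain P where "\<And>s. poly P s = \<omega> (map (dilate s) xs)" using dilation_poly_exists[OF assms] by metis
  then show ?thesis using dilation_poly_eqI[of P \<omega> xs] by simp
qed

text \<open>The integral over s in [0, 1] of (\<open>\<omega>(s xs) - \<omega>(0 xs)\<close>) / s,
  where s acts by dilation. It inverts the Euler derivation up to evaluation at t = 0.\<close>

definition radial :: "('a poly list \<Rightarrow> 'k) \<Rightarrow> 'a poly list \<Rightarrow> 'k"
  where "radial \<omega> xs = radial_integral (dilation_poly \<omega> xs)"

lemma radial_cong:
  assumes "\<And>s. \<omega> (map (dilate s) xs) = \<eta> (map (dilate s) xs)"
  shows "radial \<omega> xs = radial \<eta> xs"
  by (simp add: radial_def dilation_poly_def assms)

lemma radial_cochains:
  assumes \<omega>: "\<omega> \<in> cochains cscale UNIV n"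
  shows "radial \<omega> \<in> cochains cscale UNIV n"
proof -
  note p = poly_dilation_poly[OF \<omega>]
  have zero: "radial \<omega> xs = 0" if "\<And>s. \<omega> (map (dilate s) xs) = 0" for xs
    using dilation_poly_eqI[of 0 \<omega> xs] that by (simp add: radial_def)
  have "radial \<omega> xs = 0" if "length xs \<noteq> n" for xs
    using that by (intro zero) (simp add: cochains_length[OF \<omega>])
  moreover have "radial \<omega> xs = 0" if "i < j" "j < length xs" "xs ! i = xs ! j" for xs i j
    using that by (intro zero cochains_eq_zero[OF \<omega>, of i j]) auto
  moreover have "radial \<omega> (xs[i := x + y]) = radial \<omega> (xs[i := x]) + radial \<omega> (xs[i := y])"
    if "i < length xs" for xs i x y
  proof -
    have "dilation_poly \<omega> (xs[i := x + y]) = dilation_poly \<omega> (xs[i := x]) + dilation_poly \<omega> (xs[i := y])"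
      using that by (intro dilation_poly_eqI)
        (simp add: p map_update reweight_add cochains_update_add[OF \<omega>])
    then show ?thesis by (simp add: radial_def radial_integral_add)
  qed
  moreover have "radial \<omega> (xs[i := cscale c x]) = c * radial \<omega> (xs[i := x])"
    if "i < length xs" for xs i c x
  proof -
    have "dilation_poly \<omega> (xs[i := cscale c x]) = smult c (dilation_poly \<omega> (xs[i := x]))"
      using that by (intro dilation_poly_eqI)
        (simp add: p map_update reweight_scale cochains_update_scale[OF \<omega>])
    then show ?thesis by (simp add: radial_def radial_integral_smult)
  qed
  ultimately show ?thesis unfolding cochains_def by auto
qed

lemma radial_add:
  assumes "\<omega> \<in> cochains cscale UNIV n" "\<eta> \<in> cochains cscale UNIV m"
  shows "radial (\<omega> + \<eta>) xs = radial \<omega> xs + radial \<eta> xs"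
proof -
  have "dilation_poly (\<omega> + \<eta>) xs = dilation_poly \<omega> xs + dilation_poly \<eta> xs"
    by (rule dilation_poly_eqI) (simp add: poly_dilation_poly[OF assms(1)] poly_dilation_poly[OF assms(2)])
  then show ?thesis by (simp add: radial_def radial_integral_add)
qed

lemma radial_uminus:
  assumes "\<omega> \<in> cochains cscale UNIV n"
  shows "radial (- \<omega>) xs = - radial \<omega> xs"
proof -
  have "dilation_poly (- \<omega>) xs = smult (-1) (dilation_poly \<omega> xs)"
    by (rule dilation_poly_eqI) (simp add: poly_dilation_poly[OF assms(1)])
  then show ?thesis by (simp only: radial_def radial_integral_smult) simp
qed

text \<open>Dilations are Lie algebra endomorphisms, so pullback along them commutes with the
  differential, and the integral is linear in the polynomial.\<close>

lemma radial_ce_differential: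
  assumes \<omega>: "\<omega> \<in> cochains cscale UNIV n"
  shows "radial (cur.dd \<omega>) = cur.dd (radial \<omega>)"
proof
  fix xs
  have J: "radial_integral (\<Sum>i\<in>A. f i) = (\<Sum>i\<in>A. radial_integral (f i))" for A f
    by (rule additive_sum) (rule radial_integral_add)
  have "dilation_poly (cur.dd \<omega>) xs = (\<Sum>j<length xs. \<Sum>i<j.
      smult ((- 1) ^ (i + j)) (dilation_poly \<omega> (cbracket (xs ! i) (xs ! j) # nths xs (- {i, j}))))"
    by (rule dilation_poly_eqI)
      (simp add: poly_sum poly_dilation_poly[OF \<omega>] ce_differential_def dilate_cbracket nths_map)
  then show "radial (cur.dd \<omega>) xs = cur.dd (radial \<omega>) xs"
    by (simp add: radial_def J radial_integral_smult ce_differential_def)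
qed

lemma radial_euler:
  assumes \<omega>: "\<omega> \<in> cochains cscale UNIV n"
  shows "radial (slot_sum euler \<omega>) xs = \<omega> xs - \<omega> (map (dilate 0) xs)"
proof -
  obtain P where P: "\<And>s. poly P s = \<omega> (map (dilate s) xs)"
    "\<And>s. s * poly (pderiv P) s = slot_sum euler \<omega> (map (dilate s) xs)"
    using dilation_poly_exists[OF \<omega>] by metis
  have "dilation_poly (slot_sum euler \<omega>) xs = pCons 0 (pderiv P)"
    by (rule dilation_poly_eqI) (simp add: P)
  moreover have "map (dilate 1) xs = xs"
    by (rule map_idI) (simp add: poly_eq_iff)
  ultimately show ?thesis
    using P(1)[of 0] P(1)[of 1] by (simp add: radial_def radial_integral_euler)
qed

lemma radial_homotopy:
  assumes \<omega>: "\<omega> \<in> cochains cscale UNIV n"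
  shows "cur.dd (radial (current_homotopy \<omega>)) xs + radial (current_homotopy (cur.dd \<omega>)) xs =
    - (\<omega> xs - \<omega> (map (dilate 0) xs))"
proof -
  note h = current_homotopy_cochains[OF \<omega>]
  have "Vector_Spaces.linear cscale cscale euler"
    by unfold_locales (simp_all add: reweight_add reweight_scale)
  note e = slot_sum_cochains[OF \<omega> this]
  have "cur.dd (radial (current_homotopy \<omega>)) xs + radial (current_homotopy (cur.dd \<omega>)) xs =
    radial (cur.dd (current_homotopy \<omega>) + current_homotopy (cur.dd \<omega>)) xs"
    using radial_add[OF cur.ce_differential_cochains[OF h]
        current_homotopy_cochains[OF cur.ce_differential_cochains[OF \<omega>]]]
    by (simp add: radial_ce_differential[OF h])
  also have "cur.dd (current_homotopy \<omega>) + current_homotopy (cur.dd \<omega>) = - slot_sum euler \<omega>"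
    by (rule ext) (simp add: current_homotopy[OF \<omega>])
  finally show ?thesis by (simp only: radial_uminus[OF e] radial_euler[OF \<omega>])
qed

end

section \<open>Traces and generalized eigenspaces\<close>

locale finite_dim_space = finite_dimensional_vector_space scale Basis
  for scale :: "'a::field \<Rightarrow> 'b::ab_group_add \<Rightarrow> 'b" and Basis
begin

definition shift :: "('b \<Rightarrow> 'b) \<Rightarrow> 'a \<Rightarrow> 'b \<Rightarrow> 'b"
  where "shift A \<mu> x = A x - scale \<mu> x"

definition gen_eigenspace :: "('b \<Rightarrow> 'b) \<Rightarrow> 'a \<Rightarrow> 'b set"
  where "gen_eigenspace A \<mu> = {v. \<exists>n. (shift A \<mu> ^^ n) v = 0}"

lemma linearI:
  assumes "\<And>x y. f (x + y) = f x + f y" "\<And>c x. f (scale c x) = scale c (f x)"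
  shows "Vector_Spaces.linear scale scale f"
  using assms by unfold_locales

lemma linear_add': "Vector_Spaces.linear scale scale f \<Longrightarrow> f (x + y) = f x + f y"
  and linear_scale': "Vector_Spaces.linear scale scale f \<Longrightarrow> f (scale c x) = scale c (f x)"
  and linear_0': "Vector_Spaces.linear scale scale f \<Longrightarrow> f 0 = 0"
  and linear_diff': "Vector_Spaces.linear scale scale f \<Longrightarrow> f (x - y) = f x - f y"
  and linear_sum': "Vector_Spaces.linear scale scale f \<Longrightarrow> f (sum g I) = (\<Sum>i\<in>I. f (g i))"
proof -
  assume "Vector_Spaces.linear scale scale f"
  then interpret f: Vector_Spaces.linear scale scale f .
  show "f (x + y) = f x + f y" "f (scale c x) = scale c (f x)" "f 0 = 0" "f (x - y) = f x - f y"
    "f (sum g I) = (\<Sum>i\<in>I. f (g i))"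
    by (rule f.add f.scale f.zero f.diff f.sum)+
qed

lemma linear_shift: "Vector_Spaces.linear scale scale A \<Longrightarrow> Vector_Spaces.linear scale scale (shift A \<mu>)"
  by (rule linearI) (simp_all add: shift_def linear_add' linear_scale' algebra_simps)

lemma linear_funpow: "Vector_Spaces.linear scale scale A \<Longrightarrow> Vector_Spaces.linear scale scale (A ^^ n)"
  by (rule linearI; induction n) (simp_all add: linear_add' linear_scale')

lemma subspace_gen_eigenspace:
  assumes "Vector_Spaces.linear scale scale A"
  shows "subspace (gen_eigenspace A \<mu>)"
proof (rule subspaceI)
  let ?S = "\<lambda>n. shift A \<mu> ^^ n"
  have lin: "Vector_Spaces.linear scale scale (?S n)" for n by (intro linear_funpow linear_shift assms)
  show "0 \<in> gen_eigenspace A \<mu>"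
    unfolding gen_eigenspace_def using linear_0'[OF lin[of 0]] by blast
  show "x + y \<in> gen_eigenspace A \<mu>" if xy: "x \<in> gen_eigenspace A \<mu>" "y \<in> gen_eigenspace A \<mu>" for x y
  proof -
    obtain m n where "?S m x = 0" "?S n y = 0" using xy unfolding gen_eigenspace_def by blast
    then have "?S (n + m) x = 0" "?S (m + n) y = 0"
      by (simp_all add: funpow_add linear_0'[OF lin])
    then have "?S (m + n) (x + y) = 0" by (simp add: linear_add'[OF lin] add.commute)
    then show ?thesis unfolding gen_eigenspace_def by blast
  qed
  show "scale c x \<in> gen_eigenspace A \<mu>" if "x \<in> gen_eigenspace A \<mu>" for c x
    using that by (auto simp: gen_eigenspace_def linear_scale'[OF lin])
qed

lemma gen_eigenspace_shift_iff: "shift A \<mu> x \<in> gen_eigenspace A \<mu> \<longleftrightarrow> x \<in> gen_eigenspace A \<mu>"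
  if "Vector_Spaces.linear scale scale A"
proof
  assume "shift A \<mu> x \<in> gen_eigenspace A \<mu>"
  then obtain n where "(shift A \<mu> ^^ n) (shift A \<mu> x) = 0" by (auto simp: gen_eigenspace_def)
  then have "(shift A \<mu> ^^ Suc n) x = 0" by (simp add: funpow_swap1)
  then show "x \<in> gen_eigenspace A \<mu>" unfolding gen_eigenspace_def by blast
next
  assume "x \<in> gen_eigenspace A \<mu>"
  then obtain n where "(shift A \<mu> ^^ n) x = 0" by (auto simp: gen_eigenspace_def)
  then have "(shift A \<mu> ^^ n) (shift A \<mu> x) = 0"
    using linear_0'[OF linear_shift[OF that]] by (simp add: funpow_swap1[symmetric])
  then show "shift A \<mu> x \<in> gen_eigenspace A \<mu>" unfolding gen_eigenspace_def by blast
qed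

lemma shift_shift: "shift A \<nu> x = shift A \<mu> x + scale (\<mu> - \<nu>) x"
  by (simp add: shift_def algebra_simps)

lemma gen_eigenspace_shift_other:
  assumes A: "Vector_Spaces.linear scale scale A" and x: "x \<in> gen_eigenspace A \<mu>"
  shows "shift A \<nu> x \<in> gen_eigenspace A \<mu>"
  unfolding shift_shift[of A \<nu> x \<mu>]
  using subspace_gen_eigenspace[OF A] x
  by (intro subspace_add subspace_scale) (auto simp: gen_eigenspace_shift_iff[OF A])

text \<open>\<open>A - \<nu>\<close> is a nonzero scalar plus a nilpotent operator on the
  generalized eigenspace of \<open>\<mu>\<close>. The induction on the nilpotency order runs the
  finite geometric series of its inverse and keeps the preimage in \<open>W\<close>.\<close>

lemma shift_surj:
  assumes A: "Vector_Spaces.linear scale scale A" and W: "subspace W" "\<And>w. w \<in> W \<Longrightarrow> A w \<in> W"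
    and "\<mu> \<noteq> \<nu>" and z: "z \<in> W" "z \<in> gen_eigenspace A \<mu>"
  shows "\<exists>z'\<in>W. shift A \<nu> z' = z"
proof -
  obtain n where "(shift A \<mu> ^^ n) z = 0" using z by (auto simp: gen_eigenspace_def)
  then show ?thesis using z(1)
  proof (induction n arbitrary: z)
    case 0
    then show ?case using linear_0'[OF linear_shift[OF A]] subspace_0[OF W(1)] by auto
  next
    case (Suc n)
    have "shift A \<mu> z \<in> W"
      unfolding shift_def using Suc.prems W by (intro subspace_diff subspace_scale) auto
    moreover have "(shift A \<mu> ^^ n) (shift A \<mu> z) = 0" using Suc.prems by (simp add: funpow_swap1)
    ultimately obtain y where y: "y \<in> W" "shift A \<nu> y = shift A \<mu> z" using Suc.IH by blast
    have "shift A \<nu> (z - y) = scale (\<mu> - \<nu>) z"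
      by (simp add: linear_diff'[OF linear_shift[OF A]] y shift_shift[of A \<nu> z \<mu>])
    then have "shift A \<nu> (scale (inverse (\<mu> - \<nu>)) (z - y)) = z"
      using \<open>\<mu> \<noteq> \<nu>\<close> by (simp add: linear_scale'[OF linear_shift[OF A]])
    then show ?case using y Suc.prems W(1) by (intro bexI[of _ "scale (inverse (\<mu> - \<nu>)) (z - y)"]
          subspace_scale subspace_diff) auto
  qed
qed

text \<open>By induction \<open>shift A \<mu> x\<close> is 0, so \<open>x\<close> is an eigenvector
  on which powers of \<open>A - \<nu>\<close> act by powers of \<open>\<mu> - \<nu>\<close>.\<close>

lemma shift_inj:
  assumes A: "Vector_Spaces.linear scale scale A" and "\<mu> \<noteq> \<nu>"
    and x: "x \<in> gen_eigenspace A \<mu>" "x \<in> gen_eigenspace A \<nu>"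
  shows "x = 0"
proof -
  obtain n where "(shift A \<mu> ^^ n) x = 0" using x by (auto simp: gen_eigenspace_def)
  then show ?thesis using x(2)
  proof (induction n arbitrary: x)
    case (Suc n)
    have "(shift A \<mu> ^^ n) (shift A \<mu> x) = 0" using Suc.prems by (simp add: funpow_swap1)
    then have x0: "shift A \<mu> x = 0" using Suc gen_eigenspace_shift_other[OF A Suc.prems(2)] by blast
    have e: "shift A \<nu> x = scale (\<mu> - \<nu>) x" using x0 shift_shift[of A \<nu> x \<mu>] by simp
    obtain m where "(shift A \<nu> ^^ m) x = 0" using Suc.prems by (auto simp: gen_eigenspace_def)
    moreover have "(shift A \<nu> ^^ m) x = scale ((\<mu> - \<nu>) ^ m) x"
      by (induction m) (simp_all add: linear_scale'[OF linear_shift[OF A]] e mult.commute)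
    ultimately show ?case using \<open>\<mu> \<noteq> \<nu>\<close> by simp
  qed simp
qed

text \<open>A power of \<open>A - \<nu>\<close> kills the \<open>\<nu>\<close> component. By
  induction it kills every other component too, and these then lie in two generalized eigenspaces at
  once.\<close>

lemma gen_eigenspaces_independent:
  assumes A: "Vector_Spaces.linear scale scale A" and "finite F"
    and "\<And>\<mu>. \<mu> \<in> F \<Longrightarrow> w \<mu> \<in> gen_eigenspace A \<mu>" and "(\<Sum>\<mu>\<in>F. w \<mu>) = 0" and "\<mu> \<in> F"
  shows "w \<mu> = 0"
  using assms(2-)
proof (induction F arbitrary: w \<mu>)
  case (insert \<nu> F)
  have "w \<nu> \<in> gen_eigenspace A \<nu>" using insert.prems by auto
  then obtain n where n: "(shift A \<nu> ^^ n) (w \<nu>) = 0" by (auto simp: gen_eigenspace_def)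
  have lin: "Vector_Spaces.linear scale scale (shift A \<nu> ^^ n)" by (intro linear_funpow linear_shift A)
  have "(\<Sum>\<mu>\<in>F. (shift A \<nu> ^^ n) (w \<mu>)) = (shift A \<nu> ^^ n) (\<Sum>\<mu>\<in>insert \<nu> F. w \<mu>)"
    using insert.hyps n by (simp add: linear_add'[OF lin] linear_sum'[OF lin])
  also have "\<dots> = 0" unfolding insert.prems(2) by (rule linear_0'[OF lin])
  finally have s: "(\<Sum>\<mu>\<in>F. (shift A \<nu> ^^ n) (w \<mu>)) = 0" .
  have F: "w \<mu> = 0" if "\<mu> \<in> F" for \<mu>
  proof -
    have "(shift A \<nu> ^^ k) (w \<mu>) \<in> gen_eigenspace A \<mu>" if "\<mu> \<in> F" for k \<mu>
      by (induction k) (use insert.prems(1) that in \<open>auto simp: gen_eigenspace_shift_other[OF A]\<close>)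
    then have "(shift A \<nu> ^^ n) (w \<mu>) = 0" using insert.IH[of "\<lambda>\<mu>. (shift A \<nu> ^^ n) (w \<mu>)"] s that by blast
    then have "w \<mu> \<in> gen_eigenspace A \<nu>" unfolding gen_eigenspace_def by blast
    moreover have "\<mu> \<noteq> \<nu>" using that insert.hyps by auto
    ultimately show ?thesis using shift_inj[OF A, of \<mu> \<nu> "w \<mu>"] insert.prems(1)[of \<mu>] that by blast
  qed
  then show ?case using insert.prems insert.hyps by auto
qed simp

section \<open>Polynomials in an operator, applied to a fixed vector\<close>

definition poly_orbit :: "('b \<Rightarrow> 'b) \<Rightarrow> 'b \<Rightarrow> 'a poly \<Rightarrow> 'b"
  where "poly_orbit A u p = (\<Sum>i\<le>degree p. scale (coeff p i) ((A ^^ i) u))"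

lemma poly_orbit_bounded:
  "degree p \<le> n \<Longrightarrow> poly_orbit A u p = (\<Sum>i\<le>n. scale (coeff p i) ((A ^^ i) u))"
  unfolding poly_orbit_def by (intro sum.mono_neutral_left) (auto simp: coeff_eq_0)

lemma poly_orbit_add: "poly_orbit A u (p + q) = poly_orbit A u p + poly_orbit A u q"
proof -
  define n where "n = max (degree p) (degree q)"
  have "degree p \<le> n" "degree q \<le> n" "degree (p + q) \<le> n"
    by (auto simp: n_def intro: degree_add_le)
  then show ?thesis by (simp add: poly_orbit_bounded scale_left_distrib sum.distrib)
qed

lemma poly_orbit_smult: "poly_orbit A u (smult c p) = scale c (poly_orbit A u p)"
  by (simp add: poly_orbit_bounded[of "smult c p" "degree p"] poly_orbit_def scale_sum_right)

lemma poly_orbit_monom: "poly_orbit A u (monom c n) = scale c ((A ^^ n) u)"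
proof -
  have "poly_orbit A u (monom c n) = (\<Sum>i\<le>n. if i = n then scale c ((A ^^ n) u) else 0)"
    unfolding poly_orbit_bounded[OF degree_monom_le] by (intro sum.cong) auto
  then show ?thesis by simp
qed

lemma poly_orbit_pCons_0:
  assumes "Vector_Spaces.linear scale scale A"
  shows "poly_orbit A u (pCons 0 p) = A (poly_orbit A u p)"
proof -
  have "poly_orbit A u (pCons 0 p) = (\<Sum>i\<le>Suc (degree p). scale (coeff (pCons 0 p) i) ((A ^^ i) u))"
    by (rule poly_orbit_bounded) (simp add: degree_pCons_le)
  also have "\<dots> = (\<Sum>i\<le>degree p. scale (coeff p i) (A ((A ^^ i) u)))"
    by (subst sum.atMost_Suc_shift) simp
  finally show ?thesis by (simp add: poly_orbit_def linear_sum'[OF assms] linear_scale'[OF assms])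
qed

lemma poly_orbit_linear_factor:
  assumes "Vector_Spaces.linear scale scale A"
  shows "poly_orbit A u ([:- z, 1:] * q) = shift A z (poly_orbit A u q)"
proof -
  have "[:- z, 1:] * q = pCons 0 q + smult (- z) q" by simp
  then show ?thesis
    by (simp only: poly_orbit_add poly_orbit_smult poly_orbit_pCons_0[OF assms] shift_def) simp
qed

text \<open>By finite dimension some A^n u lies in the span of the earlier powers. Writing it as
  q(A) u with \<open>coeff q n = 0\<close> makes t^n - q nonzero without any control of the degree
  of q.\<close>

lemma poly_orbit_kernel:
  "\<exists>p. p \<noteq> 0 \<and> poly_orbit A u p = 0"
proof -
  define U where "U n = (\<lambda>i. (A ^^ i) u) ` {..<n}" for n :: nat
  have "\<exists>n. (A ^^ n) u \<in> span (U n)"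
  proof (rule ccontr)
    assume "\<not> ?thesis"
    then have "dim (U n) = n" for n
      by (induction n) (simp_all add: U_def lessThan_Suc dim_insert)
    then show False using dim_subset_UNIV[of "U (Suc dimension)"] by simp
  qed
  then obtain n where n: "(A ^^ n) u \<in> span (U n)" by blast
  have "span (U n) \<subseteq> {poly_orbit A u q | q. coeff q n = 0}"
  proof (rule span_minimal)
    show "U n \<subseteq> {poly_orbit A u q | q. coeff q n = 0}"
    proof
      fix x assume "x \<in> U n"
      then obtain i where "i < n" "x = (A ^^ i) u" by (auto simp: U_def)
      then have "x = poly_orbit A u (monom 1 i)" "coeff (monom 1 i :: 'a poly) n = 0"
        by (simp_all add: poly_orbit_monom)
      then show "x \<in> {poly_orbit A u q | q. coeff q n = 0}" by blast
    qed
    show "subspace {poly_orbit A u q | q. coeff q n = 0}"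
    proof (rule subspaceI)
      have "poly_orbit A u 0 = 0" "coeff (0 :: 'a poly) n = 0" by (simp_all add: poly_orbit_def)
      then show "0 \<in> {poly_orbit A u q | q. coeff q n = 0}" by force
    next
      fix x y assume "x \<in> {poly_orbit A u q | q. coeff q n = 0}" "y \<in> {poly_orbit A u q | q. coeff q n = 0}"
      then obtain p q where "x = poly_orbit A u p" "y = poly_orbit A u q" "coeff p n = 0" "coeff q n = 0" by auto
      then have "x + y = poly_orbit A u (p + q)" "coeff (p + q) n = 0" by (simp_all add: poly_orbit_add)
      then show "x + y \<in> {poly_orbit A u q | q. coeff q n = 0}" by blast
    next
      fix c x assume "x \<in> {poly_orbit A u q | q. coeff q n = 0}"
      then obtain p where "x = poly_orbit A u p" "coeff p n = 0" by auto
      then have "scale c x = poly_orbit A u (smult c p)" "coeff (smult c p) n = 0" by (simp_all add: poly_orbit_smult)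
      then show "scale c x \<in> {poly_orbit A u q | q. coeff q n = 0}" by blast
    qed
  qed
  then obtain q where q: "(A ^^ n) u = poly_orbit A u q" "coeff q n = 0" using n by blast
  have "poly_orbit A u (monom 1 n + smult (- 1) q) = 0"
    unfolding poly_orbit_add poly_orbit_smult poly_orbit_monom q(1) by simp
  moreover have "coeff (monom 1 n + smult (- 1) q) n = 1" using q(2) by simp
  then have "monom 1 n + smult (- 1) q \<noteq> 0" by (metis coeff_0 zero_neq_one)
  ultimately show ?thesis by blast
qed

section \<open>Traces with respect to a basis\<close>

definition trace :: "'b set \<Rightarrow> ('b \<Rightarrow> 'b) \<Rightarrow> 'a"
  where "trace C f = (\<Sum>b\<in>C. representation C (f b) b)"

lemma basis_expansion:
  assumes "independent C" "span C = UNIV"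
  shows "(\<Sum>b\<in>C. scale (representation C v b) b) = v"
  using assms by (intro sum_representation_eq) (auto simp: finiteI_independent)

lemma representation_sum_scale:
  assumes "independent C" "span C = UNIV"
  shows "representation C (\<Sum>i\<in>I. scale (r i) (v i)) b = (\<Sum>i\<in>I. r i * representation C (v i) b)"
  using assms by (simp add: representation_sum representation_scale)

lemma trace_basis:
  assumes C: "independent C" "span C = UNIV" and D: "independent D" "span D = UNIV"
    and f: "Vector_Spaces.linear scale scale f"
  shows "trace C f = trace D f"
proof -
  have "trace C f = (\<Sum>b\<in>C. representation C (f (\<Sum>c\<in>D. scale (representation D b c) c)) b)"
    by (simp add: trace_def basis_expansion[OF D])
  also have "\<dots> = (\<Sum>b\<in>C. \<Sum>c\<in>D. representation D b c * representation C (f c) b)"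
    by (simp add: linear_sum'[OF f] linear_scale'[OF f] representation_sum_scale[OF C])
  also have "\<dots> = (\<Sum>c\<in>D. \<Sum>b\<in>C. representation C (f c) b * representation D b c)"
    by (subst sum.swap) (simp add: mult.commute)
  also have "\<dots> = (\<Sum>c\<in>D. representation D (\<Sum>b\<in>C. scale (representation C (f c) b) b) c)"
    by (simp add: representation_sum_scale[OF D])
  finally show ?thesis by (simp add: trace_def basis_expansion[OF C])
qed

lemma trace_add:
  assumes "independent C" "span C = UNIV"
  shows "trace C (\<lambda>x. f x + g x) = trace C f + trace C g"
  using assms by (simp add: trace_def representation_add sum.distrib)

lemma trace_diff:
  assumes "independent C" "span C = UNIV"
  shows "trace C (\<lambda>x. f x - g x) = trace C f - trace C g"
  using assms by (simp add: trace_def representation_diff sum_subtractf)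

lemma trace_scale:
  assumes "independent C" "span C = UNIV"
  shows "trace C (\<lambda>x. scale c (f x)) = c * trace C f"
  using assms by (simp add: trace_def representation_scale sum_distrib_left)

lemma trace_commute:
  assumes C: "independent C" "span C = UNIV" and f: "Vector_Spaces.linear scale scale f" and g: "Vector_Spaces.linear scale scale g"
  shows "trace C (\<lambda>x. f (g x)) = trace C (\<lambda>x. g (f x))"
proof -
  have e: "representation C (f (g b)) b = (\<Sum>c\<in>C. representation C (g b) c * representation C (f c) b)"
    if "Vector_Spaces.linear scale scale f" for f g b
  proof -
    have "f (g b) = f (\<Sum>c\<in>C. scale (representation C (g b) c) c)" by (simp add: basis_expansion[OF C])
    then show ?thesis
      by (simp add: linear_sum'[OF that] linear_scale'[OF that] representation_sum_scale[OF C])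
  qed
  show ?thesis unfolding trace_def e[OF f, of g] e[OF g, of f] by (subst sum.swap) (simp add: mult.commute)
qed

lemma span_proper_dim:
  assumes "subspace S" "subspace T" "S \<subset> T"
  shows "dim S < dim T"
  using assms by (intro dim_psubset) (simp add: span_eq_iff[THEN iffD2])

end

locale complex_vector_space = finite_dim_space scale Basis
  for scale :: "complex \<Rightarrow> 'b::ab_group_add \<Rightarrow> 'b" and Basis
begin

text \<open>An eigenvector modulo \<open>W\<close>, found without quotient spaces: take a nonzero p
  of least degree with p(A) u in \<open>W\<close>, split off a linear factor t - z, and use the
  cofactor q, for which q(A) u is outside \<open>W\<close> by minimality.\<close>

lemma quotient_eigenvector:
  assumes A: "Vector_Spaces.linear scale scale A" and W: "subspace W" "W \<noteq> UNIV"
  shows "\<exists>v \<mu>. v \<notin> W \<and> shift A \<mu> v \<in> W"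
proof -
  obtain u where u: "u \<notin> W" using W by auto
  define P where "P p \<longleftrightarrow> p \<noteq> 0 \<and> poly_orbit A u p \<in> W" for p
  have "\<exists>p. P p" using poly_orbit_kernel[of A u] subspace_0[OF W(1)] unfolding P_def by metis
  then obtain p where p: "P p" "\<And>q. P q \<Longrightarrow> degree p \<le> degree q"
    using ex_has_least_nat[of P _ degree] by blast
  have "degree p \<noteq> 0"
  proof
    assume "degree p = 0"
    then obtain c where c: "p = [:c:]" by (rule degree_eq_zeroE)
    then have "c \<noteq> 0" "scale c u \<in> W" using p(1) by (auto simp: P_def poly_orbit_def)
    then have "scale (inverse c) (scale c u) \<in> W" using subspace_scale[OF W(1)] by blast
    then show False using u \<open>c \<noteq> 0\<close> by simp
  qed
  then obtain z where "poly p z = 0"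
    using fundamental_theorem_of_algebra[of p] by (auto simp: constant_degree)
  then obtain q where q: "p = [:- z, 1:] * q" by (metis poly_eq_0_iff_dvd dvdE)
  have "q \<noteq> 0" using q p(1) by (auto simp: P_def)
  then have "degree q < degree p" by (simp add: q degree_mult_eq del: mult_pCons_left)
  then have "\<not> P q" using p(2)[of q] by auto
  then have "poly_orbit A u q \<notin> W" using \<open>q \<noteq> 0\<close> by (simp add: P_def)
  moreover have "shift A z (poly_orbit A u q) \<in> W"
    using p(1) poly_orbit_linear_factor[OF A, of u z q] by (simp only: P_def q[symmetric])
  ultimately show ?thesis by blast
qed

text \<open>No order on \<open>C\<close> is recorded. The condition \<open>b \<notin> S\<close> is
  what makes \<open>\<mu> b\<close> the diagonal entry of \<open>A\<close> at \<open>b\<close>,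
  which is all that the trace sees.\<close>

definition triangular :: "('b \<Rightarrow> 'b) \<Rightarrow> 'b set \<Rightarrow> ('b \<Rightarrow> complex) \<Rightarrow> bool"
  where "triangular A C \<mu> \<longleftrightarrow> independent C \<and>
    (\<forall>b\<in>C. b \<in> gen_eigenspace A (\<mu> b) \<and> (\<exists>S\<subseteq>C. b \<notin> S \<and> shift A (\<mu> b) b \<in> span S))"

lemma triangular_extend:
  assumes A: "Vector_Spaces.linear scale scale A" and C: "triangular A C \<mu>" and "span C \<noteq> UNIV"
  shows "\<exists>b \<nu>. b \<notin> C \<and> triangular A (insert b C) \<nu>"
proof -
  have ind: "independent C" using C by (simp add: triangular_def)
  have fin: "finite C" using ind by (rule finiteI_independent)
  let ?W = "span C"
  have W: "A w \<in> ?W" if "w \<in> ?W" for w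
    using that
  proof (induction rule: span_induct_alt)
    case base
    show ?case using linear_0'[OF A] span_zero by simp
  next
    case (step c x y)
    obtain S where S: "S \<subseteq> C" "shift A (\<mu> x) x \<in> span S" using C step.hyps by (auto simp: triangular_def)
    then have "shift A (\<mu> x) x + scale (\<mu> x) x \<in> ?W"
      using span_mono[OF S(1)] span_base[OF step(1)] by (intro span_add span_scale) auto
    then have "A x \<in> ?W" by (simp add: shift_def)
    then show ?case using step by (simp add: linear_add'[OF A] linear_scale'[OF A] span_add span_scale)
  qed
  obtain v \<rho> where v: "v \<notin> ?W" "shift A \<rho> v \<in> ?W"
    using quotient_eigenvector[OF A subspace_span assms(3)] by blast
  define r where "r = representation C (shift A \<rho> v)"
  have r: "shift A \<rho> v = (\<Sum>b\<in>C. scale (r b) b)"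
    unfolding r_def using sum_representation_eq[OF ind v(2) fin order.refl] by simp
  have g: "scale (r b) b \<in> gen_eigenspace A (\<mu> b)" if "b \<in> C" for b
    using that C by (intro subspace_scale[OF subspace_gen_eigenspace[OF A]]) (simp add: triangular_def)
  have "\<exists>z\<in>?W. shift A \<rho> z = scale (r b) b" if "b \<in> C" "\<mu> b \<noteq> \<rho>" for b
    using that g W by (intro shift_surj[OF A, of _ "\<mu> b"]) (auto intro: span_base span_scale)
  then obtain z where z: "\<And>b. b \<in> C \<Longrightarrow> \<mu> b \<noteq> \<rho> \<Longrightarrow> z b \<in> ?W \<and> shift A \<rho> (z b) = scale (r b) b" by metis
  \<comment> \<open>The eigenvector modulo \<open>span C\<close> is corrected so that only
    components with eigenvalue \<open>\<rho>\<close> remain in \<open>shift A \<rho> x\<close>; this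
    puts \<open>x\<close> itself into the generalized eigenspace of \<open>\<rho>\<close>.\<close>
  define x where "x = v - (\<Sum>b\<in>{b\<in>C. \<mu> b \<noteq> \<rho>}. z b)"
  have "(\<Sum>b\<in>{b\<in>C. \<mu> b \<noteq> \<rho>}. z b) \<in> ?W" using z by (intro span_sum) auto
  then have x: "x \<notin> ?W" using v(1) span_add[of x C "\<Sum>b\<in>{b\<in>C. \<mu> b \<noteq> \<rho>}. z b"] by (auto simp: x_def)
  have "shift A \<rho> x = (\<Sum>b\<in>C. scale (r b) b) - (\<Sum>b\<in>{b\<in>C. \<mu> b \<noteq> \<rho>}. scale (r b) b)"
    unfolding x_def linear_diff'[OF linear_shift[OF A]] linear_sum'[OF linear_shift[OF A]] r
    using z by simp
  also have "\<dots> = (\<Sum>b\<in>C - {b\<in>C. \<mu> b \<noteq> \<rho>}. scale (r b) b)" using fin by (subst sum_diff) auto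
  finally have sx: "shift A \<rho> x = (\<Sum>b\<in>C - {b\<in>C. \<mu> b \<noteq> \<rho>}. scale (r b) b)" .
  have "shift A \<rho> x \<in> gen_eigenspace A \<rho>"
    unfolding sx using g by (intro subspace_sum[OF subspace_gen_eigenspace[OF A]]) force
  then have gx: "x \<in> gen_eigenspace A \<rho>" by (simp add: gen_eigenspace_shift_iff[OF A])
  have "shift A \<rho> x \<in> ?W" unfolding sx by (intro span_sum span_scale span_base) auto
  moreover have xC: "x \<notin> C" using x span_base by blast
  ultimately have "triangular A (insert x C) (\<mu>(x := \<rho>))"
    unfolding triangular_def
  proof (intro conjI ballI)
    fix b assume "b \<in> insert x C"
    then consider "b = x" | "b \<in> C" "b \<noteq> x" by blast
    then show "b \<in> gen_eigenspace A ((\<mu>(x := \<rho>)) b)"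
      using gx C by cases (simp_all add: triangular_def)
    from \<open>b \<in> insert x C\<close> consider "b = x" | "b \<in> C" "b \<noteq> x" by blast
    then show "\<exists>S\<subseteq>insert x C. b \<notin> S \<and> shift A ((\<mu>(x := \<rho>)) b) b \<in> span S"
    proof cases
      case 1
      then show ?thesis using xC \<open>shift A \<rho> x \<in> ?W\<close> by (intro exI[of _ C]) auto
    next
      case 2
      then obtain S where "S \<subseteq> C" "b \<notin> S" "shift A (\<mu> b) b \<in> span S"
        using C unfolding triangular_def by blast
      then show ?thesis using 2 by (intro exI[of _ S]) auto
    qed
  qed (rule independent_insertI[OF x ind])
  then show ?thesis using xC by blast
qed

text \<open>A triangular set of maximal cardinality must span, since otherwise
  \<open>triangular_extend\<close> enlarges it.\<close>

lemma triangular_basis: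
  assumes A: "Vector_Spaces.linear scale scale A"
  shows "\<exists>C \<mu>. triangular A C \<mu> \<and> span C = UNIV"
proof -
  define P where "P C \<longleftrightarrow> (\<exists>\<mu>. triangular A C \<mu>)" for C
  have "P {}" by (auto simp: P_def triangular_def independent_empty)
  moreover have "card C < Suc dimension" if "P C" for C
    using that independent_card_le_dim[OF subset_UNIV, of C] dimension_def
    by (auto simp: P_def triangular_def)
  ultimately obtain C where C: "P C" "\<And>D. P D \<Longrightarrow> card D \<le> card C"
    using ex_has_greatest_nat[of P "{}" card "Suc dimension"] by auto
  obtain \<mu> where \<mu>: "triangular A C \<mu>" using C(1) by (auto simp: P_def)
  then have fin: "finite C" by (simp add: triangular_def finiteI_independent)
  have "span C = UNIV"
  proof (rule ccontr)
    assume "span C \<noteq> UNIV"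
    then obtain b \<nu> where "b \<notin> C" "triangular A (insert b C) \<nu>"
      using triangular_extend[OF A \<mu>] by blast
    then show False using C(2)[of "insert b C"] fin by (auto simp: P_def)
  qed
  then show ?thesis using \<mu> by blast
qed

lemma gen_eigenspace_representation:
  assumes A: "Vector_Spaces.linear scale scale A" and C: "triangular A C \<mu>" "span C = UNIV"
    and v: "v \<in> gen_eigenspace A \<rho>" and b: "b \<in> C" "\<mu> b \<noteq> \<rho>"
  shows "representation C v b = 0"
proof -
  have ind: "independent C" using C by (simp add: triangular_def)
  have fin: "finite C" using ind by (rule finiteI_independent)
  define r where "r = representation C v"
  define s where "s \<nu> = (\<Sum>b\<in>{b\<in>C. \<mu> b = \<nu>}. scale (r b) b)" for \<nu>
  \<comment> \<open>The basis expansion of \<open>v\<close>, grouped by eigenvalue, minus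
    \<open>v\<close> placed at \<open>\<rho>\<close>: a vanishing sum of generalized
    eigenvectors.\<close>
  define w where "w \<nu> = s \<nu> - (if \<nu> = \<rho> then v else 0)" for \<nu>
  let ?F = "insert \<rho> (\<mu> ` C)"
  have "(\<Sum>\<nu>\<in>?F. s \<nu>) = (\<Sum>\<nu>\<in>\<mu> ` C. s \<nu>)"
    using fin by (cases "\<rho> \<in> \<mu> ` C") (auto simp: insert_absorb s_def intro!: sum.neutral)
  also have "\<dots> = v"
    unfolding s_def sum.image_gen[OF fin, symmetric] r_def by (rule basis_expansion[OF ind C(2)])
  finally have w0: "(\<Sum>\<nu>\<in>?F. w \<nu>) = 0"
    using fin by (simp add: w_def sum_subtractf del: sum.insert)
  have wg: "w \<nu> \<in> gen_eigenspace A \<nu>" for \<nu>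
  proof -
    note sub = subspace_gen_eigenspace[OF A]
    have "s \<nu> \<in> gen_eigenspace A \<nu>"
      unfolding s_def using C by (intro subspace_sum[OF sub] subspace_scale[OF sub]) (auto simp: triangular_def)
    then show ?thesis unfolding w_def using v subspace_0[OF sub] by (intro subspace_diff[OF sub]) auto
  qed
  have "w (\<mu> b) = 0"
    using fin b by (intro gen_eigenspaces_independent[OF A _ wg w0]) auto
  then have "(\<Sum>b\<in>{c\<in>C. \<mu> c = \<mu> b}. scale (r b) b) = 0" using b by (simp add: w_def s_def)
  moreover have "independent {c\<in>C. \<mu> c = \<mu> b}" by (rule independent_mono[OF ind]) auto
  ultimately show ?thesis
    using independentD[of "{c\<in>C. \<mu> c = \<mu> b}" "{c\<in>C. \<mu> c = \<mu> b}" r b] fin b by (simp add: r_def)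
qed

text \<open>The semisimple part of the operator with its eigenvalues conjugated.\<close>

definition conj_part :: "'b set \<Rightarrow> ('b \<Rightarrow> complex) \<Rightarrow> 'b \<Rightarrow> 'b"
  where "conj_part C \<mu> v = (\<Sum>b\<in>C. scale (cnj (\<mu> b) * representation C v b) b)"

lemma linear_conj_part:
  assumes "independent C" "span C = UNIV"
  shows "Vector_Spaces.linear scale scale (conj_part C \<mu>)"
  using assms
  by (intro linearI) (simp_all add: conj_part_def representation_add representation_scale
      scale_left_distrib sum.distrib scale_sum_right algebra_simps)

lemma conj_part_gen_eigenspace:
  assumes A: "Vector_Spaces.linear scale scale A" and C: "triangular A C \<mu>" "span C = UNIV"
    and v: "v \<in> gen_eigenspace A \<rho>"
  shows "conj_part C \<mu> v = scale (cnj \<rho>) v"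
proof -
  have ind: "independent C" using C by (simp add: triangular_def)
  have "conj_part C \<mu> v = (\<Sum>b\<in>C. scale (cnj \<rho>) (scale (representation C v b) b))"
    unfolding conj_part_def using gen_eigenspace_representation[OF A C v]
    by (intro sum.cong refl) (metis mult_zero_right scale_scale scale_zero_left)
  then show ?thesis by (simp only: scale_sum_right[symmetric] basis_expansion[OF ind C(2)])
qed

text \<open>The diagonal entry at \<open>b\<close> is \<open>cnj (\<mu> b) * \<mu> b\<close>. That
  these are nonnegative is the point of conjugating: a vanishing trace forces every eigenvalue to
  vanish.\<close>

lemma trace_conj_part:
  assumes A: "Vector_Spaces.linear scale scale A" and C: "triangular A C \<mu>" "span C = UNIV"
  shows "trace C (\<lambda>v. conj_part C \<mu> (A v)) = of_real (\<Sum>b\<in>C. (cmod (\<mu> b))\<^sup>2)"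
proof -
  have ind: "independent C" using C by (simp add: triangular_def)
  have rep: "representation C (conj_part C \<mu> v) b = cnj (\<mu> b) * representation C v b" if "b \<in> C" for v b
  proof -
    have "representation C (conj_part C \<mu> v) b = (\<Sum>c\<in>C. (cnj (\<mu> c) * representation C v c) * representation C c b)"
      unfolding conj_part_def by (rule representation_sum_scale[OF ind C(2)])
    also have "\<dots> = (\<Sum>c\<in>C. if c = b then cnj (\<mu> b) * representation C v b else 0)"
      by (intro sum.cong) (auto simp: representation_basis[OF ind])
    finally show ?thesis using that by (simp add: finiteI_independent[OF ind])
  qed
  have "representation C (A b) b = \<mu> b" if "b \<in> C" for b
  proof -
    obtain S where S: "S \<subseteq> C" "b \<notin> S" "shift A (\<mu> b) b \<in> span S"
      using C \<open>b \<in> C\<close> unfolding triangular_def by blast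
    have "representation C (shift A (\<mu> b) b) b = representation S (shift A (\<mu> b) b) b"
      by (subst representation_extend[OF ind S(3,1)]) simp
    also have "\<dots> = 0" using S(2) representation_ne_zero by blast
    finally have "representation C (A b - scale (\<mu> b) b) b = 0" by (simp add: shift_def)
    then show ?thesis
      using that by (simp add: representation_diff[OF ind] representation_scale[OF ind] C(2)
          representation_basis[OF ind])
  qed
  then show ?thesis
    by (simp add: trace_def rep complex_norm_square mult.commute del: of_real_power)
qed

end

section \<open>The Killing form of a simple Lie algebra\<close>

lemma (in lie_algebra) bracket_bracket:
  "bracket (bracket x y) z = bracket x (bracket y z) - bracket y (bracket x z)"
proof -
  have "bracket z (bracket x y) = - bracket (bracket x y) z" by (rule bracket_antisym)
  moreover have "bracket y (bracket z x) = - bracket y (bracket x z)"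
    by (simp add: bracket_antisym[of z x] bracket_minus_right)
  ultimately show ?thesis using jacobi[of x y z] by (simp add: algebra_simps)
qed

locale complex_lie_algebra = lie_algebra scale bracket + complex_vector_space scale Basis
  for scale :: "complex \<Rightarrow> 'a::ab_group_add \<Rightarrow> 'a" and bracket and Basis
begin

definition killing :: "'a \<Rightarrow> 'a \<Rightarrow> complex"
  where "killing x y = trace Basis (\<lambda>z. bracket x (bracket y z))"

lemmas Basis = independent_Basis span_Basis

lemma linear_ad_ad: "Vector_Spaces.linear scale scale (\<lambda>z. bracket x (bracket y z))"
  by (rule linearI) (simp_all add: bracket_add_right bracket_scale_right)

lemma killing_add_left: "killing (x + y) z = killing x z + killing y z"
  by (simp add: killing_def bracket_add_left trace_add[OF Basis])

lemma killing_scale_left: "killing (scale c x) z = c * killing x z"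
  by (simp add: killing_def bracket_scale_left trace_scale[OF Basis])

lemma killing_commute: "killing x y = killing y x"
  unfolding killing_def by (rule trace_commute[OF Basis linear_bracket linear_bracket])

lemma killing_add_right: "killing z (x + y) = killing z x + killing z y"
  by (simp add: killing_commute[of z] killing_add_left)

lemma killing_zero [simp]: "killing 0 x = 0" "killing x 0 = 0"
  using killing_scale_left[of 0 0 x] by (simp_all add: killing_commute[of x])

lemma killing_scale_right: "killing z (scale c x) = c * killing z x"
  by (simp add: killing_commute[of z] killing_scale_left)

lemma killing_sum_left: "killing (sum f I) z = (\<Sum>i\<in>I. killing (f i) z)"
  by (rule additive_sum[of "\<lambda>x. killing x z"]) (rule killing_add_left)

lemma killing_minus_left: "killing (- x) z = - killing x z"
  using killing_scale_left[of "-1" x z] by simp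

lemma killing_minus_right: "killing z (- x) = - killing z x"
  using killing_scale_right[of z "-1" x] by simp

lemma killing_diff_left: "killing (x - y) z = killing x z - killing y z"
  using killing_add_left[of x "- y" z] by (simp add: killing_minus_left)

lemma killing_invariant: "killing (bracket x y) z = killing x (bracket y z)"
proof -
  have "trace Basis (\<lambda>v. bracket y (bracket x (bracket z v))) = trace Basis (\<lambda>v. bracket x (bracket z (bracket y v)))"
    by (rule trace_commute[OF Basis linear_bracket linear_ad_ad])
  then show ?thesis
    by (simp add: killing_def bracket_bracket bracket_diff_right trace_diff[OF Basis])
qed

text \<open>The Leibniz rule gives \<open>(ad x - \<mu> - \<nu>) [y, z] = [(ad x - \<mu>) y, z] +
  [y, (ad x - \<nu>) z]\<close>; induction on the sum of the two nilpotency orders finishes.\<close>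

lemma gen_eigenspace_bracket:
  assumes y: "y \<in> gen_eigenspace (bracket x) \<mu>" and z: "z \<in> gen_eigenspace (bracket x) \<nu>"
  shows "bracket y z \<in> gen_eigenspace (bracket x) (\<mu> + \<nu>)"
proof -
  let ?A = "bracket x"
  obtain m where m: "(shift ?A \<mu> ^^ m) y = 0" using y unfolding gen_eigenspace_def by blast
  obtain n where n: "(shift ?A \<nu> ^^ n) z = 0" using z unfolding gen_eigenspace_def by blast
  have "bracket y z \<in> gen_eigenspace ?A (\<mu> + \<nu>)"
    if "(shift ?A \<mu> ^^ m) y = 0" "(shift ?A \<nu> ^^ n) z = 0" "m + n = k" for k m n y z
    using that
  proof (induction k arbitrary: m n y z)
    case 0
    then show ?case using subspace_0[OF subspace_gen_eigenspace[OF linear_bracket]] by simp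
  next
    case (Suc k)
    note sub = subspace_gen_eigenspace[OF linear_bracket]
    show ?case
    proof (cases "m = 0 \<or> n = 0")
      case True
      then show ?thesis using Suc.prems subspace_0[OF sub] by auto
    next
      case False
      then obtain m' n' where mn: "m = Suc m'" "n = Suc n'" by (auto simp: gr0_conv_Suc)
      have "bracket (shift ?A \<mu> y) z \<in> gen_eigenspace ?A (\<mu> + \<nu>)"
        using Suc.prems mn by (intro Suc.IH[of m' _ n]) (simp_all add: funpow_swap1)
      moreover have "bracket y (shift ?A \<nu> z) \<in> gen_eigenspace ?A (\<mu> + \<nu>)"
        using Suc.prems mn by (intro Suc.IH[of m _ n']) (simp_all add: funpow_swap1)
      moreover have "shift ?A (\<mu> + \<nu>) (bracket y z) = bracket (shift ?A \<mu> y) z + bracket y (shift ?A \<nu> z)"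
      proof -
        have "bracket (u - v) w = bracket u w - bracket v w" for u v w
          using bracket_add_left[of "u - v" v w] by simp
        then show ?thesis
          by (simp add: shift_def bracket_diff_right bracket_bracket bracket_scale_left
              bracket_scale_right scale_left_distrib)
      qed
      ultimately have "shift ?A (\<mu> + \<nu>) (bracket y z) \<in> gen_eigenspace ?A (\<mu> + \<nu>)"
        using subspace_add[OF sub] by simp
      then show ?thesis by (simp add: gen_eigenspace_shift_iff[OF linear_bracket])
    qed
  qed
  then show ?thesis using m n by blast
qed

text \<open>Since complex conjugation is additive, replacing every eigenvalue of \<open>ad x\<close> by its
  conjugate yields a derivation.\<close>

lemma conj_part_derivation:
  assumes C: "triangular (bracket x) C \<mu>" "span C = UNIV"
  shows "conj_part C \<mu> (bracket y z) = bracket (conj_part C \<mu> y) z + bracket y (conj_part C \<mu> z)"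
proof -
  have ind: "independent C" using C by (simp add: triangular_def)
  let ?s = "conj_part C \<mu>"
  note s = linear_add'[OF linear_conj_part[OF ind C(2)]] linear_scale'[OF linear_conj_part[OF ind C(2)]]
    linear_0'[OF linear_conj_part[OF ind C(2)]]
  have b: "?s (bracket b c) = bracket (?s b) c + bracket b (?s c)" if "b \<in> C" "c \<in> C" for b c
  proof -
    have g: "b \<in> gen_eigenspace (bracket x) (\<mu> b)" "c \<in> gen_eigenspace (bracket x) (\<mu> c)"
      using C that by (simp_all add: triangular_def)
    show ?thesis
      unfolding conj_part_gen_eigenspace[OF linear_bracket C gen_eigenspace_bracket[OF g]]
        conj_part_gen_eigenspace[OF linear_bracket C g(1)] conj_part_gen_eigenspace[OF linear_bracket C g(2)]
      by (simp add: bracket_scale_left bracket_scale_right scale_left_distrib)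
  qed
  have y: "?s (bracket y c) = bracket (?s y) c + bracket y (?s c)" if "c \<in> C" for y c
  proof -
    have "y \<in> span C" using C(2) by simp
    then show ?thesis
      by (induction rule: span_induct_alt)
        (simp_all add: s b that bracket_add_left bracket_scale_left scale_right_distrib algebra_simps)
  qed
  have "z \<in> span C" using C(2) by simp
  then show ?thesis
    by (induction rule: span_induct_alt)
      (simp_all add: s y bracket_add_right bracket_scale_right scale_right_distrib algebra_simps)
qed

text \<open>Perfectness writes \<open>x\<close> as a combination of brackets, on which the trace
  against the conjugated part of \<open>ad x\<close> reduces to values of the Killing form.\<close>

lemma ad_nilpotent:
  assumes k: "\<And>x y. killing x y = 0" and perfect: "span {bracket y z | y z. True} = UNIV"
  shows "\<exists>n. (bracket x ^^ n) v = 0"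
proof -
  obtain C \<mu> where C: "triangular (bracket x) C \<mu>" "span C = UNIV"
    using triangular_basis[OF linear_bracket] by blast
  then have ind: "independent C" by (simp add: triangular_def)
  let ?s = "conj_part C \<mu>"
  note s = linear_conj_part[OF ind C(2), of \<mu>]
  have sb: "Vector_Spaces.linear scale scale (\<lambda>v. ?s (bracket z v))" for z
    by (rule linearI) (simp_all add: bracket_add_right bracket_scale_right linear_add'[OF s] linear_scale'[OF s])
  \<comment> \<open>The derivation rule splits s ad y as ad (s y) + (ad y) s. Cyclicity of the trace
    cancels the last piece against the other half of the commutator, leaving
    \<open>killing (?s y) z\<close>.\<close>
  have t: "trace C (\<lambda>v. ?s (bracket (bracket y z) v)) = 0" for y z
  proof -
    have "trace C (\<lambda>v. ?s (bracket (bracket y z) v)) =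
      trace C (\<lambda>v. bracket (?s y) (bracket z v)) + trace C (\<lambda>v. bracket y (?s (bracket z v)))
      - trace C (\<lambda>v. ?s (bracket z (bracket y v)))"
      unfolding bracket_bracket linear_diff'[OF s] trace_diff[OF ind C(2)]
      unfolding conj_part_derivation[OF C, of y] trace_add[OF ind C(2)] ..
    also have "trace C (\<lambda>v. bracket y (?s (bracket z v))) = trace C (\<lambda>v. ?s (bracket z (bracket y v)))"
      by (rule trace_commute[OF ind C(2) linear_bracket sb])
    also have "trace C (\<lambda>v. bracket (?s y) (bracket z v)) = killing (?s y) z"
      unfolding killing_def by (rule trace_basis[OF ind C(2) Basis linear_ad_ad])
    finally show ?thesis by (simp add: k)
  qed
  have "w \<in> span {bracket y z | y z. True} \<Longrightarrow> trace C (\<lambda>v. ?s (bracket w v)) = 0" for w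
  proof (induction rule: span_induct_alt)
    case base
    show ?case by (simp add: linear_0'[OF s] trace_def representation_zero)
  next
    case (step c w u)
    then have "trace C (\<lambda>v. ?s (bracket w v)) = 0" using t by auto
    then show ?case
      using step.IH by (simp add: bracket_add_left bracket_scale_left linear_add'[OF s] linear_scale'[OF s]
          trace_add[OF ind C(2)] trace_scale[OF ind C(2)])
  qed
  then have "trace C (\<lambda>v. ?s (bracket x v)) = 0" using perfect by blast
  then have "(\<Sum>b\<in>C. (cmod (\<mu> b))\<^sup>2) = 0"
    unfolding trace_conj_part[OF linear_bracket C] by (simp only: of_real_eq_0_iff)
  then have "\<mu> b = 0" if "b \<in> C" for b
    using that by (simp add: sum_nonneg_eq_0_iff finiteI_independent[OF ind])
  then have "C \<subseteq> gen_eigenspace (bracket x) 0" using C(1) by (auto simp: triangular_def)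
  then have "span C \<subseteq> gen_eigenspace (bracket x) 0"
    by (intro span_minimal subspace_gen_eigenspace linear_bracket)
  then have "v \<in> gen_eigenspace (bracket x) 0" using C(2) by auto
  moreover have "shift (bracket x) 0 = bracket x" by (simp add: fun_eq_iff shift_def)
  ultimately show ?thesis by (simp add: gen_eigenspace_def)
qed

text \<open>Stating the result relative to \<open>W \<subset> U\<close> replaces quotient modules.
  In the induction on \<open>dim S\<close> the hypothesis is used twice for a maximal proper
  subalgebra \<open>T\<close>: acting on \<open>S\<close> modulo \<open>T\<close>, and on
  \<open>U\<close> modulo \<open>W\<close>.\<close>

lemma engel:
  assumes nil: "\<And>x v. \<exists>n. (bracket x ^^ n) v = 0"
    and "subspace S" "\<And>x y. x \<in> S \<Longrightarrow> y \<in> S \<Longrightarrow> bracket x y \<in> S"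
    and "subspace W" "\<And>x w. x \<in> S \<Longrightarrow> w \<in> W \<Longrightarrow> bracket x w \<in> W"
    and "\<And>x u. x \<in> S \<Longrightarrow> u \<in> U \<Longrightarrow> bracket x u \<in> U" and "W \<subset> U"
  shows "\<exists>u\<in>U - W. \<forall>x\<in>S. bracket x u \<in> W"
  using assms(2-)
proof (induction "dim S" arbitrary: S W U rule: less_induct)
  case (less S W U)
  note S = less.prems(1,2) and W = less.prems(3,4) and U = less.prems(5,6)
  show ?case
  proof (cases "S = {0}")
    case True
    then show ?thesis using U subspace_0[OF W(1)] by auto
  next
    case False
    define P where "P T \<longleftrightarrow> subspace T \<and> (\<forall>x\<in>T. \<forall>y\<in>T. bracket x y \<in> T) \<and> T \<subset> S" for T
    have "P {0}" using False subspace_0[OF S(1)] by (auto simp: P_def)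
    moreover have "dim T < dim S" if "P T" for T using that S(1) by (auto simp: P_def intro: span_proper_dim)
    ultimately obtain T where T: "P T" "\<And>T'. P T' \<Longrightarrow> dim T' \<le> dim T"
      using ex_has_greatest_nat[of P "{0}" dim "dim S"] by blast
    have sT: "subspace T" and bT: "\<And>x y. x \<in> T \<Longrightarrow> y \<in> T \<Longrightarrow> bracket x y \<in> T" and TS: "T \<subset> S"
      using T(1) by (auto simp: P_def)
    have dT: "dim T < dim S" using sT S(1) TS by (rule span_proper_dim)
    \<comment> \<open>An element outside \<open>T\<close> that normalizes \<open>T\<close>;
      adjoining it gives a subalgebra, which by maximality of \<open>dim T\<close> is all of
      \<open>S\<close>.\<close>
    have "\<exists>y\<in>S - T. \<forall>x\<in>T. bracket x y \<in> T"
      using TS S(2) by (intro less.hyps[OF dT sT bT sT bT _ TS]) auto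
    then obtain y where y: "y \<in> S" "y \<notin> T" "\<And>x. x \<in> T \<Longrightarrow> bracket x y \<in> T" by auto
    let ?T' = "span (insert y T)"
    have sp: "span T = T" using sT by simp
    have dec: "\<exists>k. x - scale k y \<in> T" if "x \<in> ?T'" for x
      using that by (simp add: span_breakdown_eq sp)
    have TT': "T \<subseteq> ?T'" "y \<in> ?T'" using span_base[of _ "insert y T"] by auto
    have T'S: "?T' \<subseteq> S" using y(1) TS S(1) by (intro span_minimal) auto
    have "?T' = S"
    proof (rule ccontr)
      assume "?T' \<noteq> S"
      have "bracket x z \<in> ?T'" if xz: "x \<in> ?T'" "z \<in> ?T'" for x z
      proof -
        obtain k l where k: "x - scale k y \<in> T" and l: "z - scale l y \<in> T" using dec[OF xz(1)] dec[OF xz(2)] by blast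
        define a where "a = x - scale k y"
        define c where "c = z - scale l y"
        have "bracket x z = bracket a c + scale l (bracket a y) - scale k (bracket c y)"
        proof -
          have "x = a + scale k y" "z = c + scale l y" by (simp_all add: a_def c_def)
          then show ?thesis using bracket_antisym[of y c]
            by (simp add: bracket_add_left bracket_add_right bracket_scale_left bracket_scale_right bracket_self)
        qed
        also have "\<dots> \<in> T"
          using k l y(3) bT unfolding a_def[symmetric] c_def[symmetric]
          by (intro subspace_diff[OF sT] subspace_add[OF sT] subspace_scale[OF sT]) auto
        finally show ?thesis using TT' by blast
      qed
      then have "P ?T'" using T'S \<open>?T' \<noteq> S\<close> by (auto simp: P_def)
      moreover have "dim T < dim ?T'" using TT' y(2) by (intro span_proper_dim sT subspace_span) auto
      ultimately show False using T(2)[of ?T'] by simp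
    qed
    then have decS: "\<exists>k. x - scale k y \<in> T" if "x \<in> S" for x using dec that by simp
    have "\<exists>u\<in>U - W. \<forall>x\<in>T. bracket x u \<in> W"
      using TS W U by (intro less.hyps[OF dT sT bT]) auto
    then obtain u where u: "u \<in> U" "u \<notin> W" "\<And>x. x \<in> T \<Longrightarrow> bracket x u \<in> W" by auto
    \<comment> \<open>The vectors annihilated by \<open>T\<close> modulo \<open>W\<close> are stable
      under \<open>bracket y\<close> because \<open>y\<close> normalizes \<open>T\<close>.\<close>
    have Z: "(bracket y ^^ n) u \<in> U \<and> (\<forall>x\<in>T. bracket x ((bracket y ^^ n) u) \<in> W)" for n
    proof (induction n)
      case (Suc n)
      let ?v = "(bracket y ^^ n) u"
      have "bracket x (bracket y ?v) \<in> W" if "x \<in> T" for x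
      proof -
        have "bracket x (bracket y ?v) = bracket (bracket x y) ?v + bracket y (bracket x ?v)"
          by (simp add: bracket_bracket)
        then show ?thesis using Suc that y W by (auto intro: subspace_add)
      qed
      then show ?case using Suc U(1) y(1) by simp
    qed (use u in auto)
    \<comment> \<open>Nilpotency of \<open>bracket y\<close> brings the iterates into
      \<open>W\<close>; the last one outside \<open>W\<close> is annihilated modulo \<open>W\<close>
      by \<open>y\<close> as well as by \<open>T\<close>.\<close>
    define n where "n = (LEAST n. (bracket y ^^ n) u \<in> W)"
    have "\<exists>n. (bracket y ^^ n) u \<in> W" using nil[of y u] subspace_0[OF W(1)] by metis
    then have n: "(bracket y ^^ n) u \<in> W" unfolding n_def by (rule LeastI_ex)
    then obtain m where m: "n = Suc m" using u(2) by (cases n) auto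
    define v where "v = (bracket y ^^ m) u"
    have "v \<notin> W" 
      using not_less_Least[of m "\<lambda>n. (bracket y ^^ n) u \<in> W"] m by (simp add: v_def n_def)
    moreover have yv: "bracket y v \<in> W" using n by (simp add: m v_def)
    moreover have "bracket x v \<in> W" if x: "x \<in> S" for x
    proof -
      obtain k where k: "x - scale k y \<in> T" using decS[OF x] by blast
      have "bracket x v = bracket (x - scale k y) v + scale k (bracket y v)"
        by (simp add: bracket_add_left[symmetric] bracket_scale_left[symmetric])
      then show ?thesis using Z[of m] k yv W(1) by (auto simp: v_def intro: subspace_add subspace_scale)
    qed
    ultimately show ?thesis using Z[of m] by (auto simp: v_def)
  qed
qed

end

locale simple_complex_lie_algebra =
  complex_lie_algebra scale bracket Basis + simple_lie_algebra scale bracket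
  for scale :: "complex \<Rightarrow> 'a::ab_group_add \<Rightarrow> 'a" and bracket and Basis
begin

lemma perfect: "span {bracket y z | y z. True} = UNIV"
proof -
  have "bracket x y \<in> span {bracket y z | y z. True}" for x y
    by (rule span_base) blast
  then have "lie_ideal scale bracket (span {bracket y z | y z. True})"
    by (simp add: lie_ideal_def)
  moreover have "span {bracket y z | y z. True} \<noteq> {0}"
  proof
    assume "span {bracket y z | y z. True} = {0}"
    then have "bracket y z = 0" for y z using span_base[of "bracket y z" "{bracket y z | y z. True}"] by auto
    then show False using not_abelian by blast
  qed
  ultimately show ?thesis using ideal_trivial by blast
qed

theorem killing_nondegenerate:
  assumes "\<And>y. killing x y = 0"
  shows "x = 0"
proof -
  define R where "R = {x. \<forall>y. killing x y = 0}"
  have "lie_ideal scale bracket R"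
    unfolding lie_ideal_def
  proof (intro conjI allI ballI)
    show "subspace R"
      by (rule subspaceI)
        (auto simp: R_def killing_add_left killing_scale_left)
    show "bracket y z \<in> R" if "z \<in> R" for y z
      using that by (auto simp: R_def bracket_antisym[of y] killing_minus_left killing_invariant)
  qed
  moreover have "R \<noteq> UNIV"
  proof
    assume "R = UNIV"
    then have "killing z w = 0" for z w by (auto simp: R_def)
    then have nil: "\<exists>n. (bracket z ^^ n) v = 0" for z v using ad_nilpotent[OF _ perfect] by blast
    obtain a b where ab: "bracket a b \<noteq> 0" using not_abelian by blast
    then have "{0} \<noteq> (UNIV :: 'a set)" by auto
    then have "\<exists>u\<in>UNIV - {0}. \<forall>x\<in>UNIV. bracket x u \<in> {0}"
      by (intro engel[OF nil]) auto
    then obtain u where u: "u \<noteq> 0" "\<And>x. bracket x u = 0" by auto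
    define Z where "Z = {u. \<forall>x. bracket x u = 0}"
    have "lie_ideal scale bracket Z"
      unfolding lie_ideal_def
      by (auto simp: Z_def bracket_add_right bracket_scale_right intro!: subspaceI)
    moreover have "Z \<noteq> {0}" using u by (auto simp: Z_def)
    ultimately have "Z = UNIV" using ideal_trivial by blast
    then show False using ab by (auto simp: Z_def)
  qed
  ultimately have "R = {0}" using ideal_trivial by blast
  then show ?thesis using assms by (auto simp: R_def)
qed

text \<open>\<open>\<Phi>\<close> lists the Killing products with the basis as coordinates.
  Nondegeneracy makes it injective, hence surjective, and \<open>star b\<close> is a preimage of
  \<open>b\<close>.\<close>

lemma dual_basis:
  "\<exists>star. \<forall>b\<in>Basis. \<forall>c\<in>Basis. killing (star b) c = (if b = c then 1 else 0)"
proof -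
  define \<Phi> where "\<Phi> x = (\<Sum>b\<in>Basis. scale (killing x b) b)" for x
  have lin: "Vector_Spaces.linear scale scale \<Phi>"
    by (rule linearI) (simp_all add: \<Phi>_def killing_add_left killing_scale_left scale_left_distrib
        sum.distrib scale_sum_right)
  have rep: "representation Basis (\<Phi> x) c = killing x c" if "c \<in> Basis" for x c
  proof -
    have "representation Basis (\<Phi> x) c = (\<Sum>b\<in>Basis. killing x b * representation Basis b c)"
      unfolding \<Phi>_def by (rule representation_sum_scale[OF Basis])
    also have "\<dots> = (\<Sum>b\<in>Basis. if b = c then killing x c else 0)"
      by (intro sum.cong) (auto simp: representation_basis[OF independent_Basis])
    finally show ?thesis using that by (simp add: finite_Basis)
  qed
  have "x = y" if "\<Phi> x = \<Phi> y" for x y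
  proof -
    have "killing (x - y) z = 0" for z
    proof -
      have "z \<in> span Basis" by (simp add: span_Basis)
      then show ?thesis
      proof (induction rule: span_induct_alt)
        case base
        show ?case by simp
      next
        case (step c z w)
        then show ?case using rep[of z x] rep[of z y] that
          by (simp add: killing_add_right killing_scale_right killing_diff_left)
      qed
    qed
    then show ?thesis using killing_nondegenerate[of "x - y"] by simp
  qed
  then have "surj \<Phi>" using linear_inj_imp_surj[OF lin] by (simp add: inj_def)
  then obtain star where \<Phi>: "\<And>b. \<Phi> (star b) = b" by (metis surjD)
  then have "killing (star b) c = (if b = c then 1 else 0)" if "b \<in> Basis" "c \<in> Basis" for b c
    using that rep[of c "star b"] by (auto simp: \<Phi> representation_basis[OF independent_Basis] split: if_splits)
  then show ?thesis by blast
qed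

lemma killing_cancel:
  assumes "\<And>b. b \<in> Basis \<Longrightarrow> killing x b = killing y b"
  shows "x = y"
proof -
  have "killing (x - y) z = 0" for z
  proof -
    have "z \<in> span Basis" by (simp add: span_Basis)
    then show ?thesis
      by (induction rule: span_induct_alt)
        (use assms in
          \<open>auto simp: killing_add_right killing_scale_right killing_diff_left\<close>)
  qed
  then show ?thesis using killing_nondegenerate[of "x - y"] by simp
qed

text \<open>Invariance comes from expanding brackets in the basis and its dual. The normalisation is
  exactly 1 because the Killing form is the trace form of the adjoint representation: the trace
  defining \<open>killing x y\<close>, written in dual bases, is the Killing product of the Casimir
  operator at \<open>x\<close> with \<open>y\<close>.\<close>

theorem casimir_exists: "\<exists>star. casimir_lie_algebra scale bracket Basis star"
proof -
  obtain star where star: "\<And>b c. b \<in> Basis \<Longrightarrow> c \<in> Basis \<Longrightarrow> killing (star b) c = (if b = c then 1 else 0)"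
    using dual_basis by blast
  have e1: "y = (\<Sum>c\<in>Basis. scale (killing y c) (star c))" for y
  proof (rule killing_cancel)
    fix b assume "b \<in> Basis"
    then have "killing (\<Sum>c\<in>Basis. scale (killing y c) (star c)) b = (\<Sum>c\<in>Basis. if c = b then killing y b else 0)"
      unfolding killing_sum_left killing_scale_left by (intro sum.cong) (auto simp: star)
    then show "killing y b = killing (\<Sum>c\<in>Basis. scale (killing y c) (star c)) b"
      using \<open>b \<in> Basis\<close> by (simp add: finite_Basis)
  qed
  have rep: "representation Basis y b = killing y (star b)" if "b \<in> Basis" for y b
  proof -
    have "killing y (star b) = killing (\<Sum>c\<in>Basis. scale (representation Basis y c) c) (star b)"
      by (simp add: basis_expansion[OF Basis])
    also have "\<dots> = (\<Sum>c\<in>Basis. if c = b then representation Basis y b else 0)"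
      unfolding killing_sum_left killing_scale_left using that
      by (intro sum.cong) (auto simp: star killing_commute[of _ "star b"])
    finally show ?thesis using that by (simp add: finite_Basis)
  qed
  have e2: "y = (\<Sum>c\<in>Basis. scale (killing y (star c)) c)" for y
  proof -
    have "(\<Sum>c\<in>Basis. scale (killing y (star c)) c) = (\<Sum>c\<in>Basis. scale (representation Basis y c) c)"
      by (intro sum.cong) (auto simp: rep)
    then show ?thesis by (simp add: basis_expansion[OF Basis])
  qed
  show ?thesis
  proof (intro exI[of _ star], unfold_locales)
    fix \<gamma> :: "'a \<Rightarrow> 'a \<Rightarrow> complex" and x
    assume \<gamma>: "bilinear_form scale \<gamma>"
    have g: "\<gamma> (\<Sum>c\<in>Basis. scale (r c) (f c)) z = (\<Sum>c\<in>Basis. r c * \<gamma> (f c) z)"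
      "\<gamma> z (\<Sum>c\<in>Basis. scale (r c) (f c)) = (\<Sum>c\<in>Basis. r c * \<gamma> z (f c))" for r f z
    proof -
      have l: "\<gamma> (x + y) z = \<gamma> x z + \<gamma> y z" "\<gamma> (scale c x) y = c * \<gamma> x y"
        "\<gamma> x (y + z) = \<gamma> x y + \<gamma> x z" "\<gamma> x (scale c y) = c * \<gamma> x y" for x y z c
        using \<gamma> unfolding bilinear_form_def by blast+
      show "\<gamma> (\<Sum>c\<in>Basis. scale (r c) (f c)) z = (\<Sum>c\<in>Basis. r c * \<gamma> (f c) z)"
        "\<gamma> z (\<Sum>c\<in>Basis. scale (r c) (f c)) = (\<Sum>c\<in>Basis. r c * \<gamma> z (f c))"
        by (simp_all add: additive_sum[of "\<lambda>x. \<gamma> x z", OF l(1)] additive_sum[of "\<gamma> z", OF l(3)] l)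
    qed
    have "(\<Sum>b\<in>Basis. \<gamma> (bracket x b) (star b)) =
      (\<Sum>b\<in>Basis. \<Sum>c\<in>Basis. killing (bracket x b) (star c) * \<gamma> c (star b))"
      by (subst e2[of "bracket x _"]) (simp only: g)
    also have "\<dots> = (\<Sum>c\<in>Basis. \<Sum>b\<in>Basis. - (killing (bracket x (star c)) b * \<gamma> c (star b)))"
    proof (subst sum.swap, intro sum.cong refl)
      fix b c
      have "killing (bracket x b) (star c) = - killing (bracket x (star c)) b"
        by (simp add: killing_commute[of _ "star c"] killing_invariant[symmetric]
            bracket_antisym[of "star c" x] killing_minus_left)
      then show "killing (bracket x b) (star c) * \<gamma> c (star b) = - (killing (bracket x (star c)) b * \<gamma> c (star b))"
        by simp
    qed
    also have "\<dots> = - (\<Sum>c\<in>Basis. \<gamma> c (\<Sum>b\<in>Basis. scale (killing (bracket x (star c)) b) (star b)))"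
      by (simp only: g sum_negf)
    finally show "(\<Sum>b\<in>Basis. \<gamma> (bracket x b) (star b)) = - (\<Sum>b\<in>Basis. \<gamma> b (bracket x (star b)))"
      by (simp only: e1[symmetric])
  next
    fix x
    have "killing (\<Sum>b\<in>Basis. bracket b (bracket (star b) x)) y = killing x y" for y
    proof -
      have "killing x y = (\<Sum>b\<in>Basis. killing (bracket x (bracket y b)) (star b))"
        unfolding killing_def[of x y] trace_def by (intro sum.cong refl rep)
      also have "\<dots> = (\<Sum>b\<in>Basis. killing (bracket b (bracket (star b) x)) y)"
      proof (intro sum.cong refl)
        fix b
        have "killing (bracket x (bracket y b)) (star b) = - killing (bracket y b) (bracket x (star b))"
          using bracket_antisym[of x "bracket y b"] by (simp add: killing_minus_left killing_invariant)
        moreover have "killing (bracket b (bracket (star b) x)) y = - killing (bracket (star b) x) (bracket b y)"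
          using bracket_antisym[of b "bracket (star b) x"] by (simp add: killing_minus_left killing_invariant)
        ultimately show "killing (bracket x (bracket y b)) (star b) = killing (bracket b (bracket (star b) x)) y"
          using bracket_antisym[of y b] bracket_antisym[of x "star b"]
          by (simp add: killing_minus_left killing_minus_right killing_commute[of "bracket b y"])
      qed
      finally show ?thesis by (simp add: killing_sum_left)
    qed
    then show "(\<Sum>b\<in>Basis. bracket b (bracket (star b) x)) = x" by (intro killing_cancel)
  qed
qed

end

section \<open>Cohomology of current algebras\<close>

lemma coboundaries_0: "0 \<in> coboundaries scale bracket L n"
  by (cases n) (auto intro!: image_eqI[of _ _ 0])

lemma coboundaries_add:
  "\<omega> \<in> coboundaries scale bracket L n \<Longrightarrow> \<eta> \<in> coboundaries scale bracket L n \<Longrightarrow>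
    \<omega> + \<eta> \<in> coboundaries scale bracket L n"
  by (cases n) (auto simp: ce_differential_add[symmetric] intro!: imageI cochains_add)

lemma coboundaries_mult:
  assumes "\<omega> \<in> coboundaries scale bracket L n"
  shows "(\<lambda>xs. c * \<omega> xs) \<in> coboundaries scale bracket L n"
proof (cases n)
  case 0
  then show ?thesis using assms by (simp add: zero_fun_def)
next
  case (Suc m)
  then obtain \<eta> where "\<eta> \<in> cochains scale L m" "\<omega> = ce_differential bracket L \<eta>" using assms by auto
  then show ?thesis
    using Suc cochains_mult[of \<eta> scale L m c] by (auto simp: ce_differential_mult[symmetric])
qed

lemma coboundaries_uminus:
  "\<omega> \<in> coboundaries scale bracket L n \<Longrightarrow> - \<omega> \<in> coboundaries scale bracket L n"
  by (cases n) (auto simp: ce_differential_uminus[symmetric] intro!: imageI cochains_uminus)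

lemma coboundaries_diff:
  "\<omega> \<in> coboundaries scale bracket L n \<Longrightarrow> \<eta> \<in> coboundaries scale bracket L n \<Longrightarrow>
    \<omega> - \<eta> \<in> coboundaries scale bracket L n"
  using coboundaries_add[of \<omega> scale bracket L n "- \<eta>"] coboundaries_uminus[of \<eta> scale bracket L n] by simp

lemma coset_eq_iff:
  "\<omega> +o coboundaries scale bracket L n = \<eta> +o coboundaries scale bracket L n \<longleftrightarrow>
    \<omega> - \<eta> \<in> coboundaries scale bracket L n"
proof
  assume "\<omega> +o coboundaries scale bracket L n = \<eta> +o coboundaries scale bracket L n"
  then have "\<omega> \<in> \<eta> +o coboundaries scale bracket L n"
    using coboundaries_0[of scale bracket L n] by (auto simp: elt_set_plus_def)
  then show "\<omega> - \<eta> \<in> coboundaries scale bracket L n" by (auto simp: elt_set_plus_def)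
next
  assume d: "\<omega> - \<eta> \<in> coboundaries scale bracket L n"
  show "\<omega> +o coboundaries scale bracket L n = \<eta> +o coboundaries scale bracket L n"
  proof (intro set_eqI iffI)
    fix x assume "x \<in> \<omega> +o coboundaries scale bracket L n"
    then obtain b where "b \<in> coboundaries scale bracket L n" "x = \<omega> + b" by (auto simp: elt_set_plus_def)
    then show "x \<in> \<eta> +o coboundaries scale bracket L n"
      using coboundaries_add[OF d, of b] by (auto simp: elt_set_plus_def intro!: bexI[of _ "\<omega> - \<eta> + b"])
  next
    fix x assume "x \<in> \<eta> +o coboundaries scale bracket L n"
    then obtain b where "b \<in> coboundaries scale bracket L n" "x = \<eta> + b" by (auto simp: elt_set_plus_def)
    then show "x \<in> \<omega> +o coboundaries scale bracket L n"
      using coboundaries_diff[OF _ d, of b] by (auto simp: elt_set_plus_def intro!: bexI[of _ "b - (\<omega> - \<eta>)"])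
  qed
qed

lemma zero_coset: "0 +o (B :: 'a::monoid_add set) = B"
  by (auto simp: elt_set_plus_def)

lemma coset_eq_coboundaries_iff:
  "\<omega> +o coboundaries scale bracket L n = coboundaries scale bracket L n \<longleftrightarrow>
    \<omega> \<in> coboundaries scale bracket L n"
  using coset_eq_iff[of \<omega> scale bracket L n 0] by (simp add: zero_coset)

lemma on_classes_coset:
  fixes f :: "('a::ab_group_add list \<Rightarrow> 'k::field) \<Rightarrow> 'b::ab_group_add list \<Rightarrow> 'k"
  assumes add: "\<And>\<omega> \<eta>. f (\<omega> + \<eta>) = f \<omega> + f \<eta>"
    and B: "\<And>\<omega>. \<omega> \<in> coboundaries scale' bracket' L' n \<Longrightarrow> f \<omega> \<in> coboundaries scale bracket L m"
  shows "on_classes (coboundaries scale bracket L m) f (\<omega> +o coboundaries scale' bracket' L' n) =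
    f \<omega> +o coboundaries scale bracket L m"
proof (intro set_eqI iffI)
  fix x assume "x \<in> on_classes (coboundaries scale bracket L m) f (\<omega> +o coboundaries scale' bracket' L' n)"
  then obtain b c where bc: "b \<in> coboundaries scale' bracket' L' n" "c \<in> coboundaries scale bracket L m"
    "x = f (\<omega> + b) + c"
    by (auto simp: on_classes_def elt_set_plus_def set_plus_def)
  then have "x = f \<omega> + (f b + c)" by (simp add: add add.assoc)
  then show "x \<in> f \<omega> +o coboundaries scale bracket L m"
    using coboundaries_add[OF B[OF bc(1)] bc(2)] by (auto simp: elt_set_plus_def)
next
  fix x assume "x \<in> f \<omega> +o coboundaries scale bracket L m"
  then obtain c where "c \<in> coboundaries scale bracket L m" "x = f (\<omega> + 0) + c"
    by (auto simp: elt_set_plus_def)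
  then show "x \<in> on_classes (coboundaries scale bracket L m) f (\<omega> +o coboundaries scale' bracket' L' n)"
    using coboundaries_0[of scale' bracket' L' n]
    unfolding on_classes_def elt_set_plus_def set_plus_def by blast
qed

lemma class_scale_coset:
  "class_scale (coboundaries scale bracket L n) c (\<omega> +o coboundaries scale bracket L n) =
    (\<lambda>xs. c * \<omega> xs) +o coboundaries scale bracket L n"
  unfolding class_scale_def
  by (rule on_classes_coset) (auto simp: fun_eq_iff algebra_simps intro: coboundaries_mult)

lemma coset_plus_coset:
  "(\<omega> +o coboundaries scale bracket L n) + (\<eta> +o coboundaries scale bracket L n) =
    (\<omega> + \<eta>) +o coboundaries scale bracket L n"
proof -
  have "coboundaries scale bracket L n + coboundaries scale bracket L n = coboundaries scale bracket L n"
    using coboundaries_add[of _ scale bracket L n] coboundaries_0[of scale bracket L n]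
    by (force simp: set_plus_def)
  then show ?thesis by (simp add: set_plus_rearrange)
qed

section \<open>Pullback along Lie algebra homomorphisms\<close>

lemma pullback_cochains:
  assumes \<omega>: "\<omega> \<in> cochains scale' L n"
    and \<phi>: "\<And>x y. \<phi> (x + y) = \<phi> x + \<phi> y" "\<And>c x. \<phi> (scale c x) = scale' c (\<phi> x)" "\<And>x. \<phi> x \<in> L"
  shows "pullback UNIV \<phi> \<omega> \<in> cochains scale UNIV n"
proof -
  have "set (map \<phi> xs) \<subseteq> L" for xs using \<phi>(3) by auto
  then show ?thesis
    using \<omega> \<phi> unfolding cochains_def pullback_def by (auto simp: map_update)
qed

lemma pullback_UNIV: "pullback UNIV \<phi> \<omega> xs = \<omega> (map \<phi> xs)"
  by (simp add: pullback_def)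

lemma pullback_add: "pullback L \<phi> (\<omega> + \<eta>) = pullback L \<phi> \<omega> + (pullback L \<phi> \<eta> :: _ \<Rightarrow> 'k::field)"
  by (simp add: pullback_def fun_eq_iff)

lemma pullback_zero: "pullback L \<phi> 0 = 0"
  by (simp add: pullback_def fun_eq_iff)

lemma pullback_ce_differential:
  assumes "\<And>x y. \<phi> (bracket x y) = bracket' (\<phi> x) (\<phi> y)"
  shows "pullback UNIV \<phi> (ce_differential bracket' UNIV \<omega>) = ce_differential bracket UNIV (pullback UNIV \<phi> \<omega>)"
  by (simp add: fun_eq_iff pullback_UNIV ce_differential_def assms nths_map)

lemma pullback_coboundaries:
  assumes "\<omega> \<in> coboundaries scale' bracket' UNIV n"
    and \<phi>: "\<And>x y. \<phi> (x + y) = \<phi> x + \<phi> y" "\<And>c x. \<phi> (scale c x) = scale' c (\<phi> x)"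
    "\<And>x y. \<phi> (bracket x y) = bracket' (\<phi> x) (\<phi> y)"
  shows "pullback UNIV \<phi> \<omega> \<in> coboundaries scale bracket UNIV n"
proof (cases n)
  case 0
  then show ?thesis using assms(1) by (simp add: fun_eq_iff pullback_UNIV)
next
  case (Suc m)
  then obtain \<eta> where "\<eta> \<in> cochains scale' UNIV m" "\<omega> = ce_differential bracket' UNIV \<eta>"
    using assms(1) by auto
  then show ?thesis
    using Suc pullback_cochains[of \<eta> scale' UNIV m \<phi> scale] \<phi>
    by (auto simp: pullback_ce_differential[of \<phi> bracket bracket'])
qed

lemma pullback_cocycles:
  assumes "\<omega> \<in> cocycles scale' bracket' UNIV n"
    and \<phi>: "\<And>x y. \<phi> (x + y) = \<phi> x + \<phi> y" "\<And>c x. \<phi> (scale c x) = scale' c (\<phi> x)"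
    "\<And>x y. \<phi> (bracket x y) = bracket' (\<phi> x) (\<phi> y)"
  shows "pullback UNIV \<phi> \<omega> \<in> cocycles scale bracket UNIV n"
  using assms(1) pullback_cochains[of \<omega> scale' UNIV n \<phi> scale] \<phi>
  by (auto simp: cocycles_def pullback_zero pullback_ce_differential[of \<phi> bracket bracket', symmetric])

text \<open>Lie derivatives commute with the differential. In the induction, the commutator of the
  slot sums for \<open>x\<close> and \<open>p\<close> supplies the slot sum for
  \<open>bracket x p\<close> that Cartan's formula asks for.\<close>

lemma (in lie_algebra) ce_differential_slot_sum_bracket:
  assumes "\<omega> \<in> cochains scale UNIV n"
  shows "dd (slot_sum (bracket x) \<omega>) xs = slot_sum (bracket x) (dd \<omega>) xs"
  using assms
proof (induction xs arbitrary: \<omega> n)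
  case (Cons p xs)
  note \<omega> = Cons.prems
  have "slot_sum (bracket x) (slot_sum (bracket p) \<omega>) xs - slot_sum (bracket p) (slot_sum (bracket x) \<omega>) xs =
    slot_sum (\<lambda>z. scale (- 1) (bracket (bracket x p) z)) \<omega> xs"
    unfolding slot_sum_commutator[OF \<omega>] by (simp add: bracket_bracket)
  then have "slot_sum (bracket x) (slot_sum (bracket p) \<omega>) xs - slot_sum (bracket p) (slot_sum (bracket x) \<omega>) xs =
    - slot_sum (bracket (bracket x p)) \<omega> xs"
    unfolding slot_sum_scale_op[OF \<omega>] by simp
  then show ?case
    using Cons.IH[OF ins_cochains[OF \<omega>, of p]]
    by (simp add: ce_differential_Cons[OF slot_sum_cochains[OF \<omega> linear_bracket]] slot_sum_Cons
        ce_differential_Cons[OF \<omega>] ins_slot_sum ins_ce_differential[OF \<omega>] ce_differential_add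
        slot_sum_diff slot_sum_uminus) (simp add: algebra_simps)
qed simp

section \<open>Comparison with the constants, for (b)\<close>

context casimir_lie_algebra
begin

lemma current_homotopy_zero: "current_homotopy 0 = 0"
  by (simp add: fun_eq_iff current_homotopy_def cur.insertion_homotopy_def)

lemma radial_zero: "radial 0 xs = 0"
  using dilation_poly_eqI[of 0 0 xs] by (simp add: radial_def)

text \<open>Since \<open>0 ^ 0 = 1\<close> the constant coefficient survives: this dilation is
  evaluation at t = 0 followed by the inclusion of constants.\<close>

lemma dilate_0: "dilate 0 p = [:coeff p 0:]"
  by (rule poly_eqI) (simp add: coeff_pCons split: nat.split)

lemma current_bracket_const: "cbracket [:x:] p = map_poly (bracket x) p"
proof (induction p rule: current_poly_induct)
  case (monom y n)
  have "cbracket [:x:] (monom y n) = monom (bracket x y) n"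
    using current_bracket_monom[of x 0 y n] by (simp add: monom_0)
  then show ?case by (intro poly_eqI) (simp add: coeff_map_poly)
next
  case (add p q)
  then show ?case by (simp add: cur.bracket_add_right) (rule poly_eqI, simp add: coeff_map_poly bracket_add_right)
qed

lemma coeff_current_bracket_0: "coeff (cbracket p q) 0 = bracket (coeff p 0) (coeff q 0)"
proof -
  have "dilate 0 (cbracket p q) = cbracket (dilate 0 p) (dilate 0 q)" by (rule dilate_cbracket)
  then have "[:coeff (cbracket p q) 0:] = [:bracket (coeff p 0) (coeff q 0):]"
    using current_bracket_monom[of "coeff p 0" 0 "coeff q 0" 0] by (simp add: dilate_0 monom_0)
  then show ?thesis by simp
qed

abbreviation "res \<equiv> pullback UNIV (\<lambda>x. [:x:])"
abbreviation "ev \<equiv> pullback UNIV (\<lambda>p. coeff p 0)"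

lemma const_hom: "[:x + y:] = [:x:] + [:y:]" "[:scale c x:] = cscale c [:x:]"
  "[:bracket x y:] = cbracket [:x:] [:y:]"
  using current_bracket_monom[of x 0 y 0]
  by (auto simp: monom_0 intro!: poly_eqI simp: coeff_pCons split: nat.split)

lemma cocycle_retract:
  assumes "\<omega> \<in> cocycles cscale cbracket UNIV n"
  shows "\<omega> - ev (res \<omega>) \<in> coboundaries cscale cbracket UNIV n"
proof -
  have \<omega>: "\<omega> \<in> cochains cscale UNIV n" "cur.dd \<omega> = 0" using assms by (auto simp: cocycles_def)
  have "dilate 0 = (\<lambda>p. [:coeff p 0:])" by (rule ext) (rule dilate_0)
  then have er: "ev (res \<omega>) xs = \<omega> (map (dilate 0) xs)" for xs
    by (simp add: pullback_UNIV comp_def)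
  show ?thesis
  proof (cases n)
    case 0
    \<comment> \<open>In degree 0 only the empty list matters, and dilation fixes it; the difference
      has to be 0 exactly.\<close>
    have "\<omega> xs = \<omega> (map (dilate 0) xs)" for xs
      using \<omega>(1) 0 by (cases xs) (auto simp: cochains_0_iff)
    then show ?thesis using 0 by (simp add: fun_eq_iff er)
  next
    case (Suc m)
    have c: "- radial (current_homotopy \<omega>) \<in> cochains cscale UNIV m"
      using current_homotopy_cochains[OF \<omega>(1)] Suc by (intro cochains_uminus radial_cochains) simp
    have "cur.dd (- radial (current_homotopy \<omega>)) = \<omega> - ev (res \<omega>)"
      using radial_homotopy[OF \<omega>(1)]
      by (simp add: fun_eq_iff ce_differential_uminus er \<omega>(2) current_homotopy_zero radial_zero)
    then show ?thesis using c Suc by (metis coboundaries.simps(2) imageI)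
  qed
qed

text \<open>Evaluation at t = 0 induces the inverse: restricting after evaluating is the identity on
  forms, and \<open>cocycle_retract\<close> gives the other composite on classes.\<close>

theorem restriction_iso:
  "linear_iso (class_scale (coboundaries cscale cbracket UNIV n)) (cohomology cscale cbracket UNIV n)
    (class_scale (coboundaries scale bracket UNIV n)) (cohomology scale bracket UNIV n)
    (on_classes (coboundaries scale bracket UNIV n) res)"
proof -
  let ?B' = "coboundaries cscale cbracket UNIV n"
  let ?B = "coboundaries scale bracket UNIV n"
  have rB: "res \<omega> \<in> ?B" if "\<omega> \<in> ?B'" for \<omega>
    by (rule pullback_coboundaries[OF that]) (rule const_hom)+
  have eB: "ev \<omega> \<in> ?B'" if "\<omega> \<in> ?B" for \<omega>
    by (rule pullback_coboundaries[OF that]) (simp_all add: coeff_current_bracket_0)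
  have rZ: "res \<omega> \<in> cocycles scale bracket UNIV n" if "\<omega> \<in> cocycles cscale cbracket UNIV n" for \<omega>
    by (rule pullback_cocycles[OF that]) (rule const_hom)+
  have eZ: "ev \<omega> \<in> cocycles cscale cbracket UNIV n" if "\<omega> \<in> cocycles scale bracket UNIV n" for \<omega>
    by (rule pullback_cocycles[OF that]) (simp_all add: coeff_current_bracket_0)
  have re: "res (ev \<omega>) = \<omega>" for \<omega>
    by (simp add: fun_eq_iff pullback_UNIV comp_def)
  have f: "on_classes ?B res (\<omega> +o ?B') = res \<omega> +o ?B" for \<omega>
    by (rule on_classes_coset[OF pullback_add rB])
  have "inj_on (on_classes ?B res) (cohomology cscale cbracket UNIV n)"
  proof (rule inj_onI)
    fix X Y
    assume "X \<in> cohomology cscale cbracket UNIV n" "Y \<in> cohomology cscale cbracket UNIV n"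
      and eq: "on_classes ?B res X = on_classes ?B res Y"
    then obtain \<omega> \<eta> where \<omega>: "\<omega> \<in> cocycles cscale cbracket UNIV n" "X = \<omega> +o ?B'"
      and \<eta>: "\<eta> \<in> cocycles cscale cbracket UNIV n" "Y = \<eta> +o ?B'"
      by (auto simp: cohomology_def)
    have "res \<omega> - res \<eta> \<in> ?B" using eq unfolding \<omega> \<eta> f coset_eq_iff .
    then have "ev (res \<omega> - res \<eta>) \<in> ?B'" by (rule eB)
    then have "(\<omega> - ev (res \<omega>)) - (\<eta> - ev (res \<eta>)) + ev (res \<omega> - res \<eta>) \<in> ?B'"
      by (intro coboundaries_add coboundaries_diff cocycle_retract \<omega> \<eta>)
    moreover have "(\<omega> - ev (res \<omega>)) - (\<eta> - ev (res \<eta>)) + ev (res \<omega> - res \<eta>) = \<omega> - \<eta>"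
      by (simp add: fun_eq_iff pullback_UNIV)
    ultimately show "X = Y" by (simp add: \<omega> \<eta> coset_eq_iff)
  qed
  moreover have "on_classes ?B res ` cohomology cscale cbracket UNIV n = cohomology scale bracket UNIV n"
  proof (intro equalityI subsetI)
    fix Y assume "Y \<in> on_classes ?B res ` cohomology cscale cbracket UNIV n"
    then show "Y \<in> cohomology scale bracket UNIV n" using rZ by (auto simp: cohomology_def f)
  next
    fix Y assume "Y \<in> cohomology scale bracket UNIV n"
    then obtain \<omega> where "\<omega> \<in> cocycles scale bracket UNIV n" "Y = res (ev \<omega>) +o ?B"
      by (auto simp: cohomology_def re)
    then show "Y \<in> on_classes ?B res ` cohomology cscale cbracket UNIV n"
      using eZ by (auto simp: cohomology_def f[symmetric])
  qed
  moreover have "res (\<lambda>xs. c * \<omega> xs) = (\<lambda>xs. c * res \<omega> xs)" for c and \<omega> :: "'a poly list \<Rightarrow> 'k"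
    by (simp add: fun_eq_iff pullback_UNIV)
  ultimately show ?thesis
    by (auto simp: linear_iso_def bij_betw_def cohomology_def f coset_plus_coset class_scale_coset pullback_add)
qed

section \<open>Invariant classes of the positive currents, for (a)\<close>

abbreviation "P \<equiv> positive_currents :: 'a poly set"
abbreviation "dP \<equiv> ce_differential cbracket P"

lemma P_closed:
  "p \<in> P \<Longrightarrow> q \<in> P \<Longrightarrow> p + q \<in> P" "p \<in> P \<Longrightarrow> cscale c p \<in> P" "q \<in> P \<Longrightarrow> cbracket p q \<in> P"
  "p \<in> P \<Longrightarrow> dilate s p \<in> P"
  by (auto simp: positive_currents_def coeff_current_bracket_0)

definition pos_part :: "'a poly \<Rightarrow> 'a poly"
  where "pos_part p = p - [:coeff p 0:]"

lemma pos_part: "pos_part (p + q) = pos_part p + pos_part q" "pos_part (cscale c p) = cscale c (pos_part p)"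
  "pos_part p \<in> P" "p \<in> P \<Longrightarrow> pos_part p = p" "pos_part [:x:] = 0"
  by (auto simp: pos_part_def positive_currents_def poly_eq_iff coeff_pCons scale_right_diff_distrib split: nat.split)

text \<open>\<open>pos_part\<close> is linear but in general does not respect brackets with
  constants, so extension need not commute with the differential. The defect is measured in
  \<open>homotopy_extension\<close>.\<close>

definition extension :: "('a poly list \<Rightarrow> 'k) \<Rightarrow> 'a poly list \<Rightarrow> 'k"
  where "extension = pullback UNIV pos_part"

definition restr :: "('a poly list \<Rightarrow> 'k) \<Rightarrow> 'a poly list \<Rightarrow> 'k"
  where "restr \<omega> xs = (if set xs \<subseteq> P then \<omega> xs else 0)"

lemma extension_cochains: "\<omega> \<in> cochains cscale P n \<Longrightarrow> extension \<omega> \<in> cochains cscale UNIV n"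
  unfolding extension_def by (rule pullback_cochains) (rule pos_part | assumption)+

lemma extension_eq: "set xs \<subseteq> P \<Longrightarrow> extension \<omega> xs = \<omega> xs"
proof -
  assume "set xs \<subseteq> P"
  then have "map pos_part xs = xs" by (intro map_idI pos_part(4)) auto
  then show ?thesis by (simp add: extension_def pullback_UNIV)
qed

lemma extension_const: "\<omega> \<in> cochains cscale P n \<Longrightarrow> extension \<omega> ([:x:] # xs) = 0"
proof -
  assume "\<omega> \<in> cochains cscale P n"
  then have "extension \<omega> (0 # xs) = 0" by (rule cochains_Cons_zero[OF extension_cochains])
  moreover have "pos_part 0 = 0" using pos_part(5)[of 0] by simp
  ultimately show ?thesis by (simp add: extension_def pullback_UNIV pos_part(5))
qed

lemma set_update_P: "set xs \<subseteq> P \<Longrightarrow> x \<in> P \<Longrightarrow> set (xs[i := x]) \<subseteq> P"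
  using set_update_subset_insert[of xs i x] by blast

lemma restr_cochains:
  assumes \<omega>: "\<omega> \<in> cochains cscale UNIV n"
  shows "restr \<omega> \<in> cochains cscale P n"
  unfolding cochains_def mem_Collect_eq
proof (intro conjI allI impI ballI)
  fix xs
  show "restr \<omega> xs = 0" if "\<not> (length xs = n \<and> set xs \<subseteq> P)"
    using that by (auto simp: restr_def cochains_length[OF \<omega>])
  show "restr \<omega> (xs[i := x + y]) = restr \<omega> (xs[i := x]) + restr \<omega> (xs[i := y])"
    if "length xs = n \<and> set xs \<subseteq> P" "i < n" "x \<in> P" "y \<in> P" for i x y
    using that by (simp add: restr_def set_update_P P_closed cochains_update_add[OF \<omega>])
  show "restr \<omega> (xs[i := cscale c x]) = c * restr \<omega> (xs[i := x])"
    if "length xs = n \<and> set xs \<subseteq> P" "i < n" "x \<in> P" for i x c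
    using that by (simp add: restr_def set_update_P P_closed cochains_update_scale[OF \<omega>])
  show "restr \<omega> xs = 0" if "length xs = n \<and> set xs \<subseteq> P" "j < n" "i < j" "xs ! i = xs ! j" for i j
    using that cochains_eq_zero[OF \<omega>, of i j xs] by (simp add: restr_def)
qed

lemma ce_differential_P_cong:
  assumes "set xs \<subseteq> P" "\<And>ys. set ys \<subseteq> P \<Longrightarrow> \<omega> ys = \<eta> ys"
  shows "cur.dd \<omega> xs = dP \<eta> xs"
proof -
  have "\<omega> (cbracket (xs ! i) (xs ! j) # nths xs (- {i, j})) = \<eta> (cbracket (xs ! i) (xs ! j) # nths xs (- {i, j}))"
    if "j < length xs" for i j
  proof (rule assms(2))
    have "xs ! j \<in> P" using assms(1) that by auto
    then show "set (cbracket (xs ! i) (xs ! j) # nths xs (- {i, j})) \<subseteq> P"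
      using assms(1) set_nths_subset[of xs "- {i, j}"] P_closed(3) by auto
  qed
  then show ?thesis using assms(1) by (simp add: ce_differential_def)
qed

lemma slot_sum_P_cong:
  assumes "set xs \<subseteq> P" "\<And>ys. set ys \<subseteq> P \<Longrightarrow> \<omega> ys = \<eta> ys"
  shows "slot_sum (cbracket p) \<omega> xs = slot_sum (cbracket p) \<eta> xs"
proof -
  have "\<omega> (xs[i := cbracket p (xs ! i)]) = \<eta> (xs[i := cbracket p (xs ! i)])" if "i < length xs" for i
    using assms(1) that by (intro assms(2) set_update_P P_closed(3)) auto
  then show ?thesis by (simp add: slot_sum_def)
qed

lemma cochain_action_slot_sum:
  "set xs \<subseteq> P \<Longrightarrow> cochain_action cbracket P p \<omega> xs = - slot_sum (cbracket p) \<omega> xs"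
  by (simp add: cochain_action_def slot_sum_def)

text \<open>Lets primitives be built on the whole current algebra. Restricting the primitive
  suffices, because the differential on lists in \<open>P\<close> evaluates it only on lists in
  \<open>P\<close>.\<close>

lemma coboundary_on_P:
  assumes "\<zeta> \<in> cochains cscale UNIV m" "\<And>xs. set xs \<subseteq> P \<Longrightarrow> \<omega> xs = cur.dd \<zeta> xs"
    and "\<And>xs. \<not> set xs \<subseteq> P \<Longrightarrow> \<omega> xs = 0"
  shows "\<omega> \<in> coboundaries cscale cbracket P (Suc m)"
proof -
  have "\<omega> xs = dP (restr \<zeta>) xs" for xs
  proof (cases "set xs \<subseteq> P")
    case True
    then have "cur.dd \<zeta> xs = dP (restr \<zeta>) xs" by (intro ce_differential_P_cong) (auto simp: restr_def)
    then show ?thesis using assms(2) True by simp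
  next
    case False
    then show ?thesis using assms(3) by (simp add: ce_differential_def)
  qed
  then have "\<omega> = dP (restr \<zeta>)" by (rule ext)
  then show ?thesis using restr_cochains[OF assms(1)] by simp
qed

lemma cochain_action_coboundaries:
  assumes "\<omega> \<in> coboundaries cscale cbracket P n"
  shows "cochain_action cbracket P p \<omega> \<in> coboundaries cscale cbracket P n"
proof (cases n)
  case 0
  then have "cochain_action cbracket P p \<omega> = 0" using assms by (simp add: cochain_action_def fun_eq_iff)
  then show ?thesis using 0 by simp
next
  case (Suc m)
  then obtain \<eta> where \<eta>: "\<eta> \<in> cochains cscale P m" "\<omega> = dP \<eta>" using assms by auto
  note e = extension_cochains[OF \<eta>(1)]
  show ?thesis
    unfolding Suc
  proof (rule coboundary_on_P)
    show "- slot_sum (cbracket p) (extension \<eta>) \<in> cochains cscale UNIV m"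
      by (intro cochains_uminus slot_sum_cochains e cur.linear_bracket)
    fix xs
    show "cochain_action cbracket P p \<omega> xs = cur.dd (- slot_sum (cbracket p) (extension \<eta>)) xs" if "set xs \<subseteq> P"
    proof -
      have "slot_sum (cbracket p) \<omega> xs = slot_sum (cbracket p) (cur.dd (extension \<eta>)) xs"
        using that by (intro slot_sum_P_cong) (auto simp: \<eta> extension_eq intro: ce_differential_P_cong[symmetric])
      then show ?thesis
        using that by (simp add: cochain_action_slot_sum ce_differential_uminus
            cur.ce_differential_slot_sum_bracket[OF e])
    qed
    show "cochain_action cbracket P p \<omega> xs = 0" if "\<not> set xs \<subseteq> P"
      using that by (simp add: cochain_action_def)
  qed
qed

text \<open>On cochains that vanish on constants, the anticommutator of the differential with the
  homotopy is the Euler derivation corrected by the Casimir operator of the constants.\<close>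

lemma homotopy_extension:
  assumes \<omega>: "\<omega> \<in> cocycles cscale cbracket P n" and xs: "set xs \<subseteq> P"
  shows "current_homotopy (cur.dd (extension \<omega>)) xs =
    - (\<Sum>b\<in>B. slot_sum (cbracket [:b:]) (slot_sum (cbracket [:star b:]) (extension \<omega>)) xs)"
proof -
  have c: "\<omega> \<in> cochains cscale P n" and z: "dP \<omega> = 0" using \<omega> by (auto simp: cocycles_def)
  note e = extension_cochains[OF c]
  note de = cur.ce_differential_cochains[OF e]
  note se = slot_sum_cochains[OF e cur.linear_bracket]
  define N where "N = sum_list (map degree xs)"
  have deg: "degree x \<le> N" if "x \<in> set xs" for x
    using that unfolding N_def by (intro member_le_sum_list) auto
  have d0: "cur.dd (extension \<omega>) ys = 0" if "set ys \<subseteq> P" for ys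
    using ce_differential_P_cong[OF that, of "extension \<omega>" \<omega>] z by (simp add: extension_eq)
  \<comment> \<open>Cartan's formula with vanishing insertion: on a constant the differential of the
    extension is a pure Lie derivative.\<close>
  have dc: "cur.dd (extension \<omega>) ([:v:] # ys) = - slot_sum (cbracket [:v:]) (extension \<omega>) ys" for v ys
  proof -
    have "ins [:v:] (extension \<omega>) = 0" by (simp add: fun_eq_iff ins_def extension_const[OF c])
    then show ?thesis by (simp add: cur.ce_differential_Cons[OF e])
  qed
  \<comment> \<open>The form to which Casimir invariance is applied: u t^k occupies slot
    \<open>i\<close>, and the constant \<open>v\<close> acts by its slot sum.\<close>
  define \<gamma> where "\<gamma> i k u v = slot_sum (cbracket [:v:]) (extension \<omega>) (xs[i := monom u k])" for i k u v
  \<comment> \<open>The positive part of \<open>y\<close> drops out because the differential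
    vanishes on \<open>P\<close>. Swapping the constant to the front costs a sign, which cancels the
    sign in \<open>dc\<close>.\<close>
  have step: "cur.dd (extension \<omega>) (monom b k # xs[i := y]) = \<gamma> i k b (coeff y 0)"
    if "i < length xs" "1 \<le> k" for b k i y
  proof -
    have m: "monom b k \<in> P" using that by (simp add: positive_currents_def)
    have "y = pos_part y + [:coeff y 0:]" by (simp add: pos_part_def)
    then have "cur.dd (extension \<omega>) (monom b k # xs[i := y]) =
        cur.dd (extension \<omega>) ((monom b k # xs)[Suc i := pos_part y + [:coeff y 0:]])"
      by (metis list_update_code(3))
    also have "\<dots> = cur.dd (extension \<omega>) (monom b k # xs[i := pos_part y]) + cur.dd (extension \<omega>) (monom b k # xs[i := [:coeff y 0:]])"
      using cochains_update_add[OF de, of "Suc i" "monom b k # xs"] that by simp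
    also have "cur.dd (extension \<omega>) (monom b k # xs[i := pos_part y]) = 0"
      using m xs by (intro d0) (simp add: set_update_P pos_part(3))
    also have "cur.dd (extension \<omega>) (monom b k # xs[i := [:coeff y 0:]]) = \<gamma> i k b (coeff y 0)"
      using that by (simp add: cochains_swap[OF de, of _ _ "monom b k"] dc \<gamma>_def)
    finally show ?thesis by simp
  qed
  have bil: "bilinear_form scale (\<gamma> i k)" if "i < length xs" for i k
  proof -
    have "cbracket [:v + w:] = (\<lambda>z. cbracket [:v:] z + cbracket [:w:] z)"
      "cbracket [:scale r v:] = (\<lambda>z. cscale r (cbracket [:v:] z))" for v w r
      by (intro ext, simp only: const_hom cur.bracket_add_left cur.bracket_scale_left)+
    then show ?thesis
      using that unfolding bilinear_form_def \<gamma>_def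
      by (simp add: add_monom[symmetric] current_scale_monom[symmetric] cochains_update_add[OF se]
          cochains_update_scale[OF se] cur.slot_sum_add_op[OF e] cur.slot_sum_scale_op[OF e])
  qed
  have inv: "(\<Sum>b\<in>B. \<gamma> i k b (bracket (star b) y)) = - (\<Sum>b\<in>B. \<gamma> i k (bracket b y) (star b))"
    if "i < length xs" for i k y
  proof -
    have n: "\<gamma> i k (- u) v = - \<gamma> i k u v" "\<gamma> i k u (- v) = - \<gamma> i k u v" for u v
    proof -
      have "\<gamma> i k (scale (- 1) u) v = (- 1) * \<gamma> i k u v" "\<gamma> i k u (scale (- 1) v) = (- 1) * \<gamma> i k u v"
        using bil[OF that, of k] unfolding bilinear_form_def by blast+
      then show "\<gamma> i k (- u) v = - \<gamma> i k u v" "\<gamma> i k u (- v) = - \<gamma> i k u v" by simp_all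
    qed
    have "(\<Sum>b\<in>B. \<gamma> i k b (bracket (star b) y)) = - (\<Sum>b\<in>B. \<gamma> i k b (bracket y (star b)))"
      by (simp add: bracket_antisym[of "star _" y] n sum_negf)
    also have "\<dots> = (\<Sum>b\<in>B. \<gamma> i k (bracket y b) (star b))"
      by (simp add: casimir_invariant[OF bil[OF that]])
    also have "\<dots> = - (\<Sum>b\<in>B. \<gamma> i k (bracket b y) (star b))"
      by (simp add: bracket_antisym[of y] n sum_negf)
    finally show ?thesis .
  qed
  \<comment> \<open>An entry of \<open>xs\<close> has no constant term and degree at most
    \<open>N\<close>, so the modes \<open>k = 1..N\<close> see all its coefficients and reassemble
    its bracket with \<open>b\<close>.\<close>
  have col: "(\<Sum>k=1..N. \<gamma> i k (bracket b (coeff (xs ! i) k)) (star b)) =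
      slot_sum (cbracket [:star b:]) (extension \<omega>) (xs[i := cbracket [:b:] (xs ! i)])"
    if i: "i < length xs" for i b
  proof -
    have p: "coeff (xs ! i) 0 = 0" using xs i by (auto simp: positive_currents_def dest: nth_mem)
    have "cbracket [:b:] (xs ! i) = (\<Sum>k=1..N. monom (bracket b (coeff (xs ! i) k)) k)"
    proof (rule poly_eqI)
      fix j
      have "coeff (xs ! i) j = 0" if "j \<notin> {1..N}"
        using that p deg[OF nth_mem[OF i]] by (cases "j = 0") (auto intro: coeff_eq_0)
      then show "coeff (cbracket [:b:] (xs ! i)) j = coeff (\<Sum>k=1..N. monom (bracket b (coeff (xs ! i) k)) k) j"
        by (auto simp: current_bracket_const coeff_map_poly coeff_sum)
    qed
    then show ?thesis
      unfolding \<gamma>_def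
      using additive_sum[of "\<lambda>y. slot_sum (cbracket [:star b:]) (extension \<omega>) (xs[i := y])"
          "\<lambda>k. monom (bracket b (coeff (xs ! i) k)) k" "{1..N}"] cochains_update_add[OF se i]
      by simp
  qed
  have "current_homotopy (cur.dd (extension \<omega>)) xs =
    (\<Sum>k=1..N. \<Sum>b\<in>B. \<Sum>i<length xs. cur.dd (extension \<omega>) (monom b k # xs[i := contraction (k, b) (xs ! i)]))"
    by (simp add: current_homotopy_def cur.insertion_homotopy_def sum_modes N_def slot_sum_def ins_def mode_def)
  also have "\<dots> = (\<Sum>k=1..N. \<Sum>b\<in>B. \<Sum>i<length xs. \<gamma> i k b (bracket (star b) (coeff (xs ! i) k)))"
    by (intro sum.cong refl) (simp add: step)
  also have "\<dots> = (\<Sum>i<length xs. \<Sum>k=1..N. \<Sum>b\<in>B. \<gamma> i k b (bracket (star b) (coeff (xs ! i) k)))"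
    by (subst sum.swap[of _ _ B], subst sum.swap[of _ "{..<length xs}"]) (rule refl)
  also have "\<dots> = (\<Sum>i<length xs. \<Sum>k=1..N. - (\<Sum>b\<in>B. \<gamma> i k (bracket b (coeff (xs ! i) k)) (star b)))"
    by (intro sum.cong refl inv) simp
  also have "\<dots> = - (\<Sum>i<length xs. \<Sum>b\<in>B. \<Sum>k=1..N. \<gamma> i k (bracket b (coeff (xs ! i) k)) (star b))"
    by (simp only: sum_negf sum.swap[of _ B])
  also have "\<dots> = - (\<Sum>b\<in>B. slot_sum (cbracket [:b:]) (slot_sum (cbracket [:star b:]) (extension \<omega>)) xs)"
    unfolding slot_sum_def[of "cbracket [:_:]" "slot_sum _ _"] sum.swap[of _ B]
    by (intro arg_cong[of _ _ uminus] sum.cong refl col) simp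
  finally show ?thesis .
qed

text \<open>In the homotopy identity for the extended cocycle, the obstruction is the term with h d.
  By \<open>homotopy_extension\<close> it is a sum of iterated Lie derivatives, and exactness of the
  inner ones makes it exact on \<open>P\<close>.\<close>

lemma invariant_cocycle_coboundary:
  assumes \<omega>: "\<omega> \<in> cocycles cscale cbracket P (Suc m)"
    and inv: "\<And>x. cochain_action cbracket P [:x:] \<omega> \<in> coboundaries cscale cbracket P (Suc m)"
  shows "\<omega> \<in> coboundaries cscale cbracket P (Suc m)"
proof -
  have c: "\<omega> \<in> cochains cscale P (Suc m)" using \<omega> by (auto simp: cocycles_def)
  note e = extension_cochains[OF c]
  have "\<forall>b. \<exists>\<eta>\<in>cochains cscale P m. cochain_action cbracket P [:star b:] \<omega> = dP \<eta>"
    using inv by auto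
  then obtain \<eta> where \<eta>: "\<And>b. \<eta> b \<in> cochains cscale P m"
    "\<And>b. cochain_action cbracket P [:star b:] \<omega> = dP (\<eta> b)" by metis
  note e\<eta> = extension_cochains[OF \<eta>(1)]
  have s: "slot_sum (cbracket [:star b:]) (extension \<omega>) xs = (- cur.dd (extension (\<eta> b))) xs" if "set xs \<subseteq> P" for b xs
  proof -
    have "slot_sum (cbracket [:star b:]) (extension \<omega>) xs = slot_sum (cbracket [:star b:]) \<omega> xs"
      using that by (intro slot_sum_P_cong) (auto simp: extension_eq)
    moreover have "cur.dd (extension (\<eta> b)) xs = dP (\<eta> b) xs"
      using that by (intro ce_differential_P_cong) (auto simp: extension_eq)
    ultimately show ?thesis
      using cochain_action_slot_sum[OF that, of "[:star b:]" \<omega>] by (simp add: \<eta>(2))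
  qed
  \<comment> \<open>The minus signs of the dual action and of \<open>homotopy_extension\<close>
    cancel, so this is a primitive of the h d term without sign.\<close>
  define \<zeta> where "\<zeta> xs = (\<Sum>b\<in>B. slot_sum (cbracket [:b:]) (extension (\<eta> b)) xs)" for xs
  have \<zeta>: "\<zeta> \<in> cochains cscale UNIV m"
    unfolding \<zeta>_def[abs_def] by (intro cochains_sum slot_sum_cochains e\<eta> cur.linear_bracket)
  have hd: "current_homotopy (cur.dd (extension \<omega>)) xs = cur.dd \<zeta> xs" if "set xs \<subseteq> P" for xs
  proof -
    have "slot_sum (cbracket [:b:]) (slot_sum (cbracket [:star b:]) (extension \<omega>)) xs =
        - cur.dd (slot_sum (cbracket [:b:]) (extension (\<eta> b))) xs" for b
    proof -
      have "slot_sum (cbracket [:b:]) (slot_sum (cbracket [:star b:]) (extension \<omega>)) xs =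
          slot_sum (cbracket [:b:]) (- cur.dd (extension (\<eta> b))) xs"
        using that by (intro slot_sum_P_cong s) auto
      then show ?thesis by (simp add: slot_sum_uminus cur.ce_differential_slot_sum_bracket[OF e\<eta>])
    qed
    then show ?thesis
      unfolding homotopy_extension[OF \<omega> that] \<zeta>_def[abs_def] ce_differential_sum by (simp add: sum_negf)
  qed
  show ?thesis
  proof (rule coboundary_on_P)
    have h: "radial (current_homotopy (extension \<omega>)) \<in> cochains cscale UNIV m"
      using current_homotopy_cochains[OF e] by (intro radial_cochains) simp
    then show "- (radial (current_homotopy (extension \<omega>)) + radial \<zeta>) \<in> cochains cscale UNIV m"
      by (intro cochains_uminus cochains_add radial_cochains[OF \<zeta>])
    fix xs
    show "\<omega> xs = 0" if "\<not> set xs \<subseteq> P" using c that by (auto simp: cochains_def)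
    show "\<omega> xs = cur.dd (- (radial (current_homotopy (extension \<omega>)) + radial \<zeta>)) xs" if xs: "set xs \<subseteq> P"
    proof -
      \<comment> \<open>Agreement on lists in \<open>P\<close> is enough because dilations preserve
        \<open>P\<close>.\<close>
      have "radial (current_homotopy (cur.dd (extension \<omega>))) xs = radial (cur.dd \<zeta>) xs"
        using xs by (intro radial_cong hd) (auto simp: P_closed(4))
      then have "cur.dd (radial (current_homotopy (extension \<omega>))) xs + cur.dd (radial \<zeta>) xs =
          - (extension \<omega> xs - extension \<omega> (map (dilate 0) xs))"
        using radial_homotopy[OF e, of xs] by (simp add: radial_ce_differential[OF \<zeta>])
      \<comment> \<open>A nonempty list now starts with a constant, where the extension vanishes; on
        the empty list it vanishes because the degree is \<open>Suc m\<close>.\<close>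
      moreover have "extension \<omega> (map (dilate 0) xs) = 0"
        using extension_const[OF c] cochains_length[OF e, of "[]"] by (cases xs) (simp_all add: dilate_0)
      ultimately have "\<omega> xs = - (cur.dd (radial (current_homotopy (extension \<omega>))) xs + cur.dd (radial \<zeta>) xs)"
        using xs by (simp add: extension_eq)
      then show ?thesis by (simp add: ce_differential_uminus ce_differential_add ce_differential_diff)
    qed
  qed
qed

theorem invariant_classes_trivial:
  "cohomology_invariants cscale cbracket constant_currents P (Suc m) = {coboundaries cscale cbracket P (Suc m)}"
proof -
  let ?B = "coboundaries cscale cbracket P (Suc m)"
  have a: "cochain_action cbracket P p (\<omega> + \<eta>) = cochain_action cbracket P p \<omega> + cochain_action cbracket P p \<eta>"
    for p and \<omega> \<eta> :: "'a poly list \<Rightarrow> 'k"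
    by (simp add: fun_eq_iff cochain_action_def sum.distrib)
  have act: "on_classes ?B (cochain_action cbracket P p) (\<omega> +o ?B) = cochain_action cbracket P p \<omega> +o ?B" for p \<omega>
    by (rule on_classes_coset[OF a cochain_action_coboundaries])
  show ?thesis
  proof (intro equalityI subsetI)
    fix X assume X: "X \<in> cohomology_invariants cscale cbracket constant_currents P (Suc m)"
    then obtain \<omega> where \<omega>: "\<omega> \<in> cocycles cscale cbracket P (Suc m)" "X = \<omega> +o ?B"
      by (auto simp: cohomology_invariants_def cohomology_def)
    have "cochain_action cbracket P [:x:] \<omega> \<in> ?B" for x
    proof -
      have "on_classes ?B (cochain_action cbracket P [:x:]) X = ?B"
        using X by (simp add: cohomology_invariants_def constant_currents_def)
      then show ?thesis unfolding \<omega>(2) act coset_eq_coboundaries_iff .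
    qed
    then have "\<omega> \<in> ?B" by (rule invariant_cocycle_coboundary[OF \<omega>(1)])
    then show "X \<in> {?B}" unfolding \<omega>(2) singleton_iff coset_eq_coboundaries_iff .
  next
    fix X assume "X \<in> {?B}"
    then have X: "X = 0 +o ?B" by (simp only: zero_coset singleton_iff)
    have "0 \<in> cocycles cscale cbracket P (Suc m)" by (simp add: cocycles_def)
    moreover have "cochain_action cbracket P p 0 = (0 :: 'a poly list \<Rightarrow> 'k)" for p
      by (simp add: fun_eq_iff cochain_action_def)
    ultimately show "X \<in> cohomology_invariants cscale cbracket constant_currents P (Suc m)"
      unfolding cohomology_invariants_def cohomology_def X mem_Collect_eq act
      by (intro conjI ballI imageI) (simp_all only: zero_coset)
  qed
qed

end

theorem theorem3p4p1:
  fixes scale :: "complex \<Rightarrow> 'g::ab_group_add \<Rightarrow> 'g"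
    and bracket :: "'g \<Rightarrow> 'g \<Rightarrow> 'g"
    and Basis :: "'g set"
  assumes "simple_lie_algebra scale bracket"
    and "finite_dimensional_vector_space scale Basis"
  shows "(\<forall>i\<ge>1.
      cohomology_invariants (current_scale scale) (current_bracket bracket)
        constant_currents positive_currents i
      = {coboundaries (current_scale scale) (current_bracket bracket) positive_currents i})
    \<and>
    (\<forall>n.
      linear_iso
        (class_scale (coboundaries (current_scale scale) (current_bracket bracket) UNIV n))
        (cohomology (current_scale scale) (current_bracket bracket) UNIV n)
        (class_scale (coboundaries scale bracket UNIV n))
        (cohomology scale bracket UNIV n)
        (on_classes (coboundaries scale bracket UNIV n) (pullback UNIV (\<lambda>x. [:x:]))))"
proof -
  interpret simple_lie_algebra scale bracket by fact
  interpret finite_dimensional_vector_space scale Basis by fact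
  interpret simple_complex_lie_algebra scale bracket Basis ..
  obtain star where "casimir_lie_algebra scale bracket Basis star" using casimir_exists by blast
  then interpret casimir_lie_algebra scale bracket Basis star .
  show ?thesis
  proof (intro conjI allI impI)
    fix i :: nat assume "1 \<le> i"
    then obtain m where "i = Suc m" by (cases i) auto
    then show "cohomology_invariants (current_scale scale) (current_bracket bracket)
        constant_currents positive_currents i
      = {coboundaries (current_scale scale) (current_bracket bracket) positive_currents i}"
      using invariant_classes_trivial by simp
  qed (rule restriction_iso)
qed

end
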